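(* Let $n\ge 2$ and $R>0$, let $(S^n_R,g)$ be the round $n$-sphere of radius $R$, and let $p\in S^n_R$. Then there exist a radius $r_0$ with $0<r_0<\pi R/2$, a function $f\in L^2(S^n_R)$ that is nonnegative, radially symmetric about $p$ (i.e. $f(x)$ depends only on $d_g(p,x)$), supported in the geodesic ball $C=B_g(p,r_0)$ of radius $r_0$ centered at $p$, positive in the interior of $C$, with $\operatorname{tconv}(\operatorname{supp} f)=C$, and a constant $k>0$, such that the quadrature surface problem $QS(f,k)$ admits a solution $\Omega$ strictly containing $C$ (that is, $C\subsetneq\Omega$), while $$\int_C f\,dv(g) < k\,|\partial C|_g.$$
   Context: Notation: $dv(g)$ is the Riemannian volume element, $|\partial C|_g$ the perimeter ($(n-1)$-dimensional measure of the boundary), $\nabla_g$ the Riemannian gradient, $\Delta_g$ the Laplace--Beltrami operator, $d_g$ the Riemannian distance. Here $B_g(p,r_0)$ is taken closed when regarded as the hull $C$. Totally convex hull: for compact $K$, $\operatorname{tconv}(K)$ is the smallest closed subset of the manifold containing $K$ with the property that every minimizing geodesic joining two of its points is entirely contained in it. Problem $QS(f,k)$: find a domain $\Omega\subset S^n_R$ with $\operatorname{supp} f\subset\Omega$ and a function $u_\Omega\in H^1_0(\Omega)$ such that $-\Delta_g u_\Omega=f$ in $\Omega$, $u_\Omega=0$ on $\partial\Omega$, and $|\nabla_g u_\Omega|_g=k$ on $\partial\Omega$. Such an $\Omega$ is called a solution of $QS(f,k)$. *)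

theory Defs
  imports "HOL-Analysis.Analysis"
begin

text \<open>
  The round sphere \<open>S\<^sup>n\<^sub>R\<close> is \<open>sphere 0 R\<close> in a Euclidean space \<open>'a\<close> with \<open>DIM('a) = n + 1\<close>,
  carrying the metric induced by the embedding. Tangent vectors at \<open>x\<close> are the ambient vectors
  orthogonal to \<open>x\<close>. Functions and fields are total on \<open>'a\<close>; only their values on the sphere matter.
\<close>

abbreviation sph_top :: "real \<Rightarrow> 'a::euclidean_space topology" where
  "sph_top R \<equiv> top_of_set (sphere 0 R)"


section \<open>Riemannian distance, geodesics and totally convex hulls\<close>

text \<open>
  The predicate \<^const>\<open>valid_path\<close> does not bound the derivative near the break points, so integrability
  of the speed (finite length) has to be required: otherwise a curve of infinite length would be
  assigned the default value 0 of the integral.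
\<close>

definition sph_curve :: "real \<Rightarrow> (real \<Rightarrow> 'a::euclidean_space) \<Rightarrow> bool" where
  "sph_curve R \<gamma> \<longleftrightarrow> valid_path \<gamma> \<and> path_image \<gamma> \<subseteq> sphere 0 R \<and>
     (\<lambda>t. norm (vector_derivative \<gamma> (at t))) integrable_on {0..1}"

definition curve_length :: "(real \<Rightarrow> 'a::euclidean_space) \<Rightarrow> real" where
  "curve_length \<gamma> = integral {0..1} (\<lambda>t. norm (vector_derivative \<gamma> (at t)))"

definition sph_dist :: "real \<Rightarrow> 'a::euclidean_space \<Rightarrow> 'a \<Rightarrow> real" where
  "sph_dist R x y =
     Inf {curve_length \<gamma> | \<gamma>. sph_curve R \<gamma> \<and> pathstart \<gamma> = x \<and> pathfinish \<gamma> = y}"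

definition geodesic_cball :: "real \<Rightarrow> 'a::euclidean_space \<Rightarrow> real \<Rightarrow> 'a set" where
  "geodesic_cball R p r = {x \<in> sphere 0 R. sph_dist R p x \<le> r}"

definition minimizing_geodesic :: "real \<Rightarrow> (real \<Rightarrow> 'a::euclidean_space) \<Rightarrow> bool" where
  "minimizing_geodesic R c \<longleftrightarrow> c ` {0..1} \<subseteq> sphere 0 R \<and>
     (\<forall>s\<in>{0..1}. \<forall>t\<in>{0..1}. sph_dist R (c s) (c t) = \<bar>s - t\<bar> * sph_dist R (c 0) (c 1))"

definition totally_convex :: "real \<Rightarrow> 'a::euclidean_space set \<Rightarrow> bool" where
  "totally_convex R A \<longleftrightarrow>
     (\<forall>c. minimizing_geodesic R c \<and> c 0 \<in> A \<and> c 1 \<in> A \<longrightarrow> c ` {0..1} \<subseteq> A)"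

definition tconv :: "real \<Rightarrow> 'a::euclidean_space set \<Rightarrow> 'a set" where
  "tconv R K = \<Inter> {A. closedin (sph_top R) A \<and> K \<subseteq> A \<and> totally_convex R A}"


section \<open>Riemannian volume and perimeter\<close>

text \<open>
  The volume element of the sphere of radius \<open>R\<close> in dimension \<open>N = DIM('a) = n + 1\<close>, obtained from
  polar coordinates: spheres of radius \<open>t\<close> scale like \<open>(t / R)\<^sup>n\<close>, so the Lebesgue measure of the cone
  \<open>{t x | 0 < t \<le> 1, x \<in> A}\<close> over \<open>A\<close> is \<open>R / N\<close> times the volume of \<open>A\<close>.
\<close>

definition sph_vol :: "real \<Rightarrow> 'a::euclidean_space measure" where
  "sph_vol R = scale_measure (ennreal (real DIM('a) / R))
     (distr (restrict_space lborel (cball 0 R - {0})) (restrict_space borel (sphere 0 R))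
        (\<lambda>x. (R / norm x) *\<^sub>R x))"

text \<open>
  The \<open>m\<close>-dimensional Hausdorff (outer) measure for \<open>m \<ge> 1\<close>, normalized so that it is the
  \<open>m\<close>-dimensional Riemannian measure on smooth \<open>m\<close>-dimensional submanifolds.
\<close>

definition hausdorff_meas :: "nat \<Rightarrow> 'a::euclidean_space set \<Rightarrow> ennreal" where
  "hausdorff_meas m A =
     (SUP \<delta>\<in>{0<..}. INF U\<in>{U :: nat \<Rightarrow> 'a set. A \<subseteq> (\<Union>i. U i) \<and>
                                  (\<forall>i. bounded (U i) \<and> diameter (U i) \<le> \<delta>)}.
        (\<Sum>i. ennreal (unit_ball_vol (real m) * (diameter (U i) / 2) ^ m)))"

definition perimeter :: "real \<Rightarrow> 'a::euclidean_space set \<Rightarrow> ennreal" where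
  "perimeter R A = hausdorff_meas (DIM('a) - 2) (sph_top R frontier_of A)"


section \<open>Function spaces on the sphere\<close>

definition L2_sphere :: "real \<Rightarrow> ('a::euclidean_space \<Rightarrow> real) \<Rightarrow> bool" where
  "L2_sphere R f \<longleftrightarrow> f \<in> borel_measurable (sph_vol R) \<and> integrable (sph_vol R) (\<lambda>x. (f x)\<^sup>2)"

text \<open>The support of an element of \<open>L\<^sup>2\<close>, independent of the representative.\<close>

definition ess_supp :: "real \<Rightarrow> ('a::euclidean_space \<Rightarrow> real) \<Rightarrow> 'a set" where
  "ess_supp R f = {x \<in> sphere 0 R.
     \<forall>U. openin (sph_top R) U \<and> x \<in> U \<longrightarrow> emeasure (sph_vol R) {y \<in> U. f y \<noteq> 0} > 0}"

definition has_sph_grad :: "real \<Rightarrow> ('a::euclidean_space \<Rightarrow> real) \<Rightarrow> 'a \<Rightarrow> 'a \<Rightarrow> bool" where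
  "has_sph_grad R u v x \<longleftrightarrow>
     v \<bullet> x = 0 \<and> (u has_derivative (\<lambda>h. v \<bullet> h)) (at x within sphere 0 R)"

definition sph_grad :: "real \<Rightarrow> ('a::euclidean_space \<Rightarrow> real) \<Rightarrow> 'a \<Rightarrow> 'a" where
  "sph_grad R u x = (THE v. has_sph_grad R u v x)"

primrec Ck :: "nat \<Rightarrow> ('a::euclidean_space \<Rightarrow> real) \<Rightarrow> bool" where
  "Ck 0 F \<longleftrightarrow> continuous_on UNIV F"
| "Ck (Suc m) F \<longleftrightarrow> (\<forall>x. F differentiable (at x)) \<and>
     (\<forall>v. Ck m (\<lambda>x. frechet_derivative F (at x) v))"

text \<open>
  Elements of \<open>C\<^sub>c\<^sup>\<infinity>(\<Omega>)\<close>, represented by smooth functions on the ambient space: every smooth function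
  on the sphere is the restriction of such a function.
\<close>

definition test_fun :: "real \<Rightarrow> 'a::euclidean_space set \<Rightarrow> ('a \<Rightarrow> real) \<Rightarrow> bool" where
  "test_fun R \<Omega> \<phi> \<longleftrightarrow> (\<forall>m. Ck m \<phi>) \<and>
     (\<exists>K. compact K \<and> K \<subseteq> \<Omega> \<and> (\<forall>x\<in>sphere 0 R - K. \<phi> x = 0))"

text \<open>
  \<open>u \<in> H\<^sup>1\<^sub>0(\<Omega>)\<close>, the closure of \<open>C\<^sub>c\<^sup>\<infinity>(\<Omega>)\<close> in the \<open>H\<^sup>1\<close> norm, together with its weak gradient \<open>G\<close>
  (the \<open>L\<^sup>2\<close> limit of the gradients).
\<close>

definition H10_with_grad ::
    "real \<Rightarrow> 'a::euclidean_space set \<Rightarrow> ('a \<Rightarrow> real) \<Rightarrow> ('a \<Rightarrow> 'a) \<Rightarrow> bool" where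
  "H10_with_grad R \<Omega> u G \<longleftrightarrow>
     set_borel_measurable (sph_vol R) \<Omega> u \<and> set_borel_measurable (sph_vol R) \<Omega> G \<and>
     (\<exists>\<phi> :: nat \<Rightarrow> 'a \<Rightarrow> real. (\<forall>j. test_fun R \<Omega> (\<phi> j)) \<and>
        (\<lambda>j. \<integral>\<^sup>+x\<in>\<Omega>. ennreal ((\<phi> j x - u x)\<^sup>2) \<partial>sph_vol R) \<longlonglongrightarrow> 0 \<and>
        (\<lambda>j. \<integral>\<^sup>+x\<in>\<Omega>. ennreal ((norm (sph_grad R (\<phi> j) x - G x))\<^sup>2) \<partial>sph_vol R) \<longlonglongrightarrow> 0)"


section \<open>The quadrature surface problem\<close>

text \<open>\<open>-\<Delta>\<^sub>g u = f\<close> in \<open>\<Omega>\<close>, in the weak sense, for \<open>u\<close> with weak gradient \<open>G\<close>.\<close>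

definition weak_poisson ::
    "real \<Rightarrow> 'a::euclidean_space set \<Rightarrow> ('a \<Rightarrow> 'a) \<Rightarrow> ('a \<Rightarrow> real) \<Rightarrow> bool" where
  "weak_poisson R \<Omega> G f \<longleftrightarrow> (\<forall>\<phi>. test_fun R \<Omega> \<phi> \<longrightarrow>
     (LINT x:\<Omega>|sph_vol R. G x \<bullet> sph_grad R \<phi> x) = (LINT x:\<Omega>|sph_vol R. f x * \<phi> x))"

text \<open>
  \<open>u = 0\<close> and \<open>|\<nabla>\<^sub>g u| = k\<close> on \<open>\<partial>\<Omega>\<close>, in the classical sense: near \<open>\<partial>\<Omega>\<close>, the function \<open>u\<close> is \<open>C\<^sup>1\<close> in
  \<open>\<Omega>\<close>, and \<open>u\<close> and its gradient extend continuously to \<open>\<partial>\<Omega>\<close> with the prescribed boundary values.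
\<close>

definition overdetermined_bc ::
    "real \<Rightarrow> 'a::euclidean_space set \<Rightarrow> ('a \<Rightarrow> real) \<Rightarrow> real \<Rightarrow> bool" where
  "overdetermined_bc R \<Omega> u k \<longleftrightarrow> (\<exists>V D. open V \<and> sph_top R frontier_of \<Omega> \<subseteq> V \<and>
     continuous_on (closure \<Omega> \<inter> V) u \<and> continuous_on (closure \<Omega> \<inter> V) D \<and>
     (\<forall>x\<in>\<Omega> \<inter> V. has_sph_grad R u (D x) x) \<and>
     (\<forall>x\<in>sph_top R frontier_of \<Omega>. u x = 0 \<and> norm (D x) = k))"

definition QS_solution ::
    "real \<Rightarrow> ('a::euclidean_space \<Rightarrow> real) \<Rightarrow> real \<Rightarrow> 'a set \<Rightarrow> bool" where
  "QS_solution R f k \<Omega> \<longleftrightarrow>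
     openin (sph_top R) \<Omega> \<and> connected \<Omega> \<and> \<Omega> \<noteq> {} \<and> ess_supp R f \<subseteq> \<Omega> \<and>
     (\<exists>u G. H10_with_grad R \<Omega> u G \<and> weak_poisson R \<Omega> G f \<and> overdetermined_bc R \<Omega> u k)"

end

theory Submission
  imports Defs "HOL-Real_Asymp.Real_Asymp"
begin

text \<open>
  Write \<open>h x = (x \<bullet> p) / R\<^sup>2\<close> for the cosine of the angle at the centre between \<open>x\<close> and \<open>p\<close>. Geodesic
  balls about \<open>p\<close> are the caps \<open>h \<ge> c\<close>, with boundary of size proportional to
  \<open>(1 - c\<^sup>2)\<close> to the power \<open>(n - 1) / 2\<close>. Beyond the equator caps grow while their boundaries shrink,
  and this is what makes the inequality possible: by Green's formula a radial solution on the cap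
  \<open>\<Omega> = {h > a}\<close> has \<open>\<integral> f = k |\<partial>\<Omega>|\<close>, and for \<open>a\<close> close to \<open>-1\<close> the boundary of \<open>\<Omega>\<close> is much shorter
  than that of \<open>C = {h \<ge> c}\<close>. Here \<open>c = 1/2\<close>, that is \<open>r\<^sub>0 = \<pi> R / 3\<close>.

  The solution is explicit. For \<open>u = F h\<close> with \<open>w = F'\<close> the equation becomes
  \<open>n s w s - (1 - s\<^sup>2) w' s = R\<^sup>2 f\<close> at \<open>s = h x\<close>. The right-hand side vanishes exactly when \<open>w\<close> is a
  multiple of \<open>(1 - s\<^sup>2)\<close> to the power \<open>- n / 2\<close>; past \<open>s = c\<close> this \<open>w\<close> is continued along its tangent
  line, and convexity makes the resulting source positive for \<open>s > c\<close> (lemma \<open>source_sign\<close>). So one and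
  the same continuous \<open>f\<close>, supported in \<open>C\<close>, is solved on every cap \<open>\<Omega> = {h > a}\<close> by the
  antiderivative of \<open>w\<close> that vanishes at \<open>a\<close> (lemma \<open>cap_QS_solution\<close>), with boundary slope
  \<open>k = w a sqrt (1 - a\<^sup>2) / R\<close>. Since \<open>k\<close> tends to infinity as \<open>a\<close> tends to \<open>-1\<close> while \<open>f\<close>
  does not depend on \<open>a\<close>, the inequality only requires the perimeter of \<open>C\<close> to be positive; its value
  never has to be computed.

  Four facts about the sphere carry the verification. The distance is
  \<open>R arccos (x \<bullet> y / R\<^sup>2)\<close> (\<open>sph_dist_eq\<close>), which identifies balls with caps and gives total
  convexity of caps smaller than a hemisphere. A parallel has positive Hausdorff measure
  (\<open>parallel_hausdorff_pos\<close>), by comparison with Lebesgue measure of a solid swept out by it. The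
  divergence theorem for fields \<open>q \<nabla>h\<close> (\<open>sphere_divergence_theorem\<close>) follows from the vanishing of
  integrals of directional derivatives in the ambient space, because the volume of the sphere is
  defined by cones. Finally, \<open>F h\<close> lies in \<open>H\<^sup>1\<^sub>0\<close> (\<open>H10_profile\<close>): approximate \<open>F\<close> by polynomials and cut
  off near its zero with a smooth flat function.
\<close>

section \<open>The Riemannian distance on the sphere\<close>

lemma sph_inner_bound:
  fixes x y :: "'a::euclidean_space"
  assumes "R > 0" "x \<in> sphere 0 R" "y \<in> sphere 0 R"
  shows "\<bar>x \<bullet> y / R\<^sup>2\<bar> \<le> 1"
  using Cauchy_Schwarz_ineq2[of x y] assms by (simp add: power2_eq_square)

text \<open>
  The velocity is orthogonal to \<open>\<gamma> t\<close>, so only the component of \<open>x\<close> tangent at \<open>\<gamma> t\<close> contributes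
  to \<open>v \<bullet> x\<close>; that component is shorter than \<open>x\<close> by the sine of the angle.
\<close>

lemma sph_curve_speed_bound:
  fixes \<gamma> :: "real \<Rightarrow> 'a::euclidean_space"
  assumes R: "R > 0" and im: "\<gamma> ` {0..1} \<subseteq> sphere 0 R" and t: "t \<in> {0<..<1}"
    and x: "x \<in> sphere 0 R" and d: "(\<gamma> has_vector_derivative v) (at t)"
  shows "\<bar>v \<bullet> x / R\<^sup>2\<bar> \<le> norm v * sqrt (1 - (\<gamma> t \<bullet> x / R\<^sup>2)\<^sup>2) / R"
proof -
  define c where "c = \<gamma> t \<bullet> x / R\<^sup>2"
  have nx: "x \<bullet> x = R\<^sup>2"
    using x by (auto simp: power2_norm_eq_inner[symmetric])
  have ng: "\<gamma> s \<bullet> \<gamma> s = R\<^sup>2" if "s \<in> {0..1}" for s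
  proof -
    have "\<gamma> s \<in> sphere 0 R" using im that by blast
    then show ?thesis by (simp add: power2_norm_eq_inner[symmetric])
  qed
  have "((\<lambda>s. \<gamma> s \<bullet> \<gamma> s) has_vector_derivative (\<gamma> t \<bullet> v + v \<bullet> \<gamma> t)) (at t)"
    using d unfolding has_vector_derivative_def
    by (auto intro!: derivative_eq_intros simp: algebra_simps)
  moreover have "((\<lambda>s. \<gamma> s \<bullet> \<gamma> s) has_vector_derivative 0) (at t)"
    by (rule has_vector_derivative_transform_within_open[where S="{0<..<1}" and f = "\<lambda>_. R\<^sup>2"])
       (use t ng in auto)
  ultimately have "\<gamma> t \<bullet> v + v \<bullet> \<gamma> t = 0" by (rule vector_derivative_unique_at)
  then have orth: "v \<bullet> \<gamma> t = 0" by (simp add: inner_commute)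
  have gx: "\<gamma> t \<bullet> x = c * R\<^sup>2" using R by (simp add: c_def)
  have "(norm (x - c *\<^sub>R \<gamma> t))\<^sup>2 = R\<^sup>2 * (1 - c\<^sup>2)"
    using nx ng[of t] t gx
    by (simp add: power2_norm_eq_inner inner_diff_left inner_diff_right inner_commute[of x "\<gamma> t"])
       (simp add: algebra_simps power2_eq_square)
  then have n: "norm (x - c *\<^sub>R \<gamma> t) = R * sqrt (1 - c\<^sup>2)"
    by (metis R norm_ge_zero order_less_imp_le real_sqrt_abs real_sqrt_mult real_sqrt_unique abs_of_nonneg)
  have "v \<bullet> x = v \<bullet> (x - c *\<^sub>R \<gamma> t)" using orth by (simp add: inner_diff_right)
  then have "\<bar>v \<bullet> x\<bar> \<le> norm v * (R * sqrt (1 - c\<^sup>2))"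
    using Cauchy_Schwarz_ineq2[of v "x - c *\<^sub>R \<gamma> t"] n by simp
  then show ?thesis using R unfolding c_def[symmetric]
    by (simp add: field_simps power2_eq_square)
qed

text \<open>
  The angle to \<open>x\<close> changes at most at the rate \<open>norm \<gamma>' / R\<close>. Since \<open>arccos\<close> is not differentiable
  at \<open>1\<close> and \<open>-1\<close>, where the curve starts and may return, the estimate is made for
  \<open>arccos (r c)\<close> with \<open>r < 1\<close>, whose speed obeys the same bound, and then \<open>r\<close> tends to \<open>1\<close>.
\<close>

lemma curve_length_ge:
  fixes \<gamma> :: "real \<Rightarrow> 'a::euclidean_space"
  assumes R: "R > 0" and c: "sph_curve R \<gamma>" "pathstart \<gamma> = x" "pathfinish \<gamma> = y"
  shows "R * arccos (x \<bullet> y / R\<^sup>2) \<le> curve_length \<gamma>"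
proof -
  define c where "c = (\<lambda>t. \<gamma> t \<bullet> x / R\<^sup>2)"
  define D where "D = (\<lambda>t. vector_derivative \<gamma> (at t))"
  have im: "\<gamma> ` {0..1} \<subseteq> sphere 0 R" and vp: "valid_path \<gamma>"
    and int: "(\<lambda>t. norm (D t)) integrable_on {0..1}"
    using c by (auto simp: sph_curve_def path_image_def D_def)
  have x: "x = \<gamma> 0" "y = \<gamma> 1" using c by (auto simp: pathstart_def pathfinish_def)
  have xs: "x \<in> sphere 0 R" using im x by (auto simp: image_subset_iff)
  obtain S where S: "finite S" "\<gamma> C1_differentiable_on {0..1} - S" and cont: "continuous_on {0..1} \<gamma>"
    using vp by (auto simp: valid_path_def piecewise_C1_differentiable_on_def)
  have d: "(\<gamma> has_vector_derivative D t) (at t)" if "t \<in> {0..1} - S" for t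
    using S(2) that unfolding C1_differentiable_on_eq D_def
    by (auto simp: vector_derivative_works[symmetric])
  have cb: "\<bar>c t\<bar> \<le> 1" if "t \<in> {0..1}" for t
  proof -
    have "\<gamma> t \<in> sphere 0 R" using im that by blast
    then show ?thesis using sph_inner_bound[OF R _ xs, of "\<gamma> t"] by (simp add: c_def)
  qed
  have c0: "c 0 = 1" using xs R x by (simp add: c_def power2_norm_eq_inner[symmetric])
  have c1: "c 1 = x \<bullet> y / R\<^sup>2" using x by (simp add: c_def inner_commute)
  have main: "arccos (r * c 1) - arccos r \<le> curve_length \<gamma> / R" if r: "0 < r" "r < 1" for r
  proof -
    define g' where "g' = (\<lambda>t. - (r * (D t \<bullet> x / R\<^sup>2)) / sqrt (1 - (r * c t)\<^sup>2))"
    have rc: "\<bar>r * c t\<bar> < 1" if "t \<in> {0..1}" for t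
    proof -
      have "\<bar>r * c t\<bar> \<le> r * 1" using cb[OF that] r unfolding abs_mult by (intro mult_mono) auto
      then show ?thesis using r by simp
    qed
    have gd: "((\<lambda>t. arccos (r * c t)) has_vector_derivative g' t) (at t)" if t: "t \<in> {0<..<1} - S" for t
    proof -
      have t01: "t \<in> {0..1}" using t by auto
      have dc: "(c has_real_derivative (D t \<bullet> x / R\<^sup>2)) (at t)"
      proof -
        have "(\<gamma> has_vector_derivative D t) (at t)" using d t by auto
        then have "((\<lambda>t. \<gamma> t \<bullet> x) has_vector_derivative D t \<bullet> x) (at t)"
          by (rule bounded_linear.has_vector_derivative[OF bounded_linear_inner_left])
        then have "((\<lambda>t. \<gamma> t \<bullet> x) has_real_derivative D t \<bullet> x) (at t)"
          by (simp add: has_real_derivative_iff_has_vector_derivative)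
        then show ?thesis unfolding c_def by (rule DERIV_cdivide)
      qed
      have b: "-1 < r * c t" "r * c t < 1" using rc[OF t01] by auto
      have "((\<lambda>t. arccos (r * c t)) has_real_derivative
              inverse (- sqrt (1 - (r * c t)\<^sup>2)) * (r * (D t \<bullet> x / R\<^sup>2))) (at t)"
        by (rule DERIV_chain2[where f = arccos and g = "\<lambda>t. r * c t", OF DERIV_arccos[OF b]])
           (intro DERIV_cmult dc)
      then show ?thesis unfolding g'_def has_real_derivative_iff_has_vector_derivative[symmetric]
        by (simp add: divide_inverse mult.commute)
    qed
    have cc: "continuous_on {0..1} (\<lambda>t. arccos (r * c t))"
    proof (rule continuous_on_arccos)
      show "continuous_on {0..1} (\<lambda>t. r * c t)" unfolding c_def by (intro continuous_intros cont) (use R in auto)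
      show "\<forall>t\<in>{0..1}. - 1 \<le> r * c t \<and> r * c t \<le> 1" using rc by (fastforce simp: abs_less_iff)
    qed
    have hi: "(g' has_integral (arccos (r * c 1) - arccos (r * c 0))) {0..1}"
      using fundamental_theorem_of_calculus_interior_strong[OF S(1) _ gd cc] by auto
    have bound: "g' t \<le> norm (D t) / R" if t: "t \<in> {0<..<1} - S" for t
    proof -
      have t01: "t \<in> {0..1}" using t by auto
      have "\<bar>D t \<bullet> x / R\<^sup>2\<bar> \<le> norm (D t) * sqrt (1 - (c t)\<^sup>2) / R"
        unfolding c_def using t d by (intro sph_curve_speed_bound[OF R im _ xs]) auto
      then have 1: "r * \<bar>D t \<bullet> x / R\<^sup>2\<bar> \<le> r * (norm (D t) * sqrt (1 - (c t)\<^sup>2) / R)"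
        using r by (intro mult_left_mono) auto
      have "r * sqrt (1 - (c t)\<^sup>2) = sqrt (r\<^sup>2 * (1 - (c t)\<^sup>2))"
        using r by (simp add: real_sqrt_mult)
      also have "\<dots> \<le> sqrt (1 - (r * c t)\<^sup>2)"
        using r power_le_one[of r 2] by (intro real_sqrt_le_mono) (simp add: right_diff_distrib power_mult_distrib)
      finally have 2: "r * sqrt (1 - (c t)\<^sup>2) * (norm (D t) / R) \<le> sqrt (1 - (r * c t)\<^sup>2) * (norm (D t) / R)"
        using R by (intro mult_right_mono) auto
      have pos: "sqrt (1 - (r * c t)\<^sup>2) > 0" using rc[OF t01] by (simp add: abs_square_less_1)
      have "g' t \<le> r * \<bar>D t \<bullet> x / R\<^sup>2\<bar> / sqrt (1 - (r * c t)\<^sup>2)"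
        unfolding g'_def
      proof (rule divide_right_mono)
        have "r * - (D t \<bullet> x / R\<^sup>2) \<le> r * \<bar>D t \<bullet> x / R\<^sup>2\<bar>"
          using r by (intro mult_left_mono abs_ge_minus_self) auto
        then show "- (r * (D t \<bullet> x / R\<^sup>2)) \<le> r * \<bar>D t \<bullet> x / R\<^sup>2\<bar>" by simp
      qed (use pos in simp)
      also have "\<dots> \<le> norm (D t) / R"
        unfolding pos_divide_le_eq[OF pos] using 1 2 by (simp add: mult_ac)
      finally show ?thesis .
    qed
    have hi2: "((\<lambda>t. norm (D t) / R) has_integral (curve_length \<gamma> / R)) {0..1}"
      using integrable_integral[OF int] unfolding curve_length_def D_def
      by (rule has_integral_divide)
    have neg: "negligible (insert 0 (insert 1 S))" using S(1) by (intro negligible_finite) auto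
    have hi3: "((\<lambda>t. if t \<in> insert 0 (insert 1 S) then g' t else norm (D t) / R) has_integral (curve_length \<gamma> / R)) {0..1}"
      by (rule has_integral_spike[OF neg _ hi2]) auto
    have "arccos (r * c 1) - arccos (r * c 0) \<le> curve_length \<gamma> / R"
      by (rule has_integral_le[OF hi hi3]) (use bound in auto)
    then show ?thesis using c0 by simp
  qed
  have cn: "continuous_on {-1..1} (\<lambda>r. arccos (r * c 1) - arccos r)"
  proof (intro continuous_on_diff continuous_on_arccos continuous_intros, goal_cases)
    case 1
    have "\<bar>r * c 1\<bar> \<le> 1" if "r \<in> {-1..1}" for r
      using cb[of 1] that unfolding abs_mult by (intro mult_le_one) auto
    then show ?case by (auto simp: abs_le_iff)
  qed auto
  have "((\<lambda>r. arccos (r * c 1) - arccos r) \<longlongrightarrow> arccos (1 * c 1) - arccos 1) (at 1 within {-1..1})"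
    using cn unfolding continuous_on_def by (rule bspec) simp
  then have lim: "((\<lambda>r. arccos (r * c 1) - arccos r) \<longlongrightarrow> arccos (c 1) - 0) (at 1 within {0<..<1})"
    by (simp add: tendsto_within_subset[where S = "{-1..1}"] subset_eq)
  have "arccos (c 1) - 0 \<le> curve_length \<gamma> / R"
    by (rule tendsto_upperbound[OF lim])
       (auto simp: eventually_at_filter main trivial_limit_within islimpt_greaterThanLessThan2)
  then show ?thesis using R c1 by (simp add: field_simps)
qed

lemma great_circle_exists:
  fixes x y :: "'a::euclidean_space"
  assumes R: "R > 0" and xy: "x \<in> sphere 0 R" "y \<in> sphere 0 R" and dim: "DIM('a) \<ge> 2"
  shows "\<exists>\<gamma>. sph_curve R \<gamma> \<and> pathstart \<gamma> = x \<and> pathfinish \<gamma> = y \<and>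
    curve_length \<gamma> = R * arccos (x \<bullet> y / R\<^sup>2)"
proof -
  define c where "c = x \<bullet> y / R\<^sup>2"
  define \<alpha> where "\<alpha> = arccos c"
  have c1: "\<bar>c\<bar> \<le> 1" using sph_inner_bound[OF R xy] by (simp add: c_def)
  have \<alpha>: "cos \<alpha> = c" "0 \<le> \<alpha>" "\<alpha> \<le> pi" using c1 arccos_bounded[of c] by (auto simp: \<alpha>_def abs_le_iff)
  have xx: "x \<bullet> x = R\<^sup>2" and yy: "y \<bullet> y = R\<^sup>2"
    using xy by (auto simp: power2_norm_eq_inner[symmetric])
  have xyc: "x \<bullet> y = c * R\<^sup>2" using R by (simp add: c_def)
  have yc: "(y - c *\<^sub>R x) \<bullet> (y - c *\<^sub>R x) = R\<^sup>2 * (1 - c\<^sup>2)"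
    by (simp add: inner_diff_left inner_diff_right xx yy xyc inner_commute[of y x] power2_eq_square right_diff_distrib)
  have yc0: "(y - c *\<^sub>R x) \<bullet> x = 0"
    by (simp add: inner_diff_left xx xyc inner_commute[of y x])
  obtain z where z: "z \<bullet> x = 0" "z \<bullet> z = R\<^sup>2" "y = cos \<alpha> *\<^sub>R x + sin \<alpha> *\<^sub>R z"
  proof (cases "sin \<alpha> = 0")
    case True
    obtain z0 where z0: "z0 \<noteq> 0" "orthogonal x z0"
      using orthogonal_to_vector_exists[OF dim] by blast
    define z where "z = (R / norm z0) *\<^sub>R z0"
    have "norm z = R" using z0 R by (simp add: z_def)
    then have "z \<bullet> z = R\<^sup>2" by (simp add: dot_square_norm)
    moreover have "z \<bullet> x = 0" using z0 by (simp add: z_def orthogonal_def inner_commute)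
    moreover have "c\<^sup>2 = 1" using True \<alpha> by (metis add.commute add.right_neutral power_zero_numeral sin_cos_squared_add)
    then have "y - c *\<^sub>R x = 0" using yc by simp
    ultimately show ?thesis using that[of z] True \<alpha>(1) by simp
  next
    case False
    define z where "z = (1 / sin \<alpha>) *\<^sub>R (y - c *\<^sub>R x)"
    have s2: "(sin \<alpha>)\<^sup>2 = 1 - c\<^sup>2" using \<alpha> by (simp add: sin_squared_eq)
    have "z \<bullet> z = (R\<^sup>2 * (1 - c\<^sup>2)) / (sin \<alpha>)\<^sup>2"
      unfolding z_def inner_scaleR_left inner_scaleR_right yc by (simp add: power2_eq_square)
    then have "z \<bullet> z = R\<^sup>2" using False s2[symmetric] by simp
    moreover have "z \<bullet> x = 0" using yc0 by (simp add: z_def)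
    moreover have "y = cos \<alpha> *\<^sub>R x + sin \<alpha> *\<^sub>R z" using False \<alpha>(1) by (simp add: z_def)
    ultimately show ?thesis using that by blast
  qed
  define \<gamma> where "\<gamma> = (\<lambda>t. cos (\<alpha> * t) *\<^sub>R x + sin (\<alpha> * t) *\<^sub>R z)"
  define \<gamma>' where "\<gamma>' = (\<lambda>t. (- \<alpha> * sin (\<alpha> * t)) *\<^sub>R x + (\<alpha> * cos (\<alpha> * t)) *\<^sub>R z)"
  have n: "norm (u *\<^sub>R x + v *\<^sub>R z) = R * sqrt (u\<^sup>2 + v\<^sup>2)" for u v
  proof -
    have "(u *\<^sub>R x + v *\<^sub>R z) \<bullet> (u *\<^sub>R x + v *\<^sub>R z) = R\<^sup>2 * (u\<^sup>2 + v\<^sup>2)"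
      using z xx by (simp add: inner_add_left inner_add_right inner_commute[of x z]) (simp add: algebra_simps power2_eq_square)
    then show ?thesis using R by (simp add: norm_eq_sqrt_inner real_sqrt_mult)
  qed
  have d: "(\<gamma> has_vector_derivative \<gamma>' t) (at t)" for t
    unfolding \<gamma>_def \<gamma>'_def
    by (auto intro!: derivative_eq_intros simp: algebra_simps has_vector_derivative_def)
  have "norm (\<gamma>' t) = R * \<alpha>" for t
    unfolding \<gamma>'_def n using \<alpha> by (simp add: power_mult_distrib flip: distrib_left)
  moreover have "vector_derivative \<gamma> (at t) = \<gamma>' t" for t
    using d by (rule vector_derivative_at)
  ultimately have sp: "norm (vector_derivative \<gamma> (at t)) = R * \<alpha>" for t by simp
  have "continuous_on S \<gamma>'" for S unfolding \<gamma>'_def by (intro continuous_intros)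
  then have "\<gamma> C1_differentiable_on {0..1}"
    unfolding C1_differentiable_on_def using d by blast
  then have "valid_path \<gamma>" unfolding valid_path_def
    by (rule C1_differentiable_imp_piecewise)
  moreover have "norm (\<gamma> t) = R" for t unfolding \<gamma>_def n by simp
  ultimately have "sph_curve R \<gamma>"
    unfolding sph_curve_def sp by (auto simp: path_image_def)
  moreover have "pathstart \<gamma> = x" "pathfinish \<gamma> = y"
    using z by (auto simp: \<gamma>_def pathstart_def pathfinish_def)
  moreover have "curve_length \<gamma> = R * \<alpha>" unfolding curve_length_def sp by simp
  ultimately show ?thesis unfolding \<alpha>_def c_def by blast
qed

lemma sph_dist_eq:
  fixes x y :: "'a::euclidean_space"
  assumes R: "R > 0" and xy: "x \<in> sphere 0 R" "y \<in> sphere 0 R" and dim: "DIM('a) \<ge> 2"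
  shows "sph_dist R x y = R * arccos (x \<bullet> y / R\<^sup>2)"
  unfolding sph_dist_def
proof (rule cInf_eq_minimum)
  show "R * arccos (x \<bullet> y / R\<^sup>2)
    \<in> {curve_length \<gamma> |\<gamma>. sph_curve R \<gamma> \<and> pathstart \<gamma> = x \<and> pathfinish \<gamma> = y}"
    using great_circle_exists[OF assms] by (metis (mono_tags, lifting) mem_Collect_eq)
qed (use curve_length_ge[OF R] in auto)


section \<open>Caps: total convexity and topology\<close>

definition height :: "real \<Rightarrow> 'a::euclidean_space \<Rightarrow> 'a \<Rightarrow> real" where
  "height R p x = x \<bullet> p / R\<^sup>2"

lemma height_bounds:
  fixes p :: "'a::euclidean_space"
  assumes "R > 0" "p \<in> sphere 0 R" "x \<in> sphere 0 R"
  shows "-1 \<le> height R p x" "height R p x \<le> 1"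
  using sph_inner_bound[OF assms(1,3,2)] unfolding height_def by linarith+

lemma continuous_on_height [continuous_intros]:
  "continuous_on S (g :: 'b::topological_space \<Rightarrow> 'a::euclidean_space) \<Longrightarrow> continuous_on S (\<lambda>x. height R p (g x))"
  unfolding height_def divide_inverse by (intro continuous_intros)

lemma geodesic_cball_eq:
  fixes p :: "'a::euclidean_space"
  assumes "R > 0" "p \<in> sphere 0 R" "DIM('a) \<ge> 2" "\<bar>c\<bar> \<le> 1"
  shows "geodesic_cball R p (R * arccos c) = {x \<in> sphere 0 R. c \<le> height R p x}"
proof -
  have "sph_dist R p x \<le> R * arccos c \<longleftrightarrow> c \<le> height R p x" if "x \<in> sphere 0 R" for x
    using sph_dist_eq[OF assms(1,2) that assms(3)] arccos_le_mono[of "p \<bullet> x / R\<^sup>2" c]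
      sph_inner_bound[OF assms(1,2) that] assms by (simp add: height_def inner_commute)
  then show ?thesis unfolding geodesic_cball_def by blast
qed

lemma closed_cap: "closedin (sph_top R) {x \<in> sphere 0 R. c \<le> height R (p::'a::euclidean_space) x}"
proof -
  have "closed {x::'a. c \<le> height R p x}"
    by (intro closed_Collect_le continuous_intros)
  then show ?thesis by (simp add: closedin_closed Int_def) blast
qed

lemma open_cap: "openin (sph_top R) {x \<in> sphere 0 R. c < height R (p::'a::euclidean_space) x}"
proof -
  have "open {x::'a. c < height R p x}"
    by (intro open_Collect_less continuous_intros)
  then show ?thesis by (simp add: openin_open Int_def) blast
qed

text \<open>
  Equality in the triangle inequality for angles forces \<open>m\<close> onto the great circle: the squared norm
  of the difference of the two sides is a trigonometric identity.
\<close>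

lemma geodesic_interpolation:
  fixes a b m :: "'a::euclidean_space"
  assumes R: "R > 0" and s: "a \<in> sphere 0 R" "b \<in> sphere 0 R" "m \<in> sphere 0 R"
    and ab: "a \<bullet> b = R\<^sup>2 * cos (s + t)" and am: "a \<bullet> m = R\<^sup>2 * cos s" and mb: "m \<bullet> b = R\<^sup>2 * cos t"
  shows "sin (s + t) *\<^sub>R m = sin t *\<^sub>R a + sin s *\<^sub>R b"
proof -
  define d where "d = sin (s + t) *\<^sub>R m - (sin t *\<^sub>R a + sin s *\<^sub>R b)"
  have nn: "a \<bullet> a = R\<^sup>2" "b \<bullet> b = R\<^sup>2" "m \<bullet> m = R\<^sup>2"
    using s by (auto simp: power2_norm_eq_inner[symmetric])
  have "d \<bullet> d = R\<^sup>2 * ((sin (s + t))\<^sup>2 + (sin t)\<^sup>2 + (sin s)\<^sup>2 - 2 * sin (s + t) * (sin t * cos s + sin s * cos t)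
      + 2 * sin t * sin s * cos (s + t))"
    unfolding d_def
    by (simp add: inner_diff_left inner_diff_right inner_add_left inner_add_right nn am mb ab
        inner_commute[of m a] inner_commute[of b m] inner_commute[of b a])
       (simp add: algebra_simps power2_eq_square)
  also have "\<dots> = R\<^sup>2 * ((sin t)\<^sup>2 + (sin s)\<^sup>2 - (sin (s + t))\<^sup>2 + 2 * sin t * sin s * cos (s + t))"
    by (simp add: sin_add power2_eq_square algebra_simps)
  also have "\<dots> = R\<^sup>2 * ((sin t)\<^sup>2 * (1 - (cos s)\<^sup>2) + (sin s)\<^sup>2 * (1 - (cos t)\<^sup>2) - 2 * (sin t)\<^sup>2 * (sin s)\<^sup>2)"
    unfolding sin_add cos_add by (simp add: power2_eq_square algebra_simps)
  also have "\<dots> = 0" by (simp add: sin_squared_eq[symmetric])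
  finally show ?thesis by (simp add: d_def)
qed

text \<open>
  On a minimizing geodesic of angle \<open>\<alpha> < \<pi>\<close> the height is a combination of the heights of the end points
  with coefficients summing to at least \<open>1\<close>, because sine is subadditive on \<open>[0, \<pi>]\<close>. Positivity of
  \<open>c\<close> turns this into a lower bound by \<open>c\<close>, and it also excludes antipodal end points.
\<close>

lemma cap_totally_convex:
  fixes p :: "'a::euclidean_space"
  assumes R: "R > 0" and p: "p \<in> sphere 0 R" and dim: "DIM('a) \<ge> 2" and c: "c > 0"
  shows "totally_convex R {x \<in> sphere 0 R. c \<le> height R p x}"
  unfolding totally_convex_def
proof (intro allI impI subsetI)
  fix g :: "real \<Rightarrow> 'a" and m
  assume A: "minimizing_geodesic R g \<and> g 0 \<in> {x \<in> sphere 0 R. c \<le> height R p x} \<and> g 1 \<in> {x \<in> sphere 0 R. c \<le> height R p x}"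
    and "m \<in> g ` {0..1}"
  then obtain s where s: "s \<in> {0..1}" "m = g s" by blast
  define a b where "a = g 0" and "b = g 1"
  define \<alpha> where "\<alpha> = arccos (a \<bullet> b / R\<^sup>2)"
  have S: "a \<in> sphere 0 R" "b \<in> sphere 0 R" "m \<in> sphere 0 R" and ha: "c \<le> height R p a" and hb: "c \<le> height R p b"
    using A s by (auto simp: a_def b_def minimizing_geodesic_def image_subset_iff)
  have D: "sph_dist R (g u) (g v) = \<bar>u - v\<bar> * sph_dist R (g 0) (g 1)" if "u \<in> {0..1}" "v \<in> {0..1}" for u v
    using A that unfolding minimizing_geodesic_def by blast
  have dist: "sph_dist R x y = R * arccos (x \<bullet> y / R\<^sup>2)" if "x \<in> sphere 0 R" "y \<in> sphere 0 R" for x y :: 'a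
    by (rule sph_dist_eq[OF R that dim])
  have "R * arccos (a \<bullet> m / R\<^sup>2) = s * (R * \<alpha>)" "R * arccos (m \<bullet> b / R\<^sup>2) = (1 - s) * (R * \<alpha>)"
    using D[of 0 s] D[of s 1] s S unfolding a_def[symmetric] b_def[symmetric] s(2)[symmetric] \<alpha>_def
    by (auto simp: dist)
  then have ang: "arccos (a \<bullet> m / R\<^sup>2) = s * \<alpha>" "arccos (m \<bullet> b / R\<^sup>2) = (1 - s) * \<alpha>"
    using R by auto
  have cc: "x \<bullet> y = R\<^sup>2 * cos (arccos (x \<bullet> y / R\<^sup>2))" if "x \<in> sphere 0 R" "y \<in> sphere 0 R" for x y :: 'a
    using sph_inner_bound[OF R that] R by (simp add: cos_arccos_abs)
  have \<alpha>b: "0 \<le> \<alpha>" "\<alpha> \<le> pi" using sph_inner_bound[OF R S(1,2)] arccos_bounded[of "a \<bullet> b / R\<^sup>2"]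
    unfolding \<alpha>_def by linarith+
  have eq: "sin (s * \<alpha> + (1 - s) * \<alpha>) *\<^sub>R m = sin ((1 - s) * \<alpha>) *\<^sub>R a + sin (s * \<alpha>) *\<^sub>R b"
  proof (rule geodesic_interpolation[OF R S])
    show "a \<bullet> m = R\<^sup>2 * cos (s * \<alpha>)" "m \<bullet> b = R\<^sup>2 * cos ((1 - s) * \<alpha>)"
      using cc[OF S(1,3)] cc[OF S(3,2)] ang by auto
    have "s * \<alpha> + (1 - s) * \<alpha> = \<alpha>" by (simp add: algebra_simps)
    then show "a \<bullet> b = R\<^sup>2 * cos (s * \<alpha> + (1 - s) * \<alpha>)" using cc[OF S(1,2)] by (simp add: \<alpha>_def)
  qed
  have sa: "s * \<alpha> + (1 - s) * \<alpha> = \<alpha>" by (simp add: algebra_simps)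
  have "c \<le> height R p m"
  proof (cases "\<alpha> = 0 \<or> \<alpha> = pi")
    case True
    then show ?thesis
    proof
      assume "\<alpha> = 0"
      then have "a \<bullet> m = R\<^sup>2" using cc[OF S(1,3)] ang by simp
      then have "(norm (a - m))\<^sup>2 = 0" using S
        by (simp add: power2_norm_eq_inner inner_diff_left inner_diff_right inner_commute[of m a])
           (simp add: power2_norm_eq_inner[symmetric])
      then show ?thesis using ha by simp
    next
      assume "\<alpha> = pi"
      then have "a \<bullet> b = - R\<^sup>2" using cc[OF S(1,2)] by (simp add: \<alpha>_def)
      then have "(norm (a + b))\<^sup>2 = 0" using S
        by (simp add: power2_norm_eq_inner inner_add_left inner_add_right inner_commute[of b a])
           (simp add: power2_norm_eq_inner[symmetric])
      then have "a = - b" by (simp add: eq_neg_iff_add_eq_0)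
      then have "height R p a = - height R p b" by (simp add: height_def)
      then show ?thesis using ha hb c by simp
    qed
  next
    case False
    then have sp: "sin \<alpha> > 0" using \<alpha>b by (intro sin_gt_zero) auto
    have rng: "0 \<le> s * \<alpha>" "s * \<alpha> \<le> pi" "0 \<le> (1 - s) * \<alpha>" "(1 - s) * \<alpha> \<le> pi"
      using s \<alpha>b mult_right_mono[of s 1 \<alpha>] mult_right_mono[of "1 - s" 1 \<alpha>] by auto
    then have s0: "sin (s * \<alpha>) \<ge> 0" "sin ((1 - s) * \<alpha>) \<ge> 0" by (auto intro: sin_ge_zero)
    have "sin \<alpha> = sin (s * \<alpha>) * cos ((1 - s) * \<alpha>) + cos (s * \<alpha>) * sin ((1 - s) * \<alpha>)"
      using sin_add[of "s * \<alpha>" "(1 - s) * \<alpha>"] by (simp only: sa)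
    also have "\<dots> \<le> sin (s * \<alpha>) * 1 + 1 * sin ((1 - s) * \<alpha>)"
      using s0 by (intro add_mono mult_left_mono mult_right_mono) auto
    finally have sub: "sin \<alpha> \<le> sin (s * \<alpha>) + sin ((1 - s) * \<alpha>)" by simp
    have "sin \<alpha> *\<^sub>R m = sin ((1 - s) * \<alpha>) *\<^sub>R a + sin (s * \<alpha>) *\<^sub>R b" using eq by (simp only: sa)
    then have "(sin \<alpha> *\<^sub>R m) \<bullet> p / R\<^sup>2 = (sin ((1 - s) * \<alpha>) *\<^sub>R a + sin (s * \<alpha>) *\<^sub>R b) \<bullet> p / R\<^sup>2" by simp
    then have "sin \<alpha> * height R p m = sin ((1 - s) * \<alpha>) * height R p a + sin (s * \<alpha>) * height R p b"
      by (simp add: height_def inner_add_left add_divide_distrib)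
    also have "\<dots> \<ge> sin ((1 - s) * \<alpha>) * c + sin (s * \<alpha>) * c"
      using s0 ha hb by (intro add_mono mult_left_mono)
    also have "sin ((1 - s) * \<alpha>) * c + sin (s * \<alpha>) * c \<ge> sin \<alpha> * c"
      using sub c by (simp add: distrib_right[symmetric] add.commute)
    finally show ?thesis using sp by simp
  qed
  then show "m \<in> {x \<in> sphere 0 R. c \<le> height R p x}" using S by simp
qed

lemma tconv_cap:
  fixes p :: "'a::euclidean_space"
  assumes "R > 0" "p \<in> sphere 0 R" "DIM('a) \<ge> 2" "c > 0"
  shows "tconv R {x \<in> sphere 0 R. c \<le> height R p x} = {x \<in> sphere 0 R. c \<le> height R p x}"
  unfolding tconv_def using cap_totally_convex[OF assms] closed_cap[of R c p] by blast

text \<open>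
  Adding a small multiple of \<open>p\<close> to \<open>x\<close> and rescaling to the sphere raises or lowers the height,
  according to the sign of the multiple. This is how the boundary of a cap is found.
\<close>

lemma sphere_near_level:
  fixes p :: "'a::euclidean_space"
  assumes R: "R > 0" and p: "p \<in> sphere 0 R" and x: "x \<in> sphere 0 R" and c: "height R p x = c" "0 < c" "c < 1"
    and T: "open T" "x \<in> T"
  shows "\<exists>y\<in>T \<inter> sphere 0 R. c < height R p y" "\<exists>y\<in>T \<inter> sphere 0 R. height R p y < c"
proof -
  define y where "y = (\<lambda>t. (R / norm (x + t *\<^sub>R p)) *\<^sub>R (x + t *\<^sub>R p))"
  have pp: "p \<bullet> p = R\<^sup>2" and xx: "x \<bullet> x = R\<^sup>2" using p x by (auto simp: power2_norm_eq_inner[symmetric])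
  have xp: "x \<bullet> p = c * R\<^sup>2" using c R by (simp add: height_def field_simps)
  have n2: "(norm (x + t *\<^sub>R p))\<^sup>2 = R\<^sup>2 * (1 + 2 * t * c + t\<^sup>2)" for t
    unfolding power2_norm_eq_inner
    by (simp add: inner_add_left inner_add_right pp xx xp inner_commute[of p x]) (simp add: algebra_simps power2_eq_square)
  have q: "1 + 2 * t * c + t\<^sup>2 > 0" for t
  proof -
    have "1 + 2 * t * c + t\<^sup>2 = (t + c)\<^sup>2 + (1 - c\<^sup>2)" by (simp add: power2_eq_square algebra_simps)
    moreover have "c\<^sup>2 < 1" using c by (simp add: abs_square_less_1)
    ultimately show ?thesis by (metis add_nonneg_pos diff_gt_0_iff_gt zero_le_power2)
  qed
  have npos: "norm (x + t *\<^sub>R p) > 0" for t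
    using n2[of t] q[of t] R by (metis mult_pos_pos norm_ge_zero order_le_less zero_less_power zero_eq_power2 less_irrefl)
  have ys: "y t \<in> sphere 0 R" for t using npos[of t] R by (simp add: y_def)
  have hy: "height R p (y t) = (c + t) * R / norm (x + t *\<^sub>R p)" for t
  proof -
    have "(x + t *\<^sub>R p) \<bullet> p = R\<^sup>2 * (c + t)" by (simp add: inner_add_left xp pp algebra_simps)
    then show ?thesis using R by (simp add: height_def y_def)
  qed
  have id: "((c + t) * R)\<^sup>2 - (c * norm (x + t *\<^sub>R p))\<^sup>2 = R\<^sup>2 * ((1 - c\<^sup>2) * (t * (2 * c + t)))" for t
    unfolding power_mult_distrib n2 by (simp add: power2_eq_square algebra_simps)
  have c2: "1 - c\<^sup>2 > 0" using c by (simp add: abs_square_less_1)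
  have cont: "isCont y 0" unfolding y_def using npos[of 0] by (intro continuous_intros) auto
  have y0: "y 0 = x" using x R by (simp add: y_def)
  have "\<forall>\<^sub>F t in at 0. y t \<in> T"
    using cont T unfolding isCont_def y0 by (rule topological_tendstoD)
  then obtain d where d: "d > 0" "\<And>t. t \<noteq> 0 \<Longrightarrow> \<bar>t\<bar> < d \<Longrightarrow> y t \<in> T"
    unfolding eventually_at by (auto simp: dist_real_def)
  define e where "e = min (d / 2) c"
  have e: "0 < e" "e < d" "e \<le> c" using d c by (auto simp: e_def)
  have "(c * norm (x + e *\<^sub>R p))\<^sup>2 < ((c + e) * R)\<^sup>2"
  proof -
    have "0 < R\<^sup>2 * ((1 - c\<^sup>2) * (e * (2 * c + e)))" using e c c2 R by (intro mult_pos_pos) auto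
    then show ?thesis using id[of e] by simp
  qed
  then have "c * norm (x + e *\<^sub>R p) < (c + e) * R"
    by (rule power_less_imp_less_base) (use e c R in simp)
  then have "c < height R p (y e)" unfolding hy using npos[of e] by (simp add: pos_less_divide_eq)
  then show "\<exists>y\<in>T \<inter> sphere 0 R. c < height R p y" using ys[of e] d(2)[of e] e by auto
  have "((c - e) * R)\<^sup>2 < (c * norm (x + (- e) *\<^sub>R p))\<^sup>2"
  proof -
    have "0 < R\<^sup>2 * ((1 - c\<^sup>2) * (e * (2 * c - e)))" using e c c2 R by (intro mult_pos_pos) auto
    then show ?thesis using id[of "- e"] by simp
  qed
  then have "(c - e) * R < c * norm (x + (- e) *\<^sub>R p)"
    by (rule power_less_imp_less_base) (use e c R in simp)
  then have "height R p (y (- e)) < c" unfolding hy using npos[of "- e"] by (simp add: pos_divide_less_eq)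
  then show "\<exists>y\<in>T \<inter> sphere 0 R. height R p y < c" using ys[of "- e"] d(2)[of "- e"] e by auto
qed

lemma cap_interior:
  fixes p :: "'a::euclidean_space"
  assumes "R > 0" "p \<in> sphere 0 R" "0 < c" "c < 1"
  shows "sph_top R interior_of {x \<in> sphere 0 R. c \<le> height R p x} \<subseteq> {x \<in> sphere 0 R. c < height R p x}"
proof
  fix x assume "x \<in> sph_top R interior_of {x \<in> sphere 0 R. c \<le> height R p x}"
  then obtain U where U: "openin (sph_top R) U" "x \<in> U" "U \<subseteq> {x \<in> sphere 0 R. c \<le> height R p x}"
    unfolding interior_of_def by auto
  then obtain T where T: "open T" "U = sphere 0 R \<inter> T" by (auto simp: openin_open)
  have "height R p x \<noteq> c"
  proof
    assume "height R p x = c"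
    then obtain y where "y \<in> T \<inter> sphere 0 R" "height R p y < c"
      using sphere_near_level(2)[of R p x c T] assms U T by auto
    then show False using U T by auto
  qed
  then show "x \<in> {x \<in> sphere 0 R. c < height R p x}" using U(2,3) by (auto simp: order_le_less)
qed

lemma cap_frontier:
  fixes p :: "'a::euclidean_space"
  assumes "R > 0" "p \<in> sphere 0 R" "0 < c" "c < 1"
  shows "sph_top R frontier_of {x \<in> sphere 0 R. c \<le> height R p x} = {x \<in> sphere 0 R. height R p x = c}"
proof -
  have "{x \<in> sphere 0 R. c < height R p x} \<subseteq> sph_top R interior_of {x \<in> sphere 0 R. c \<le> height R p x}"
    by (rule interior_of_maximal[OF _ open_cap]) auto
  with cap_interior[OF assms]
  have int: "sph_top R interior_of {x \<in> sphere 0 R. c \<le> height R p x} = {x \<in> sphere 0 R. c < height R p x}"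
    by (rule equalityI)
  show ?thesis unfolding frontier_of_def int closure_of_closedin[OF closed_cap] by auto
qed

lemma open_cap_frontier:
  fixes p :: "'a::euclidean_space"
  shows "sph_top R frontier_of {x \<in> sphere 0 R. a < height R p x} \<subseteq> {x \<in> sphere 0 R. height R p x = a}"
proof -
  have "sph_top R closure_of {x \<in> sphere 0 R. a < height R p x} \<subseteq> {x \<in> sphere 0 R. a \<le> height R p x}"
    by (rule closure_of_minimal[OF _ closed_cap]) auto
  then show ?thesis using open_cap[of R a p]
    by (auto simp: frontier_of_def interior_of_openin)
qed

text \<open>
  The cap is star-shaped about \<open>p\<close> after central projection of straight segments. When the cap exceeds
  a hemisphere it is not geodesically convex, but the segment from \<open>x\<close> to \<open>p\<close> still stays in the cone
  \<open>y \<bullet> p > a R norm y\<close>.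
\<close>

lemma open_cap_connected:
  fixes p :: "'a::euclidean_space"
  assumes R: "R > 0" and p: "p \<in> sphere 0 R" and a: "-1 < a" "a \<le> 0"
  shows "connected {x \<in> sphere 0 R. a < height R p x}"
proof -
  define K where "K = {x \<in> sphere 0 R. a < height R p x}"
  define J where "J = (\<lambda>x. (\<lambda>y. (R / norm y) *\<^sub>R y) ` closed_segment x p)"
  have pp: "p \<bullet> p = R\<^sup>2" using p by (auto simp: power2_norm_eq_inner[symmetric])
  have pK: "p \<in> K" using p a R by (simp add: K_def height_def pp)
  have main: "y \<noteq> 0" "(R / norm y) *\<^sub>R y \<in> K" if x: "x \<in> K" and y: "y \<in> closed_segment x p" for x y
  proof -
    obtain t where t: "0 \<le> t" "t \<le> 1" "y = (1 - t) *\<^sub>R x + t *\<^sub>R p" using y by (auto simp: in_segment)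
    have nx: "norm x = R" "norm p = R" using x p by (auto simp: K_def)
    have "norm ((1 - t) *\<^sub>R x) \<le> norm y + norm (t *\<^sub>R p)"
      using norm_triangle_ineq4[of y "t *\<^sub>R p"] t(3) by simp
    moreover have "norm ((1 - t) *\<^sub>R x) = (1 - t) * R" "norm (t *\<^sub>R p) = t * R" using t(1,2) nx by auto
    ultimately have n: "(1 - 2 * t) * R \<le> norm y" by (simp add: algebra_simps)
    have xp: "x \<bullet> p > a * R\<^sup>2" using x R by (simp add: K_def height_def pos_less_divide_eq)
    have "a * R * norm y \<le> a * R * ((1 - 2 * t) * R)"
      using n a R by (intro mult_left_mono_neg) (auto simp: mult_nonpos_nonneg)
    also have "\<dots> < (1 - t) * (x \<bullet> p) + t * R\<^sup>2"
    proof (cases "t = 1")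
      case True
      have "- a * R\<^sup>2 < 1 * R\<^sup>2" using a R by (intro mult_strict_right_mono) auto
      then show ?thesis using True by (simp add: power2_eq_square mult.assoc)
    next
      case False
      then have "(1 - t) * (a * R\<^sup>2) < (1 - t) * (x \<bullet> p)" using t xp by simp
      moreover have "0 \<le> t * R\<^sup>2 * (1 + a)" using t a by simp
      moreover have "a * R * ((1 - 2 * t) * R) = (1 - t) * (a * R\<^sup>2) + t * R\<^sup>2 - t * R\<^sup>2 * (1 + a)"
        by (simp add: algebra_simps power2_eq_square)
      ultimately show ?thesis by linarith
    qed
    also have "\<dots> = y \<bullet> p" using t pp by (simp add: inner_add_left)
    finally have *: "a * R * norm y < y \<bullet> p" .
    then show y0: "y \<noteq> 0" by auto
    have "height R p ((R / norm y) *\<^sub>R y) = (y \<bullet> p) / (R * norm y)"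
      using R by (simp add: height_def power2_eq_square)
    moreover have "a < (y \<bullet> p) / (R * norm y)"
      using * y0 R by (simp add: pos_less_divide_eq mult.assoc)
    ultimately show "(R / norm y) *\<^sub>R y \<in> K" using y0 R by (simp add: K_def)
  qed
  have con: "connected (J x)" if "x \<in> K" for x
    unfolding J_def using main[OF that]
    by (intro connected_continuous_image continuous_intros connected_segment) auto
  have xJ: "x \<in> J x" "p \<in> J x" if "x \<in> K" for x
  proof -
    have "(R / norm x) *\<^sub>R x = x" "(R / norm p) *\<^sub>R p = p" using that p R by (auto simp: K_def)
    moreover have "(R / norm x) *\<^sub>R x \<in> J x" "(R / norm p) *\<^sub>R p \<in> J x"
      unfolding J_def by (rule imageI, simp)+
    ultimately show "x \<in> J x" "p \<in> J x" by simp_all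
  qed
  have "J x \<subseteq> K" if "x \<in> K" for x using main(2)[OF that] by (auto simp: J_def)
  then have "K = \<Union> (J ` K)" using xJ by blast
  moreover have "connected (\<Union> (J ` K))" using con xJ pK by (intro connected_Union) (auto, blast)
  ultimately show ?thesis unfolding K_def by metis
qed


section \<open>The volume of the sphere\<close>

definition rproj :: "real \<Rightarrow> 'a::euclidean_space \<Rightarrow> 'a" where
  "rproj R x = (R / norm x) *\<^sub>R x"

lemma rproj_sphere: "R > 0 \<Longrightarrow> x \<noteq> 0 \<Longrightarrow> rproj R x \<in> sphere 0 R"
  by (simp add: rproj_def)

lemma continuous_on_rproj: "0 \<notin> S \<Longrightarrow> continuous_on S (rproj R)"
  unfolding rproj_def by (intro continuous_intros) auto

lemma scale_measure_eq_density: "scale_measure r M = density M (\<lambda>_. r)"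
  by (rule measure_eqI) (auto simp: emeasure_density nn_integral_cmult)

lemma rproj_measurable:
  assumes "R > 0"
  shows "rproj R \<in> measurable (restrict_space lborel (cball 0 R - {0}))
           (restrict_space borel (sphere (0::'a::euclidean_space) R))"
proof (rule measurable_restrict_space2)
  show "rproj R \<in> space (restrict_space lborel (cball 0 R - {0})) \<rightarrow> sphere (0::'a) R"
    using assms by (auto simp: space_restrict_space rproj_def)
  have "rproj R \<in> borel_measurable (restrict_space borel (cball 0 R - {0::'a}))"
    by (intro borel_measurable_continuous_on_restrict continuous_on_rproj) auto
  then show "rproj R \<in> measurable (restrict_space lborel (cball 0 R - {0::'a})) borel"
    by (simp cong: measurable_cong_sets add: sets_restrict_space)
qed

lemma space_sph_vol [simp]: "space (sph_vol R) = sphere 0 R"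
  by (simp add: sph_vol_def space_scale_measure space_restrict_space)

lemma sets_sph_vol [measurable_cong]:
  "sets (sph_vol R) = sets (restrict_space borel (sphere 0 R))"
  by (simp add: sph_vol_def)

lemma continuous_measurable_sph_vol:
  fixes g :: "'a::euclidean_space \<Rightarrow> 'b::topological_space"
  assumes "continuous_on (sphere 0 R) g"
  shows "g \<in> borel_measurable (sph_vol R)"
  using borel_measurable_continuous_on_restrict[OF assms] by (simp cong: measurable_cong_sets add: sets_sph_vol)

lemma openin_sets_sph_vol: "openin (sph_top R) U \<Longrightarrow> U \<in> sets (sph_vol R)"
proof -
  assume "openin (sph_top R) U"
  then obtain T where "open T" "U = sphere 0 R \<inter> T" by (auto simp: openin_open)
  then show ?thesis unfolding sets_sph_vol sets_restrict_space by (intro image_eqI[of _ _ T]) simp_all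
qed

lemma sph_vol_rproj:
  "sph_vol R = scale_measure (ennreal (real DIM('a) / R))
     (distr (restrict_space lborel (cball 0 R - {0})) (restrict_space borel (sphere 0 R))
        (rproj R :: 'a \<Rightarrow> 'a::euclidean_space))"
  unfolding sph_vol_def rproj_def ..

text \<open>
  The definition of the volume by cones turns integrals over the sphere into Lebesgue integrals of
  functions that are constant on rays. All analysis on the sphere goes through this formula.
\<close>

lemma integral_sph_vol:
  fixes g :: "'a::euclidean_space \<Rightarrow> real"
  assumes R: "R > 0" and g: "g \<in> borel_measurable (sph_vol R)"
  shows "(LINT x|sph_vol R. g x) =
    real DIM('a) / R * (LINT x|lborel. indicator (cball 0 R - {0}) x * g (rproj R x))"
proof -
  have [measurable]: "g \<in> borel_measurable (restrict_space borel (sphere 0 R))"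
    using g by (simp cong: measurable_cong_sets add: sets_sph_vol)
  note [measurable] = rproj_measurable[OF R]
  have "(LINT x|sph_vol R. g x) = (LINT x|distr (restrict_space lborel (cball 0 R - {0})) (restrict_space borel (sphere 0 R))
        (rproj R :: 'a \<Rightarrow> 'a). (real DIM('a) / R) *\<^sub>R g x)"
    unfolding sph_vol_rproj scale_measure_eq_density using R
    by (intro integral_density) auto
  also have "\<dots> = real DIM('a) / R * (LINT x|restrict_space lborel (cball 0 R - {0}). g (rproj R x))"
    by (simp add: integral_distr)
  also have "(LINT x|restrict_space lborel (cball 0 R - {0}). g (rproj R x))
      = (LINT x|lborel. indicator (cball 0 R - {0}) x *\<^sub>R g (rproj R x))"
    by (rule integral_restrict_space) auto
  finally show ?thesis by simp
qed

lemma emeasure_sph_vol: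
  assumes R: "R > 0" and A: "A \<in> sets (sph_vol R)"
  shows "emeasure (sph_vol R) (A :: 'a::euclidean_space set) = ennreal (real DIM('a) / R) *
     emeasure lborel (rproj R -` A \<inter> (cball 0 R - {0}))"
proof -
  have A': "A \<in> sets (restrict_space borel (sphere 0 R))" using A by (simp add: sets_sph_vol)
  show ?thesis
    unfolding sph_vol_rproj emeasure_scale_measure emeasure_distr[OF rproj_measurable[OF R] A']
    by (simp add: space_restrict_space emeasure_restrict_space)
qed

lemma finite_measure_sph_vol:
  assumes "R > 0"
  shows "finite_measure (sph_vol R :: 'a::euclidean_space measure)"
proof
  have "sphere 0 R \<in> sets (sph_vol R)" by (metis sets.top space_sph_vol)
  then have "emeasure (sph_vol R) (sphere (0::'a) R) = ennreal (real DIM('a) / R) *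
     emeasure lborel (rproj R -` sphere (0::'a) R \<inter> (cball 0 R - {0}))"
    by (rule emeasure_sph_vol[OF assms])
  also have "\<dots> \<le> ennreal (real DIM('a) / R) * emeasure lborel (cball (0::'a) R)"
    by (intro mult_left_mono emeasure_mono) auto
  also have "\<dots> < \<infinity>" by (simp add: ennreal_mult_less_top emeasure_lborel_cball_finite[unfolded infinity_ennreal_def])
  finally show "emeasure (sph_vol R) (space (sph_vol R :: 'a measure)) \<noteq> \<infinity>" by simp
qed

lemma continuous_integrable_sph_vol:
  fixes g :: "'a::euclidean_space \<Rightarrow> real"
  assumes R: "R > 0" and g: "continuous_on (sphere 0 R) g"
  shows "integrable (sph_vol R) g"
proof -
  interpret finite_measure "sph_vol R :: 'a measure" by (rule finite_measure_sph_vol[OF R])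
  have "compact (g ` sphere 0 R)" by (intro compact_continuous_image g) auto
  then have "bounded (g ` sphere 0 R)" by (rule compact_imp_bounded)
  then obtain M where "\<forall>y\<in>sphere 0 R. norm (g y) \<le> M" unfolding bounded_iff by auto
  then show ?thesis by (intro integrable_const_bound[where B = M] AE_I2 continuous_measurable_sph_vol g) auto
qed

lemma emeasure_open_pos:
  assumes "open (S :: 'a::euclidean_space set)" "S \<noteq> {}"
  shows "emeasure lborel S > 0"
proof -
  obtain x e where e: "e > 0" "ball x e \<subseteq> S" using assms by (meson ex_in_conv openE)
  have "0 < emeasure lborel (ball x e)" using e(1) by (simp add: emeasure_ball)
  also have "\<dots> \<le> emeasure lborel S" using e assms by (intro emeasure_mono) auto
  finally show ?thesis .
qed

lemma sph_vol_open_pos: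
  fixes U :: "'a::euclidean_space set"
  assumes R: "R > 0" and U: "openin (sph_top R) U" "U \<noteq> {}"
  shows "emeasure (sph_vol R) U > 0"
proof -
  obtain T where T: "open T" "U = sphere 0 R \<inter> T" using U by (auto simp: openin_open)
  define S where "S = rproj R -` T \<inter> (ball 0 R - {0})"
  have "open S" unfolding S_def
    using continuous_open_preimage[of "ball 0 R - {0::'a}" "rproj R" T] continuous_on_rproj[of "ball 0 R - {0::'a}"] T
    by (simp add: Int_commute open_Diff)
  moreover obtain x where x: "x \<in> U" using U by blast
  have nx: "norm x = R" using x T by simp
  have "norm ((1/2) *\<^sub>R x) < R" "rproj R ((1/2) *\<^sub>R x) = x" "x \<noteq> 0"
    using nx R by (auto simp: rproj_def)
  then have "(1/2) *\<^sub>R x \<in> S" using x T by (auto simp: S_def)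
  ultimately have "0 < emeasure lborel S" using emeasure_open_pos by blast
  also have "\<dots> \<le> emeasure lborel (rproj R -` U \<inter> (cball 0 R - {0}))"
  proof (rule emeasure_mono)
    show "S \<subseteq> rproj R -` U \<inter> (cball 0 R - {0})"
      using R T by (auto simp: S_def rproj_def)
    show "rproj R -` U \<inter> (cball 0 R - {0}) \<in> sets lborel"
      using measurable_sets[OF rproj_measurable[OF R], of U] openin_sets_sph_vol[OF U(1)]
      by (simp add: sets_sph_vol space_restrict_space sets_restrict_space_iff)
  qed
  finally have "0 < emeasure lborel (rproj R -` U \<inter> (cball 0 R - {0}))" .
  then show ?thesis
    unfolding emeasure_sph_vol[OF R openin_sets_sph_vol[OF U(1)]]
    using R by (simp add: ennreal_zero_less_mult_iff)
qed


section \<open>Positive perimeter\<close>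

lemma hausdorff_meas_leI:
  fixes A :: "'a::euclidean_space set"
  assumes d: "d > 0" and le: "\<And>U. A \<subseteq> (\<Union>i. U i) \<Longrightarrow> (\<And>i. bounded (U i)) \<Longrightarrow> (\<And>i. diameter (U i) \<le> d) \<Longrightarrow>
     c \<le> (\<Sum>i. ennreal (unit_ball_vol (real m) * (diameter (U i) / 2) ^ m))"
  shows "c \<le> hausdorff_meas m A"
  unfolding hausdorff_meas_def
  by (rule order_trans[OF _ SUP_upper[of d]]) (use d le in \<open>auto intro!: INF_greatest\<close>)

text \<open>
  The set \<open>{s x + t e | x \<in> V}\<close> lies in a neighbourhood of width \<open>d\<close> of a two-dimensional plate, hence
  in about \<open>1 / d\<^sup>2\<close> balls of radius comparable to \<open>d\<close>, of total volume of order \<open>d\<close> to the power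
  \<open>DIM('a) - 2\<close>. This is the link between Lebesgue measure and the \<open>m\<close>-dimensional Hausdorff sums.
\<close>

lemma plate_volume_small:
  fixes V :: "'a::euclidean_space set" and e :: 'a
  assumes V: "compact V" "V \<subseteq> cball 0 R" and R: "R > 0" and e: "norm e \<le> 1"
    and d: "0 < d" "d \<le> 1" "diameter V \<le> d" and N: "DIM('a) = m + 2"
  shows "emeasure lborel ((\<lambda>(x, s, t). s *\<^sub>R x + t *\<^sub>R e) ` (V \<times> {1..2} \<times> {0..1}))
    \<le> ennreal (16 * unit_ball_vol (real (m + 2)) * (R + 3) ^ (m + 2) * d ^ m)"
proof (cases "V = {}")
  case True
  then show ?thesis by simp
next
  case False
  then obtain v where v: "v \<in> V" by blast
  define K where "K = nat \<lceil>1 / d\<rceil>"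
  have K: "real K \<ge> 1 / d" "real K \<le> 2 / d" "real K > 0"
  proof -
    have "1 / d \<ge> 1" using d by simp
    moreover have "real K = of_int \<lceil>1 / d\<rceil>" using d by (simp add: K_def)
    ultimately show "real K \<ge> 1 / d" "real K \<le> 2 / d" "real K > 0" by linarith+
  qed
  have Kd: "1 / real K \<le> d" using K d by (simp add: field_simps)
  define B where "B = (\<lambda>(i, j). cball ((1 + real i / real K) *\<^sub>R v + (real j / real K) *\<^sub>R e) ((R + 3) * d))"
  have fl: "\<exists>i\<in>{..K}. \<bar>u - real i / real K\<bar> \<le> d" if u: "u \<in> {0..1}" for u :: real
  proof
    define i where "i = nat \<lfloor>u * real K\<rfloor>"
    have "real i = of_int \<lfloor>u * real K\<rfloor>" using u by (simp add: i_def)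
    then have i: "real i \<le> u * real K" "u * real K \<le> real i + 1" by linarith+
    have "u * real K \<le> 1 * real K" using u by (intro mult_right_mono) auto
    then show "i \<in> {..K}" using i by simp
    have "\<bar>u - real i / real K\<bar> = \<bar>u * real K - real i\<bar> / real K"
      using K by (simp add: field_simps abs_if)
    also have "\<dots> \<le> 1 / real K" using i K by (intro divide_right_mono) auto
    finally show "\<bar>u - real i / real K\<bar> \<le> d" using Kd by simp
  qed
  have sub: "(\<lambda>(x, s, t). s *\<^sub>R x + t *\<^sub>R e) ` (V \<times> {1..2} \<times> {0..1}) \<subseteq> (\<Union>ij\<in>{..K}\<times>{..K}. B ij)"
  proof clarify
    fix x and s t :: real
    assume x: "x \<in> V" and s: "s \<in> {1..2}" and t: "t \<in> {0..1}"
    obtain i where i: "i \<le> K" "\<bar>(s - 1) - real i / real K\<bar> \<le> d" using fl[of "s - 1"] s by auto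
    obtain j where j: "j \<le> K" "\<bar>t - real j / real K\<bar> \<le> d" using fl[of t] t by auto
    have xv: "norm (x - v) \<le> d"
      using diameter_bounded_bound[OF compact_imp_bounded[OF V(1)] x v] d(3) by (simp add: dist_norm)
    have nv: "norm v \<le> R" using v V(2) by auto
    have "s *\<^sub>R x + t *\<^sub>R e - ((1 + real i / real K) *\<^sub>R v + (real j / real K) *\<^sub>R e)
      = s *\<^sub>R (x - v) + ((s - 1) - real i / real K) *\<^sub>R v + (t - real j / real K) *\<^sub>R e"
      by (simp add: algebra_simps)
    also have "norm \<dots> \<le> norm (s *\<^sub>R (x - v)) + norm (((s - 1) - real i / real K) *\<^sub>R v) + norm ((t - real j / real K) *\<^sub>R e)"
      by (meson add_right_mono norm_triangle_ineq order_trans)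
    also have "\<dots> \<le> 2 * d + d * R + d * 1"
      unfolding norm_scaleR using s xv nv i j e d by (intro add_mono mult_mono) auto
    finally have "s *\<^sub>R x + t *\<^sub>R e \<in> B (i, j)"
      by (simp add: B_def dist_norm norm_minus_commute algebra_simps)
    then show "s *\<^sub>R x + t *\<^sub>R e \<in> (\<Union>ij\<in>{..K}\<times>{..K}. B ij)" using i j by blast
  qed
  have "emeasure lborel ((\<lambda>(x, s, t). s *\<^sub>R x + t *\<^sub>R e) ` (V \<times> {1..2} \<times> {0..1}))
      \<le> emeasure lborel (\<Union>ij\<in>{..K}\<times>{..K}. B ij)"
    by (intro emeasure_mono sub sets.finite_UN) (auto simp: B_def)
  also have "\<dots> \<le> (\<Sum>ij\<in>{..K}\<times>{..K}. emeasure lborel (B ij))"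
    by (intro emeasure_subadditive_finite) (auto simp: B_def)
  also have "\<dots> = (\<Sum>ij\<in>{..K}\<times>{..K}. ennreal (unit_ball_vol (real (m + 2)) * ((R + 3) * d) ^ (m + 2)))"
    using R d by (intro sum.cong) (auto simp: B_def emeasure_cball N)
  also have "\<dots> = ennreal ((real K + 1)\<^sup>2 * (unit_ball_vol (real (m + 2)) * ((R + 3) * d) ^ (m + 2)))"
    using R d by (simp add: ennreal_mult power2_eq_square ennreal_of_nat_eq_real_of_nat algebra_simps flip: ennreal_plus ennreal_mult)
  also have "\<dots> \<le> ennreal (16 * unit_ball_vol (real (m + 2)) * (R + 3) ^ (m + 2) * d ^ m)"
  proof (rule ennreal_leI)
    have "(real K + 1) * d \<le> 4" using K d by (simp add: field_simps)
    then have "((real K + 1) * d)\<^sup>2 \<le> 4\<^sup>2" using d by (intro power_mono) auto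
    then have "((real K + 1) * d)\<^sup>2 * (unit_ball_vol (real (m + 2)) * (R + 3) ^ (m + 2) * d ^ m) \<le>
      16 * (unit_ball_vol (real (m + 2)) * (R + 3) ^ (m + 2) * d ^ m)"
      using R d by (intro mult_right_mono) auto
    then show "(real K + 1)\<^sup>2 * (unit_ball_vol (real (m + 2)) * ((R + 3) * d) ^ (m + 2))
        \<le> 16 * unit_ball_vol (real (m + 2)) * (R + 3) ^ (m + 2) * d ^ m"
      by (simp add: power_mult_distrib power_add power2_eq_square mult_ac)
  qed
  finally show ?thesis .
qed

text \<open>
  Diameter \<open>0\<close> is the limit case \<open>d \<longlonglongrightarrow> 0\<close>; it needs \<open>m \<ge> 1\<close>.
\<close>

lemma plate_volume_diameter:
  fixes V :: "'a::euclidean_space set" and e :: 'a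
  assumes V: "compact V" "V \<subseteq> cball 0 R" and R: "R > 0" and e: "norm e \<le> 1"
    and d: "diameter V \<le> 1" and N: "DIM('a) = m + 2" and m: "m \<ge> 1"
  shows "emeasure lborel ((\<lambda>(x, s, t). s *\<^sub>R x + t *\<^sub>R e) ` (V \<times> {1..2} \<times> {0..1}))
    \<le> ennreal (16 * unit_ball_vol (real (m + 2)) * (R + 3) ^ (m + 2) * diameter V ^ m)" (is "?L \<le> ennreal (?C * _ ^ m)")
proof (cases "diameter V = 0")
  case True
  have "\<forall>\<^sub>F d in at_right 0. ?L \<le> ennreal (?C * d ^ m)"
    unfolding eventually_at_right_field using plate_volume_small[OF V R e _ _ _ N] True
    by (intro exI[of _ 1]) auto
  moreover have "((\<lambda>d. ennreal (?C * d ^ m)) \<longlongrightarrow> ennreal (?C * 0 ^ m)) (at_right 0)"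
    by (intro tendsto_intros)
  ultimately have "?L \<le> ennreal (?C * 0 ^ m)"
    by (intro tendsto_lowerbound) auto
  then show ?thesis using True by simp
next
  case False
  then have "diameter V > 0" using diameter_ge_0[OF compact_imp_bounded[OF V(1)]] by simp
  then show ?thesis using plate_volume_small[OF V R e _ d _ N] by auto
qed

text \<open>
  Scaling the parallel by \<open>s \<in> [1, 2]\<close> and translating it by \<open>t e\<close> with \<open>t \<in> [0, 1]\<close> sweeps out a set
  that contains a nonempty open set \<open>W\<close>. Any cover of the parallel induces a cover of \<open>W\<close> by plates, so
  the Hausdorff sum of the cover is bounded below by a fixed multiple of the volume of \<open>W\<close>.
\<close>

lemma parallel_hausdorff_pos:
  fixes e :: "'a::euclidean_space"
  assumes R: "R > 0" and e: "norm e = 1" and N: "DIM('a) = m + 2" and m: "m \<ge> 1" and c: "\<bar>c\<bar> < 1"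
    and A: "A = {x \<in> sphere 0 R. x \<bullet> e = R * c}"
  shows "hausdorff_meas m A > 0"
proof -
  define F where "F = (\<lambda>(x, s, t). s *\<^sub>R x + t *\<^sub>R e)"
  define \<rho> where "\<rho> = R * sqrt (1 - c\<^sup>2)"
  have rho: "\<rho> > 0" "\<rho>\<^sup>2 = R\<^sup>2 * (1 - c\<^sup>2)"
    using R c by (auto simp: \<rho>_def abs_square_less_1 power_mult_distrib abs_square_le_1)
  have ee: "e \<bullet> e = 1" using e by (simp add: norm_eq_1)
  define n where "n = (\<lambda>y. norm (y - (y \<bullet> e) *\<^sub>R e))"
  \<comment> \<open>Every \<open>y\<close> off the axis is \<open>s x + t e\<close> with \<open>x\<close> in the parallel, \<open>s = n y / \<rho>\<close> and \<open>t = y \<bullet> e - s R c\<close>; \<open>W\<close> asks for \<open>1 < s < 2\<close> and \<open>0 < t < 1\<close>.\<close>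
  define W where "W = {y. \<rho> < n y \<and> n y < 2 * \<rho> \<and> 0 < y \<bullet> e - n y / \<rho> * (R * c) \<and> y \<bullet> e - n y / \<rho> * (R * c) < 1}"
  have Wo: "open W" unfolding W_def n_def Collect_conj_eq
    by (intro open_Int open_Collect_less continuous_intros) (use rho in auto)
  have WF: "W \<subseteq> F ` (A \<times> {1..2} \<times> {0..1})"
  proof
    fix y assume y: "y \<in> W"
    define s where "s = n y / \<rho>"
    define t where "t = y \<bullet> e - s * (R * c)"
    define x where "x = (R * c) *\<^sub>R e + (1 / s) *\<^sub>R (y - (y \<bullet> e) *\<^sub>R e)"
    have s: "1 < s" "s < 2" using y rho by (auto simp: W_def s_def field_simps)
    have t: "0 \<le> t" "t \<le> 1" using y by (auto simp: W_def t_def s_def)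
    have z: "(y - (y \<bullet> e) *\<^sub>R e) \<bullet> e = 0" by (simp add: inner_diff_left ee)
    have "x \<bullet> e = R * c" unfolding x_def by (simp add: inner_add_left ee z)
    moreover have "x \<bullet> x = R\<^sup>2"
    proof -
      have "x \<bullet> x = (R * c)\<^sup>2 + (1 / s)\<^sup>2 * (n y)\<^sup>2"
        unfolding x_def n_def power2_norm_eq_inner inner_add_left inner_add_right inner_scaleR_left inner_scaleR_right
        using z by (simp add: ee inner_commute[of e "y - (y \<bullet> e) *\<^sub>R e"] power2_eq_square)
      also have "(1 / s)\<^sup>2 * (n y)\<^sup>2 = \<rho>\<^sup>2" using s rho by (simp add: s_def power_divide)
      finally show ?thesis using rho by (simp add: algebra_simps power_mult_distrib)
    qed
    then have "norm x = R" using R by (simp add: norm_eq_sqrt_inner)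
    ultimately have "x \<in> A" by (simp add: A)
    moreover have "F (x, s, t) = y" using s
      by (simp add: F_def x_def t_def scaleR_add_right algebra_simps)
    ultimately show "y \<in> F ` (A \<times> {1..2} \<times> {0..1})" using s t
      by (intro image_eqI[of _ _ "(x, s, t)"]) auto
  qed
  have Wne: "W \<noteq> {}"
  proof -
    obtain z0 where z0: "z0 \<noteq> 0" "orthogonal e z0"
      using orthogonal_to_vector_exists[of e] N by auto
    define z where "z = (1 / norm z0) *\<^sub>R z0"
    have z: "norm z = 1" "z \<bullet> e = 0" using z0 by (auto simp: z_def orthogonal_def inner_commute)
    define y where "y = (3/2 * \<rho>) *\<^sub>R z + (3/2 * (R * c) + 1/2) *\<^sub>R e"
    have ye: "y \<bullet> e = 3/2 * (R * c) + 1/2" by (simp add: y_def inner_add_left z ee)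
    have ny: "n y = 3/2 * \<rho>" unfolding n_def ye using z rho by (simp add: y_def)
    have nyr: "n y / \<rho> * (R * c) = 3/2 * (R * c)" unfolding ny using rho by simp
    have "y \<in> W" unfolding W_def mem_Collect_eq nyr ye ny using rho by simp
    then show ?thesis by blast
  qed
  define w where "w = emeasure lborel W"
  have wpos: "w > 0" unfolding w_def by (rule emeasure_open_pos[OF Wo Wne])
  define C where "C = 16 * unit_ball_vol (real (m + 2)) * (R + 3) ^ (m + 2)"
  define C' where "C' = C * 2 ^ m / unit_ball_vol (real m)"
  have ub: "unit_ball_vol (real m) \<noteq> 0" by (metis less_irrefl of_nat_0_le_iff unit_ball_vol_pos)
  have Cpos: "C > 0" "C' > 0" using R by (auto simp: C_def C'_def intro!: mult_pos_pos divide_pos_pos)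
  have "w / ennreal C' \<le> hausdorff_meas m A"
  proof (rule hausdorff_meas_leI[of 1])
    fix U :: "nat \<Rightarrow> 'a set"
    assume U: "A \<subseteq> (\<Union>i. U i)" "\<And>i. bounded (U i)" "\<And>i. diameter (U i) \<le> 1"
    define V where "V = (\<lambda>i. closure (U i) \<inter> cball 0 R)"
    have V: "compact (V i)" "V i \<subseteq> cball 0 R" for i
      using U(2) by (auto simp: V_def compact_Int compact_closure)
    have dV: "diameter (V i) \<le> diameter (U i)" for i
    proof -
      have "diameter (V i) \<le> diameter (closure (U i))"
        using U(2) by (intro diameter_subset) (auto simp: V_def)
      then show ?thesis using diameter_closure[OF U(2)] by simp
    qed
    have cF: "compact (F ` (V i \<times> {1..2} \<times> {0..1}))" for i
      unfolding F_def case_prod_beta using V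
      by (intro compact_continuous_image continuous_intros compact_Times) auto
    have meas: "range (\<lambda>i. F ` (V i \<times> {1..2} \<times> {0..1})) \<subseteq> sets lborel"
    proof
      fix S assume "S \<in> range (\<lambda>i. F ` (V i \<times> {1..2} \<times> {0..1}))"
      then obtain i where "S = F ` (V i \<times> {1..2} \<times> {0..1})" by blast
      then show "S \<in> sets lborel" using borel_compact[OF cF[of i]] by simp
    qed
    have "W \<subseteq> (\<Union>i. F ` (V i \<times> {1..2} \<times> {0..1}))"
    proof
      fix y assume "y \<in> W"
      then obtain x s t where y: "x \<in> A" "s \<in> {1..2}" "t \<in> {0..1}" "y = F (x, s, t)" using WF by blast
      then obtain i where "x \<in> U i" using U(1) by blast
      then have "x \<in> V i" using y(1) closure_subset[of "U i"] by (auto simp: V_def A)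
      then have "y \<in> F ` (V i \<times> {1..2} \<times> {0..1})" unfolding y(4) using y(2,3) by (intro imageI) simp
      then show "y \<in> (\<Union>i. F ` (V i \<times> {1..2} \<times> {0..1}))" by (rule UN_I[OF UNIV_I])
    qed
    then have "w \<le> emeasure lborel (\<Union>i. F ` (V i \<times> {1..2} \<times> {0..1}))"
      unfolding w_def by (rule emeasure_mono) (rule sets.countable_UN[OF meas])
    also have "\<dots> \<le> (\<Sum>i. emeasure lborel (F ` (V i \<times> {1..2} \<times> {0..1})))"
      by (rule emeasure_subadditive_countably[OF meas])
    also have "\<dots> \<le> (\<Sum>i. ennreal C' * ennreal (unit_ball_vol (real m) * (diameter (U i) / 2) ^ m))"
    proof (intro suminf_le summableI)
      fix i
      have "emeasure lborel (F ` (V i \<times> {1..2} \<times> {0..1})) \<le> ennreal (C * diameter (V i) ^ m)"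
        unfolding F_def C_def using dV[of i] U(3)[of i] e
        by (intro plate_volume_diameter[OF V R _ _ N m]) auto
      also have "\<dots> \<le> ennreal (C * diameter (U i) ^ m)"
        using Cpos dV diameter_ge_0[OF compact_imp_bounded[OF V(1)]] by (intro ennreal_leI mult_left_mono power_mono) auto
      also have "C * diameter (U i) ^ m = C' * (unit_ball_vol (real m) * (diameter (U i) / 2) ^ m)"
        using ub by (simp add: C'_def power_divide)
      also have "ennreal \<dots> = ennreal C' * ennreal (unit_ball_vol (real m) * (diameter (U i) / 2) ^ m)"
        using Cpos diameter_ge_0[OF U(2)] by (intro ennreal_mult) auto
      finally show "emeasure lborel (F ` (V i \<times> {1..2} \<times> {0..1}))
          \<le> ennreal C' * ennreal (unit_ball_vol (real m) * (diameter (U i) / 2) ^ m)" .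
    qed
    also have "\<dots> = ennreal C' * (\<Sum>i. ennreal (unit_ball_vol (real m) * (diameter (U i) / 2) ^ m))"
      by (rule ennreal_suminf_cmult)
    finally show "w / ennreal C' \<le> (\<Sum>i. ennreal (unit_ball_vol (real m) * (diameter (U i) / 2) ^ m))"
      using Cpos by (simp add: divide_le_posI_ennreal mult.commute)
  qed simp
  moreover have "w / ennreal C' > 0" using wpos by (simp add: ennreal_zero_less_divide)
  ultimately show ?thesis by order
qed


section \<open>Tangential gradients\<close>

definition height_grad :: "real \<Rightarrow> 'a::euclidean_space \<Rightarrow> 'a \<Rightarrow> 'a" where
  "height_grad R p x = (p - height R p x *\<^sub>R x) /\<^sub>R R\<^sup>2"

text \<open>
  Differentiate along a curve on the sphere through \<open>x\<close> with velocity \<open>v - v'\<close>.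
\<close>

lemma has_sph_grad_unique:
  assumes R: "R > 0" and x: "x \<in> sphere 0 R" and v: "has_sph_grad R u v x" "has_sph_grad R u v' x"
  shows "v = v'"
proof -
  define d where "d = v - v'"
  define \<gamma> where "\<gamma> = (\<lambda>t::real. (R / sqrt (R\<^sup>2 + t\<^sup>2 * (d \<bullet> d))) *\<^sub>R (x + t *\<^sub>R d))"
  have dx: "d \<bullet> x = 0" using v by (simp add: d_def has_sph_grad_def inner_diff_left)
  have xx: "x \<bullet> x = R\<^sup>2" using x by (simp add: power2_norm_eq_inner[symmetric])
  have pos: "R\<^sup>2 + t\<^sup>2 * (d \<bullet> d) > 0" for t using R by (simp add: add_pos_nonneg)
  have n: "norm (x + t *\<^sub>R d) = sqrt (R\<^sup>2 + t\<^sup>2 * (d \<bullet> d))" for t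
    unfolding norm_eq_sqrt_inner using dx
    by (simp add: inner_add_left inner_add_right xx inner_commute[of x d] power2_eq_square mult.assoc)
  have im: "range \<gamma> \<subseteq> sphere 0 R"
  proof -
    have "norm (\<gamma> t) = R" for t using R pos[of t] by (simp add: \<gamma>_def n)
    then show ?thesis by auto
  qed
  have g0: "\<gamma> 0 = x" using R by (simp add: \<gamma>_def)
  have "((\<lambda>t. R / sqrt (R\<^sup>2 + t\<^sup>2 * (d \<bullet> d))) has_real_derivative 0) (at 0)"
    using R by (auto intro!: derivative_eq_intros)
  then have "((\<lambda>t. R / sqrt (R\<^sup>2 + t\<^sup>2 * (d \<bullet> d))) has_derivative (\<lambda>h. 0)) (at 0)"
    by (simp add: has_field_derivative_def lambda_zero)
  then have gd: "(\<gamma> has_derivative (\<lambda>h. h *\<^sub>R d)) (at 0)"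
    unfolding \<gamma>_def using R by (auto intro!: derivative_eq_intros)
  have "(u \<circ> \<gamma> has_derivative ((\<lambda>h. w \<bullet> h) \<circ> (\<lambda>h. h *\<^sub>R d))) (at 0)" if "has_sph_grad R u w x" for w
  proof (rule diff_chain_within[OF gd])
    show "(u has_derivative (\<lambda>h. w \<bullet> h)) (at (\<gamma> 0) within range \<gamma>)"
      unfolding g0 using that im by (auto simp: has_sph_grad_def intro: has_derivative_subset)
  qed
  from has_derivative_unique[OF this[OF v(1)] this[OF v(2)]]
  have "v \<bullet> d = v' \<bullet> d" by (metis comp_apply scaleR_one)
  then have "d \<bullet> d = 0" by (simp add: d_def inner_diff_left)
  then show ?thesis by (simp add: d_def)
qed

lemma sph_grad_eqI:
  "R > 0 \<Longrightarrow> x \<in> sphere 0 R \<Longrightarrow> has_sph_grad R u v x \<Longrightarrow> sph_grad R u x = v"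
  unfolding sph_grad_def by (rule the_equality) (auto intro: has_sph_grad_unique)

text \<open>
  On the sphere the function \<open>y \<bullet> y - R\<^sup>2\<close> vanishes, and subtracting a multiple of it removes the normal
  component of the ambient gradient.
\<close>

lemma has_sph_grad_ambient:
  fixes x g :: "'a::euclidean_space"
  assumes R: "R > 0" and x: "x \<in> sphere 0 R" and u: "(u has_derivative (\<lambda>h. g \<bullet> h)) (at x)"
  shows "has_sph_grad R u (g - ((g \<bullet> x) / R\<^sup>2) *\<^sub>R x) x"
proof -
  define k where "k = (g \<bullet> x) / R\<^sup>2"
  have xx: "x \<bullet> x = R\<^sup>2" using x by (simp add: power2_norm_eq_inner[symmetric])
  have "((\<lambda>y. u y - k * ((y \<bullet> y - R\<^sup>2) / 2)) has_derivative (\<lambda>h. (g - k *\<^sub>R x) \<bullet> h)) (at x within sphere 0 R)"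
    using has_derivative_at_withinI[OF u]
    by (auto intro!: derivative_eq_intros simp: inner_diff_left inner_diff_right inner_commute field_simps fun_eq_iff)
  then have "(u has_derivative (\<lambda>h. (g - k *\<^sub>R x) \<bullet> h)) (at x within sphere 0 R)"
    by (rule has_derivative_transform[rotated 2])
       (use x in \<open>auto simp: power2_norm_eq_inner[symmetric]\<close>)
  moreover have "(g - k *\<^sub>R x) \<bullet> x = 0" using R by (simp add: inner_diff_left xx k_def)
  ultimately show ?thesis unfolding has_sph_grad_def k_def by blast
qed

lemma has_sph_grad_height:
  fixes p :: "'a::euclidean_space"
  assumes R: "R > 0" and x: "x \<in> sphere 0 R" and F: "(F has_real_derivative d) (at (height R p x))"
  shows "has_sph_grad R (\<lambda>y. F (height R p y)) (d *\<^sub>R height_grad R p x) x"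
proof -
  have "(height R p has_derivative (\<lambda>h. h \<bullet> p / R\<^sup>2)) (at x)"
    unfolding height_def[abs_def] divide_inverse by (auto intro!: derivative_eq_intros)
  from has_derivative_compose[OF this F[unfolded has_field_derivative_def]]
  have "((\<lambda>y. F (height R p y)) has_derivative (\<lambda>h. ((d / R\<^sup>2) *\<^sub>R p) \<bullet> h)) (at x)"
    by (simp add: inner_commute)
  from has_sph_grad_ambient[OF R x this] show ?thesis
    by (simp add: height_grad_def height_def scaleR_diff_right inner_commute field_simps)
qed

lemma height_grad_tangent:
  assumes "R > 0" "x \<in> sphere 0 R"
  shows "height_grad R p x \<bullet> x = 0"
proof -
  have "x \<bullet> x = R\<^sup>2" using assms by (simp add: power2_norm_eq_inner[symmetric])
  then show ?thesis using assms by (simp add: height_grad_def height_def inner_diff_left inner_commute[of p x])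
qed

lemma norm_height_grad:
  fixes p :: "'a::euclidean_space"
  assumes R: "R > 0" and p: "p \<in> sphere 0 R" and x: "x \<in> sphere 0 R"
  shows "height_grad R p x \<bullet> p / R\<^sup>2 = (1 - (height R p x)\<^sup>2) / R\<^sup>2"
    and "norm (height_grad R p x) = sqrt (1 - (height R p x)\<^sup>2) / R"
proof -
  have pp: "p \<bullet> p = R\<^sup>2" using p by (simp add: power2_norm_eq_inner[symmetric])
  have xp: "x \<bullet> p = R\<^sup>2 * height R p x" using R by (simp add: height_def)
  have zp: "height_grad R p x \<bullet> p = 1 - (height R p x)\<^sup>2"
    using R by (simp add: height_grad_def inner_diff_left pp xp field_simps power2_eq_square)
  then show "height_grad R p x \<bullet> p / R\<^sup>2 = (1 - (height R p x)\<^sup>2) / R\<^sup>2" by simp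
  have "height_grad R p x \<bullet> height_grad R p x = (height_grad R p x \<bullet> p - height R p x * (height_grad R p x \<bullet> x)) / R\<^sup>2"
    by (subst (2) height_grad_def) (simp add: inner_diff_right divide_inverse mult.commute)
  then have "height_grad R p x \<bullet> height_grad R p x = (1 - (height R p x)\<^sup>2) / R\<^sup>2"
    using height_grad_tangent[OF R x, of p] zp by simp
  then show "norm (height_grad R p x) = sqrt (1 - (height R p x)\<^sup>2) / R"
    using R by (simp add: norm_eq_sqrt_inner real_sqrt_divide)
qed

lemma continuous_on_height_grad [continuous_intros]: "continuous_on S (height_grad R (p::'a::euclidean_space))"
  unfolding height_grad_def[abs_def] by (intro continuous_intros)

lemma test_fun_derivative:
  assumes "test_fun R \<Omega> (\<phi> :: 'a::euclidean_space \<Rightarrow> real)"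
  shows "(\<phi> has_derivative frechet_derivative \<phi> (at x)) (at x)"
    and "continuous_on UNIV (\<lambda>x. frechet_derivative \<phi> (at x) v)"
    and "continuous_on UNIV \<phi>"
proof -
  have "Ck (Suc 0) \<phi>" "Ck 0 \<phi>" using assms unfolding test_fun_def by blast+
  then show "(\<phi> has_derivative frechet_derivative \<phi> (at x)) (at x)"
    "continuous_on UNIV (\<lambda>x. frechet_derivative \<phi> (at x) v)" "continuous_on UNIV \<phi>"
    by (auto simp: frechet_derivative_works[symmetric])
qed

text \<open>
  Only the derivative of a test function in tangential directions enters the weak equation, so its
  gradient can be eliminated in favour of the ambient derivative.
\<close>

lemma test_fun_sph_grad_inner:
  fixes z :: "'a::euclidean_space"
  assumes R: "R > 0" and x: "x \<in> sphere 0 R" and t: "test_fun R \<Omega> \<phi>" and z: "z \<bullet> x = 0"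
  shows "z \<bullet> sph_grad R \<phi> x = frechet_derivative \<phi> (at x) z"
proof -
  define D where "D = frechet_derivative \<phi> (at x)"
  have D: "(\<phi> has_derivative D) (at x)" using test_fun_derivative(1)[OF t] by (simp add: D_def)
  then have lin: "linear D" by (rule has_derivative_linear)
  define g where "g = (\<Sum>b\<in>Basis. D b *\<^sub>R b)"
  have Dg: "D h = g \<bullet> h" for h
  proof -
    have "D h = D (\<Sum>b\<in>Basis. (h \<bullet> b) *\<^sub>R b)" by (simp add: euclidean_representation)
    also have "\<dots> = (\<Sum>b\<in>Basis. (h \<bullet> b) * D b)" by (simp add: linear_sum[OF lin] linear_cmul[OF lin])
    also have "\<dots> = g \<bullet> h" by (simp add: g_def inner_sum_left inner_commute[of h] mult.commute)
    finally show ?thesis .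
  qed
  have "(\<phi> has_derivative (\<lambda>h. g \<bullet> h)) (at x)" using D ext[of D "\<lambda>h. g \<bullet> h", OF Dg] by simp
  from sph_grad_eqI[OF R x has_sph_grad_ambient[OF R x this]]
  show ?thesis using z by (simp add: inner_diff_right Dg D_def[symmetric] inner_commute)
qed

lemma sph_grad_zero_outside:
  assumes R: "R > 0" and x: "x \<in> sphere 0 R" and K: "closed K" "x \<notin> K" and z: "\<And>y. y \<in> sphere 0 R - K \<Longrightarrow> \<phi> y = 0"
  shows "sph_grad R \<phi> x = 0"
proof (rule sph_grad_eqI[OF R x])
  have "open (- K)" "x \<in> - K" using K by auto
  then obtain e where e: "e > 0" "ball x e \<subseteq> - K" by (meson openE)
  have "(\<phi> has_derivative (\<lambda>h. 0)) (at x within sphere 0 R)"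
    by (rule has_derivative_transform_within[OF has_derivative_const e(1) x])
       (use e z in \<open>auto simp: dist_commute subset_iff\<close>)
  then show "has_sph_grad R \<phi> 0 x" by (simp add: has_sph_grad_def)
qed


section \<open>The divergence theorem for radial fields\<close>

text \<open>
  By translation invariance of Lebesgue measure the difference quotients of \<open>g\<close> in the direction \<open>b\<close>
  have integral \<open>0\<close>, and they converge dominatedly.
\<close>

lemma integral_directional_derivative_zero:
  fixes g :: "'a::euclidean_space \<Rightarrow> real"
  assumes g: "\<And>x. (g has_derivative g' x) (at x)" and cont: "continuous_on UNIV (\<lambda>x. g' x b)"
    and z: "\<And>x. norm x \<ge> B \<Longrightarrow> g x = 0"
  shows "integrable lborel (\<lambda>x. g' x b)" and "(LINT x|lborel. g' x b) = 0"
proof -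
  have gc: "continuous_on UNIV g"
    using g by (meson continuous_at_imp_continuous_on has_derivative_continuous)
  have "bounded ((\<lambda>x. g' x b) ` cball 0 (B + 2 * norm b))"
    by (intro compact_imp_bounded compact_continuous_image continuous_on_subset[OF cont]) auto
  then obtain M where "\<forall>x\<in>cball 0 (B + 2 * norm b). \<bar>g' x b\<bar> \<le> M"
    unfolding bounded_iff by auto
  then have M: "\<And>x. norm x \<le> B + 2 * norm b \<Longrightarrow> \<bar>g' x b\<bar> \<le> M" by simp
  define d where "d = (\<lambda>n x. (g (x + (1 / real (Suc n)) *\<^sub>R b) - g x) / (1 / real (Suc n)))"
  define w where "w = (\<lambda>x::'a. \<bar>M\<bar> * indicator (cball 0 (B + norm b)) x :: real)"
  have deriv: "((\<lambda>t. g (x + t *\<^sub>R b)) has_real_derivative g' (x + t *\<^sub>R b) b) (at t)" for x t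
  proof -
    have "((\<lambda>t. x + t *\<^sub>R b) has_derivative (\<lambda>h. h *\<^sub>R b)) (at t)"
      by (auto intro!: derivative_eq_intros)
    from has_derivative_compose[OF this g]
    have "((\<lambda>t. g (x + t *\<^sub>R b)) has_derivative (\<lambda>h. g' (x + t *\<^sub>R b) (h *\<^sub>R b))) (at t)" .
    moreover have "(\<lambda>h. g' (x + t *\<^sub>R b) (h *\<^sub>R b)) = (\<lambda>h. g' (x + t *\<^sub>R b) b * h)"
      using linear_cmul[OF has_derivative_linear[OF g]] by (auto simp: mult.commute)
    ultimately show ?thesis by (simp add: has_field_derivative_def)
  qed
  have bound: "norm (d n x) \<le> w x" for n x
  proof (cases "norm x \<le> B + norm b")
    case True
    define t where "t = 1 / real (Suc n)"
    have t: "0 < t" "t \<le> 1" by (auto simp: t_def)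
    obtain s where s: "0 < s" "s < t" "g (x + t *\<^sub>R b) - g (x + 0 *\<^sub>R b) = (t - 0) * g' (x + s *\<^sub>R b) b"
      using MVT2[OF t(1), of "\<lambda>t. g (x + t *\<^sub>R b)" "\<lambda>t. g' (x + t *\<^sub>R b) b"] deriv by blast
    have "norm (x + s *\<^sub>R b) \<le> norm x + norm (s *\<^sub>R b)" by (rule norm_triangle_ineq)
    also have "norm (s *\<^sub>R b) \<le> 1 * norm b" using s t by (simp add: mult_left_le_one_le)
    finally have "\<bar>g' (x + s *\<^sub>R b) b\<bar> \<le> M" using True by (intro M) simp
    moreover have "d n x = (g (x + t *\<^sub>R b) - g x) / t" unfolding d_def t_def ..
    then have "d n x = g' (x + s *\<^sub>R b) b" using s t by simp
    ultimately show ?thesis using True by (simp add: w_def)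
  next
    case False
    have "norm x \<le> norm (x + (1 / real (Suc n)) *\<^sub>R b) + norm ((1 / real (Suc n)) *\<^sub>R b)"
      using norm_triangle_ineq4[of "x + (1 / real (Suc n)) *\<^sub>R b" "(1 / real (Suc n)) *\<^sub>R b"] by simp
    moreover have "norm ((1 / real (Suc n)) *\<^sub>R b) \<le> norm b"
      by (simp add: divide_le_eq) (metis le_add_same_cancel2 mult.commute mult_left_mono norm_ge_zero of_nat_0_le_iff distrib_left mult.right_neutral add.commute mult_nonneg_nonneg)
    ultimately have "norm (x + (1 / real (Suc n)) *\<^sub>R b) \<ge> B" using False by linarith
    moreover have "norm x \<ge> B" using False norm_ge_zero[of b] by linarith
    ultimately show ?thesis using z by (simp add: d_def w_def)
  qed
  have lim: "(\<lambda>n. d n x) \<longlonglongrightarrow> g' x b" for x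
  proof -
    have "((\<lambda>h. (g (x + h *\<^sub>R b) - g x) / h) \<longlongrightarrow> g' x b) (at 0)"
      using deriv[of x 0] by (simp add: DERIV_def)
    moreover have "filterlim (\<lambda>n. 1 / real (Suc n)) (at 0) sequentially"
      unfolding filterlim_at using LIMSEQ_inverse_real_of_nat by (auto simp: inverse_eq_divide)
    ultimately show ?thesis unfolding d_def by (rule filterlim_compose)
  qed
  have "emeasure lborel (cball 0 (B + norm b) :: 'a set) < \<infinity>"
    by (rule emeasure_lborel_cball_finite)
  then have wi: "integrable lborel w"
    unfolding w_def by (intro integrable_mult_right integrable_real_indicator) auto
  have gm: "g \<in> borel_measurable borel" using gc by (rule borel_measurable_continuous_onI)
  have g'm: "(\<lambda>x. g' x b) \<in> borel_measurable lborel" using cont by (simp add: borel_measurable_continuous_onI)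
  have dm: "d n \<in> borel_measurable lborel" for n
    unfolding d_def using gm by measurable
  show "integrable lborel (\<lambda>x. g' x b)"
    by (rule integrable_dominated_convergence[where s = d and w = w]) (use g'm dm wi lim bound in auto)
  have gi: "integrable lborel g"
  proof -
    have "integrable lborel (\<lambda>x. indicator (cball 0 B) x *\<^sub>R g x)"
      by (intro borel_integrable_compact continuous_on_subset[OF gc]) auto
    moreover have "(\<lambda>x. indicator (cball 0 B) x *\<^sub>R g x) = g"
      using z by (auto simp: indicator_def fun_eq_iff)
    ultimately show ?thesis by simp
  qed
  have shift: "integrable lborel (\<lambda>x. g (x + c))" "(LINT x|lborel. g (x + c)) = (LINT x|lborel. g x)" for c
  proof -
    have "integrable (distr lborel borel ((+) c)) g" using gi by (simp add: lborel_distr_plus)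
    then show "integrable lborel (\<lambda>x. g (x + c))" using gm
      by (subst (asm) integrable_distr_eq) (auto simp: add.commute)
    have "(LINT x|lborel. g x) = (LINT x|distr lborel borel ((+) c). g x)" by (simp add: lborel_distr_plus)
    also have "\<dots> = (LINT x|lborel. g (x + c))" using gm by (subst integral_distr) (auto simp: add.commute)
    finally show "(LINT x|lborel. g (x + c)) = (LINT x|lborel. g x)" by simp
  qed
  have "(LINT x|lborel. d n x) = 0" for n
    unfolding d_def using shift gi by (simp add: Bochner_Integration.integral_diff)
  moreover have "(\<lambda>n. LINT x|lborel. d n x) \<longlonglongrightarrow> (LINT x|lborel. g' x b)"
    by (rule integral_dominated_convergence[where w = w]) (use g'm dm wi lim bound in auto)
  ultimately show "(LINT x|lborel. g' x b) = 0" by (simp add: LIMSEQ_const_iff)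
qed

text \<open>
  The integrand is the divergence of \<open>s T\<close>. The field \<open>T\<close> is tangent to all spheres about the origin and
  is a positive multiple of the gradient of the height on each of them, so radial cutoffs in \<open>s\<close> are
  not differentiated by it.
\<close>

lemma integral_divergence_tangential:
  fixes s :: "'a::euclidean_space \<Rightarrow> real" and p :: 'a
  defines "T \<equiv> \<lambda>x. (x \<bullet> x) *\<^sub>R p - (x \<bullet> p) *\<^sub>R x"
  assumes s: "\<And>x. (s has_derivative s' x) (at x)" and cont: "\<And>b. continuous_on UNIV (\<lambda>x. s' x b)"
    and z: "\<And>x. norm x \<ge> B \<Longrightarrow> s x = 0"
  shows "(LINT x|lborel. s' x (T x) + s x * ((1 - real DIM('a)) * (x \<bullet> p))) = 0"
proof -
  define T' where "T' = (\<lambda>x h. (2 * (x \<bullet> h)) *\<^sub>R p - (h \<bullet> p) *\<^sub>R x - (x \<bullet> p) *\<^sub>R h)"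
  define g' where "g' = (\<lambda>b x h. s' x h * (T x \<bullet> b) + s x * (T' x h \<bullet> b))"
  have sc: "continuous_on UNIV s"
    using s by (meson continuous_at_imp_continuous_on has_derivative_continuous)
  have Td: "(T has_derivative T' x) (at x)" for x
    unfolding T_def T'_def by (auto intro!: derivative_eq_intros simp: algebra_simps inner_commute fun_eq_iff scaleR_2)
  have gd: "((\<lambda>x. s x * (T x \<bullet> b)) has_derivative g' b x) (at x)" for b x
    unfolding g'_def by (auto intro!: derivative_eq_intros s Td simp: algebra_simps)
  have gc: "continuous_on UNIV (\<lambda>x. g' b x b)" for b
    unfolding g'_def T_def T'_def by (intro continuous_intros cont sc)
  have i: "integrable lborel (\<lambda>x. g' b x b)" "(LINT x|lborel. g' b x b) = 0" for b
    using integral_directional_derivative_zero[OF gd gc, of B b] z by auto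
  have "(\<Sum>b\<in>Basis. g' b x b) = s' x (T x) + s x * ((1 - real DIM('a)) * (x \<bullet> p))" for x
  proof -
    have lin: "linear (s' x)" using s by (rule has_derivative_linear)
    have "(\<Sum>b\<in>Basis. g' b x b) = (\<Sum>b\<in>Basis. (T x \<bullet> b) * s' x b) + s x * (\<Sum>b\<in>Basis. T' x b \<bullet> b)"
      by (simp add: g'_def sum.distrib sum_distrib_left mult.commute)
    also have "(\<Sum>b\<in>Basis. (T x \<bullet> b) * s' x b) = s' x (\<Sum>b\<in>Basis. (T x \<bullet> b) *\<^sub>R b)"
      by (simp add: linear_sum[OF lin] linear_cmul[OF lin])
    also have "\<dots> = s' x (T x)" by (simp add: euclidean_representation)
    also have "(\<Sum>b\<in>Basis. T' x b \<bullet> b) = (\<Sum>b\<in>Basis. 2 * ((x \<bullet> b) * (p \<bullet> b)) - (x \<bullet> b) * (p \<bullet> b) - (x \<bullet> p) * (b \<bullet> b))"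
      by (intro sum.cong) (simp_all add: T'_def inner_diff_left inner_commute[of _ p])
    also have "\<dots> = (\<Sum>b\<in>Basis. (x \<bullet> b) * (p \<bullet> b)) - (\<Sum>b\<in>(Basis::'a set). x \<bullet> p)"
      unfolding sum_subtractf[symmetric] by (intro sum.cong) (auto simp: inner_Basis)
    also have "\<dots> = (1 - real DIM('a)) * (x \<bullet> p)"
      by (simp add: euclidean_inner[of x p] algebra_simps)
    finally show ?thesis .
  qed
  then have "(LINT x|lborel. s' x (T x) + s x * ((1 - real DIM('a)) * (x \<bullet> p))) = (LINT x|lborel. (\<Sum>b\<in>Basis. g' b x b))"
    by simp
  also have "\<dots> = (\<Sum>b\<in>Basis. LINT x|lborel. g' b x b)" using i by (intro Bochner_Integration.integral_sum) auto
  finally show ?thesis using i by simp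
qed

lemma DERIV_glue:
  fixes f g :: "real \<Rightarrow> real"
  assumes f: "(f has_real_derivative d) (at a)" and g: "(g has_real_derivative d) (at a)" and "f a = g a"
  shows "((\<lambda>x. if x \<le> a then f x else g x) has_real_derivative d) (at a)"
proof -
  let ?h = "\<lambda>x. if x \<le> a then f x else g x"
  have "((\<lambda>y. (?h y - ?h a) / (y - a)) \<longlongrightarrow> d) (at a)"
  proof (rule filterlim_split_at)
    have "((\<lambda>y. (f y - f a) / (y - a)) \<longlongrightarrow> d) (at_left a)"
      using f[unfolded has_field_derivative_iff] by (rule filterlim_mono) (auto simp: at_le)
    then show "((\<lambda>y. (?h y - ?h a) / (y - a)) \<longlongrightarrow> d) (at_left a)"
      by (rule Lim_transform_eventually) (auto simp: eventually_at_filter)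
    have "((\<lambda>y. (g y - g a) / (y - a)) \<longlongrightarrow> d) (at_right a)"
      using g[unfolded has_field_derivative_iff] by (rule filterlim_mono) (auto simp: at_le)
    then show "((\<lambda>y. (?h y - ?h a) / (y - a)) \<longlongrightarrow> d) (at_right a)"
      by (rule Lim_transform_eventually) (auto simp: eventually_at_filter assms(3))
  qed
  then show ?thesis by (simp add: has_field_derivative_iff)
qed

text \<open>
  The one-sided hypotheses concern the single point \<open>x\<close>, so that nested definitions can be glued whose
  pieces are differentiable only on the range where they are used.
\<close>

lemma DERIV_glue_at:
  fixes f g :: "real \<Rightarrow> real"
  assumes f: "x \<le> a \<Longrightarrow> (f has_real_derivative f') (at x)"
    and g: "x \<ge> a \<Longrightarrow> (g has_real_derivative g') (at x)"
    and eq: "f a = g a" "x = a \<Longrightarrow> f' = g'"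
  shows "((\<lambda>x. if x \<le> a then f x else g x) has_real_derivative (if x \<le> a then f' else g')) (at x)"
proof (cases x a rule: linorder_cases)
  case less
  then show ?thesis using f
    by (auto elim: has_field_derivative_transform_within_open[where S = "{..<a}"])
next
  case equal
  then show ?thesis using DERIV_glue[of f f' a g] f g eq by simp
next
  case greater
  then show ?thesis using g
    by (auto elim: has_field_derivative_transform_within_open[where S = "{a<..}"])
qed

text \<open>
  A continuously differentiable transition from \<open>0\<close> to \<open>1\<close>, used to build radial cutoffs.
\<close>

definition ramp :: "real \<Rightarrow> real" where
  "ramp t = (if t \<le> 0 then 0 else t\<^sup>2 / (1 + t\<^sup>2))"

definition ramp' :: "real \<Rightarrow> real" where
  "ramp' t = (if t \<le> 0 then 0 else 2 * t / (1 + t\<^sup>2)\<^sup>2)"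

lemma ramp_deriv: "(ramp has_real_derivative ramp' t) (at t)"
  unfolding ramp_def[abs_def] ramp'_def
proof (rule DERIV_glue_at)
  have "1 + t\<^sup>2 \<noteq> 0" by (metis add_pos_nonneg less_irrefl zero_le_power2 zero_less_one)
  then show "((\<lambda>t. t\<^sup>2 / (1 + t\<^sup>2)) has_real_derivative 2 * t / (1 + t\<^sup>2)\<^sup>2) (at t)"
    by (auto intro!: derivative_eq_intros simp: field_simps power2_eq_square)
qed auto

lemma ramp'_continuous: "continuous_on UNIV ramp'"
proof -
  have "continuous_on ({..0} \<union> {0..}) (\<lambda>t::real. if t \<le> 0 then 0 else 2 * t / (1 + t\<^sup>2)\<^sup>2)"
  proof (rule continuous_on_cases)
    have "1 + x\<^sup>2 \<noteq> 0" for x :: real by (metis add_pos_nonneg less_irrefl zero_le_power2 zero_less_one)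
    then show "continuous_on {0..} (\<lambda>t::real. 2 * t / (1 + t\<^sup>2)\<^sup>2)" by (intro continuous_intros) auto
  qed auto
  moreover have "{..0} \<union> {0..} = (UNIV :: real set)" by auto
  ultimately show ?thesis unfolding ramp'_def[abs_def] by simp
qed

lemma ramp_bounds: "0 \<le> ramp t" "ramp t \<le> 1"
  by (auto simp: ramp_def divide_le_eq add_pos_nonneg)

lemma ramp_limit: "(ramp \<longlongrightarrow> 1) at_top"
proof -
  have "((\<lambda>t::real. 1 - 1 / (1 + t\<^sup>2)) \<longlongrightarrow> 1 - 0) at_top"
    by (intro tendsto_intros tendsto_divide_0[OF tendsto_const] filterlim_at_top_imp_at_infinity
        filterlim_tendsto_add_at_top[OF tendsto_const] filterlim_pow_at_top filterlim_ident) auto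
  then have "((\<lambda>t::real. 1 - 1 / (1 + t\<^sup>2)) \<longlongrightarrow> 1) at_top" by simp
  moreover have "\<forall>\<^sub>F t in at_top. 1 - 1 / (1 + t\<^sup>2) = ramp t"
  proof (rule eventually_mono[OF eventually_gt_at_top[of 0]])
    fix t :: real assume t: "0 < t"
    have "1 + t\<^sup>2 > 0" by (simp add: add_pos_nonneg)
    then show "1 - 1 / (1 + t\<^sup>2) = ramp t" using t by (simp add: ramp_def field_simps)
  qed
  ultimately show ?thesis by (rule Lim_transform_eventually)
qed

lemma rproj_derivative:
  fixes x :: "'a::euclidean_space"
  assumes x: "x \<noteq> 0"
  shows "(rproj R has_derivative (\<lambda>h. (R / norm x) *\<^sub>R h - (R * (x \<bullet> h) / norm x ^ 3) *\<^sub>R x)) (at x)"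
proof -
  have n: "(norm has_derivative (\<lambda>h. (x \<bullet> h) / norm x)) (at x)"
    using has_derivative_norm[OF x] by (simp add: sgn_div_norm divide_inverse inner_commute mult.commute)
  have "((\<lambda>y. R / norm y) has_derivative (\<lambda>h. - (R * (x \<bullet> h) / norm x ^ 3))) (at x)"
    using x by (auto intro!: derivative_eq_intros n simp: fun_eq_iff field_simps power3_eq_cube)
  from has_derivative_scaleR[OF this has_derivative_ident]
  show ?thesis unfolding rproj_def[abs_def] by simp
qed

text \<open>
  This is the divergence on the sphere of \<open>q\<close> times the gradient of the height: the Laplacian of
  the height is \<open>- (DIM('a) - 1) / R\<^sup>2\<close> times the height.
\<close>

definition sph_div_integrand :: "real \<Rightarrow> 'a::euclidean_space \<Rightarrow> ('a \<Rightarrow> real) \<Rightarrow> ('a \<Rightarrow> 'a \<Rightarrow> real) \<Rightarrow> 'a \<Rightarrow> real" where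
  "sph_div_integrand R p q q' y = q' y (height_grad R p y) - (real DIM('a) - 1) / R\<^sup>2 * height R p y * q y"

text \<open>
  The field \<open>q \<nabla>h\<close> is extended to the punctured space by homogeneity and multiplied by a radial weight
  \<open>\<eta>\<close> that vanishes near the origin and near infinity. With the extra factor \<open>1 / norm x\<close> in \<open>s\<close>, its
  divergence is \<open>\<eta>\<close> times a function that is constant on rays.
\<close>

lemma weighted_cone_divergence:
  fixes q :: "'a::euclidean_space \<Rightarrow> real" and \<eta> \<eta>' :: "real \<Rightarrow> real"
  assumes R: "R > 0"
    and q: "\<And>x. (q has_derivative q' x) (at x)" and qc: "\<And>b. continuous_on UNIV (\<lambda>x. q' x b)"
    and e: "\<And>s. (\<eta> has_real_derivative \<eta>' s) (at s)" and ec: "continuous_on UNIV \<eta>'"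
    and lo: "\<epsilon> > 0" "\<And>s. s \<le> \<epsilon> \<Longrightarrow> \<eta> s = 0" and hi: "B > 0" "\<And>s. s \<ge> B\<^sup>2 \<Longrightarrow> \<eta> s = 0"
  shows "(LINT x|lborel. \<eta> (x \<bullet> x) * sph_div_integrand R p q q' (rproj R x)) = 0"
proof -
  define P' where "P' = (\<lambda>x h::'a. (R / norm x) *\<^sub>R h - (R * (x \<bullet> h) / norm x ^ 3) *\<^sub>R x)"
  define s where "s = (\<lambda>x. \<eta> (x \<bullet> x) * (q (rproj R x) / norm x))"
  define s' where "s' = (\<lambda>x h. if x = 0 then 0 else
     \<eta>' (x \<bullet> x) * (2 * (x \<bullet> h)) * (q (rproj R x) / norm x)
     + \<eta> (x \<bullet> x) * (q' (rproj R x) (P' x h) / norm x - q (rproj R x) * (x \<bullet> h) / norm x ^ 3))"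
  have lin: "linear (q' x)" for x using q by (rule has_derivative_linear)
  have qcont: "continuous_on UNIV q" using q by (meson continuous_at_imp_continuous_on has_derivative_continuous)
  have econt: "continuous_on UNIV \<eta>" using e by (meson DERIV_isCont continuous_at_imp_continuous_on)
  have Pd: "(rproj R has_derivative P' x) (at x)" if "x \<noteq> 0" for x :: 'a
    unfolding P'_def by (rule rproj_derivative[OF that])
  have small: "x \<bullet> x \<le> \<epsilon>" if "x \<in> ball 0 (sqrt \<epsilon>)" for x :: 'a
  proof -
    have "(norm x)\<^sup>2 < (sqrt \<epsilon>)\<^sup>2" using that by (intro power_strict_mono) auto
    then show ?thesis using lo by (simp add: dot_square_norm)
  qed
  have \<eta>'0: "\<eta>' s = 0" if "s < \<epsilon>" for s
  proof -
    have "(\<eta> has_real_derivative 0) (at s)"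
      by (rule has_field_derivative_transform_within_open[where S = "{..<\<epsilon>}" and f = "\<lambda>_. 0"])
         (use that lo in auto)
    then show ?thesis using e DERIV_unique by blast
  qed
  have sd: "(s has_derivative s' x) (at x)" for x
  proof (cases "x = 0")
    case True
    have "(s has_derivative (\<lambda>h. 0)) (at x)"
      by (rule has_derivative_transform_within_open[OF has_derivative_const[of 0] open_ball[of 0 "sqrt \<epsilon>"]])
         (use True lo small in \<open>auto simp: s_def\<close>)
    then show ?thesis using True by (simp add: s'_def)
  next
    case False
    have n: "(norm has_derivative (\<lambda>h. (x \<bullet> h) / norm x)) (at x)"
      using has_derivative_norm[OF False] by (simp add: sgn_div_norm divide_inverse inner_commute mult.commute)
    have 1: "((\<lambda>y. \<eta> (y \<bullet> y)) has_derivative (\<lambda>h. \<eta>' (x \<bullet> x) * (2 * (x \<bullet> h)))) (at x)"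
    proof -
      have "((\<lambda>y. y \<bullet> y) has_derivative (\<lambda>h. 2 * (x \<bullet> h))) (at x)"
        by (auto intro!: derivative_eq_intros simp: inner_commute)
      from has_derivative_compose[OF this e[unfolded has_field_derivative_def]] show ?thesis .
    qed
    have 2: "((\<lambda>y. q (rproj R y)) has_derivative (\<lambda>h. q' (rproj R x) (P' x h))) (at x)"
      by (rule has_derivative_compose[OF Pd[OF False] q])
    have 3: "((\<lambda>y. 1 / norm y) has_derivative (\<lambda>h. - ((x \<bullet> h) / norm x ^ 3))) (at x)"
      using False by (auto intro!: derivative_eq_intros n simp: fun_eq_iff field_simps power3_eq_cube)
    have "((\<lambda>y. \<eta> (y \<bullet> y) * (q (rproj R y) * (1 / norm y))) has_derivative
       (\<lambda>h. \<eta> (x \<bullet> x) * (q (rproj R x) * - ((x \<bullet> h) / norm x ^ 3) + q' (rproj R x) (P' x h) * (1 / norm x))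
          + \<eta>' (x \<bullet> x) * (2 * (x \<bullet> h)) * (q (rproj R x) * (1 / norm x)))) (at x)"
      by (rule has_derivative_mult[OF 1 has_derivative_mult[OF 2 3]])
    moreover have "s' x = (\<lambda>h. \<eta> (x \<bullet> x) * (q (rproj R x) * - ((x \<bullet> h) / norm x ^ 3) + q' (rproj R x) (P' x h) * (1 / norm x))
          + \<eta>' (x \<bullet> x) * (2 * (x \<bullet> h)) * (q (rproj R x) * (1 / norm x)))"
      using False by (simp add: s'_def fun_eq_iff)
    ultimately show ?thesis by (simp add: s_def)
  qed
  have sc: "continuous_on UNIV (\<lambda>x. s' x b)" for b
  proof -
    have rc: "continuous_on (- {0}) (rproj R :: 'a \<Rightarrow> 'a)" by (rule continuous_on_rproj) simp
    have qr: "continuous_on (- {0}) (\<lambda>x. q (rproj R x))" "continuous_on (- {0}) (\<lambda>x. q' (rproj R x) c)" for c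
      by (rule continuous_on_compose2[OF qcont rc] continuous_on_compose2[OF qc rc], simp)+
    have "q' (rproj R x) (P' x b) = (\<Sum>c\<in>Basis. (P' x b \<bullet> c) * q' (rproj R x) c)" for x
    proof -
      have "q' (rproj R x) (P' x b) = q' (rproj R x) (\<Sum>c\<in>Basis. (P' x b \<bullet> c) *\<^sub>R c)" by (simp add: euclidean_representation)
      then show ?thesis by (simp add: linear_sum[OF lin] linear_cmul[OF lin])
    qed
    then have qP: "continuous_on (- {0}) (\<lambda>x. q' (rproj R x) (P' x b))"
      unfolding P'_def by (simp only:) (intro continuous_intros qr; simp)
    have "continuous_on (- {0}) (\<lambda>x. \<eta>' (x \<bullet> x) * (2 * (x \<bullet> b)) * (q (rproj R x) / norm x)
     + \<eta> (x \<bullet> x) * (q' (rproj R x) (P' x b) / norm x - q (rproj R x) * (x \<bullet> b) / norm x ^ 3))"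
      by (intro continuous_intros qP qr continuous_on_compose2[OF econt] continuous_on_compose2[OF ec]) auto
    then have A: "continuous_on (- {0}) (\<lambda>x. s' x b)"
      by (rule continuous_on_eq) (auto simp: s'_def)
    have B: "continuous_on (ball 0 (sqrt \<epsilon>)) (\<lambda>x. s' x b)"
    proof (rule continuous_on_eq[OF continuous_on_const[of _ 0]])
      fix x :: 'a assume x: "x \<in> ball 0 (sqrt \<epsilon>)"
      then have "(norm x)\<^sup>2 < (sqrt \<epsilon>)\<^sup>2" by (intro power_strict_mono) auto
      then have "x \<bullet> x < \<epsilon>" using lo by (simp add: dot_square_norm)
      then show "0 = s' x b" using \<eta>'0 lo(2)[of "x \<bullet> x"] by (simp add: s'_def)
    qed
    have "continuous_on (- {0} \<union> ball 0 (sqrt \<epsilon>)) (\<lambda>x. s' x b)"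
      by (rule continuous_on_open_Un[OF _ _ A B]) auto
    moreover have "- {0} \<union> ball 0 (sqrt \<epsilon>) = (UNIV :: 'a set)" using lo by auto
    ultimately show ?thesis by simp
  qed
  have sz: "s x = 0" if "norm x \<ge> B" for x
  proof -
    have "B\<^sup>2 \<le> x \<bullet> x" using that hi(1) by (simp add: dot_square_norm power_mono)
    then show ?thesis using hi(2) by (simp add: s_def)
  qed
  have "s' x ((x \<bullet> x) *\<^sub>R p - (x \<bullet> p) *\<^sub>R x) + s x * ((1 - real DIM('a)) * (x \<bullet> p))
     = R ^ 3 * (\<eta> (x \<bullet> x) * sph_div_integrand R p q q' (rproj R x))" for x
  proof (cases "x = 0")
    case True
    then show ?thesis using lo by (simp add: s'_def s_def)
  next
    case False
    define T where "T = (x \<bullet> x) *\<^sub>R p - (x \<bullet> p) *\<^sub>R x"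
    define y where "y = rproj R x"
    define r where "r = norm x"
    have r: "r > 0" using False by (simp add: r_def)
    have xx: "x \<bullet> x = r\<^sup>2" by (simp add: r_def dot_square_norm)
    have xT: "x \<bullet> T = 0" by (simp add: T_def inner_diff_right)
    have xp: "x \<bullet> p = r * R * height R p y"
      using r R by (simp add: y_def rproj_def height_def r_def[symmetric] power2_eq_square)
    have Ty: "T = (r\<^sup>2 * R\<^sup>2) *\<^sub>R height_grad R p y"
    proof -
      have "(x \<bullet> p) *\<^sub>R x = (r\<^sup>2 * height R p y) *\<^sub>R y" unfolding xp
        using r R by (simp add: y_def rproj_def r_def[symmetric] power2_eq_square)
      then have "T = r\<^sup>2 *\<^sub>R (p - height R p y *\<^sub>R y)" by (simp add: T_def xx scaleR_diff_right)
      moreover have "(r\<^sup>2 * R\<^sup>2) *\<^sub>R (v /\<^sub>R R\<^sup>2) = r\<^sup>2 *\<^sub>R v" for v :: 'a using R by (simp add: mult.assoc)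
      ultimately show ?thesis by (simp only: height_grad_def)
    qed
    have PT: "P' x T = (R ^ 3 * r) *\<^sub>R height_grad R p y"
    proof -
      have "P' x T = (R / r) *\<^sub>R T" by (simp add: P'_def xT r_def)
      then show ?thesis unfolding Ty using r by (simp add: power2_eq_square power3_eq_cube)
    qed
    have "s' x T = \<eta> (r\<^sup>2) * (R ^ 3 * q' y (height_grad R p y))"
      using False r by (simp add: s'_def xT PT y_def[symmetric] linear_cmul[OF lin] r_def[symmetric] xx)
    moreover have "s x * ((1 - real DIM('a)) * (x \<bullet> p)) = \<eta> (r\<^sup>2) * (R * ((1 - real DIM('a)) * height R p y * q y))"
      unfolding xp s_def using r by (simp add: y_def[symmetric] r_def[symmetric] xx)
    moreover have "R ^ 3 * (\<eta> (r\<^sup>2) * sph_div_integrand R p q q' y)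
        = \<eta> (r\<^sup>2) * (R ^ 3 * q' y (height_grad R p y)) + \<eta> (r\<^sup>2) * (R * ((1 - real DIM('a)) * height R p y * q y))"
      using R by (simp add: sph_div_integrand_def field_simps power2_eq_square power3_eq_cube)
    ultimately show ?thesis unfolding T_def[symmetric] y_def[symmetric] xx[symmetric] by (simp only:)
  qed
  then have "(LINT x|lborel. R ^ 3 * (\<eta> (x \<bullet> x) * sph_div_integrand R p q q' (rproj R x))) = 0"
    using integral_divergence_tangential[OF sd sc sz, where p = p] by simp
  then show ?thesis using R by simp
qed

text \<open>
  Radial weights that converge to the indicator of the punctured ball turn the weighted identity into
  an integral over the sphere.
\<close>

lemma sphere_divergence_theorem:
  fixes q :: "'a::euclidean_space \<Rightarrow> real"
  assumes R: "R > 0"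
    and q: "\<And>x. (q has_derivative q' x) (at x)" and qc: "\<And>b. continuous_on UNIV (\<lambda>x. q' x b)"
  shows "(LINT x|sph_vol R. sph_div_integrand R p q q' x) = 0"
proof -
  define \<Psi> where "\<Psi> = sph_div_integrand R p q q'"
  have lin: "linear (q' x)" for x using q by (rule has_derivative_linear)
  have qcont: "continuous_on UNIV q" using q by (meson continuous_at_imp_continuous_on has_derivative_continuous)
  have "q' y (height_grad R p y) = (\<Sum>b\<in>Basis. (height_grad R p y \<bullet> b) * q' y b)" for y
  proof -
    have "q' y (height_grad R p y) = q' y (\<Sum>b\<in>Basis. (height_grad R p y \<bullet> b) *\<^sub>R b)" by (simp add: euclidean_representation)
    then show ?thesis by (simp add: linear_sum[OF lin] linear_cmul[OF lin])
  qed
  then have \<Psi>c: "continuous_on UNIV \<Psi>"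
    unfolding \<Psi>_def sph_div_integrand_def[abs_def] by (simp only:) (intro continuous_intros qc qcont)
  have \<Psi>m: "\<Psi> \<in> borel_measurable borel" by (rule borel_measurable_continuous_onI[OF \<Psi>c])
  have rm: "rproj R \<in> borel_measurable (borel :: 'a measure)" unfolding rproj_def[abs_def] by measurable
  have "compact (\<Psi> ` cball 0 R)" by (intro compact_continuous_image continuous_on_subset[OF \<Psi>c]) auto
  then have "bounded (\<Psi> ` cball 0 R)" by (rule compact_imp_bounded)
  then obtain M where "\<forall>y\<in>cball 0 R. \<bar>\<Psi> y\<bar> \<le> M" unfolding bounded_iff by auto
  then have M: "\<bar>\<Psi> (rproj R x)\<bar> \<le> M" for x using R by (auto simp: rproj_def)
  \<comment> \<open>The additional terms of order \<open>k\<close> make the weight vanish near \<open>0\<close> and tend to \<open>1\<close> also on the sphere \<open>norm x = R\<close>.\<close>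
  define a where "a = (\<lambda>k::nat. \<lambda>s. real (Suc k) ^ 2 * s - real (Suc k))"
  define b where "b = (\<lambda>k::nat. \<lambda>s. real (Suc k) ^ 2 * (R\<^sup>2 - s) + real (Suc k))"
  define \<eta> where "\<eta> = (\<lambda>k s. ramp (a k s) * ramp (b k s))"
  define \<eta>' where "\<eta>' = (\<lambda>k s. ramp (a k s) * (ramp' (b k s) * - (real (Suc k) ^ 2)) + ramp' (a k s) * real (Suc k) ^ 2 * ramp (b k s))"
  have rc: "continuous_on UNIV ramp" using ramp_deriv by (meson DERIV_isCont continuous_at_imp_continuous_on)
  have ed: "(\<eta> k has_real_derivative \<eta>' k s) (at s)" for k s
  proof -
    have "(a k has_real_derivative real (Suc k) ^ 2) (at s)" "(b k has_real_derivative - (real (Suc k) ^ 2)) (at s)"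
      unfolding a_def b_def by (auto intro!: derivative_eq_intros)
    note DERIV_mult[OF DERIV_chain2[OF ramp_deriv this(1)] DERIV_chain2[OF ramp_deriv this(2)]]
    then show ?thesis unfolding \<eta>_def \<eta>'_def by (simp add: algebra_simps)
  qed
  have ec: "continuous_on UNIV (\<eta>' k)" for k
    unfolding \<eta>'_def a_def b_def
    by (intro continuous_intros continuous_on_compose2[OF rc] continuous_on_compose2[OF ramp'_continuous]) auto
  have lo: "\<eta> k s = 0" if "s \<le> 1 / real (Suc k)" for k s
  proof -
    have "real (Suc k) ^ 2 * s \<le> real (Suc k) ^ 2 * (1 / real (Suc k))" using that by (intro mult_left_mono) auto
    also have "\<dots> = real (Suc k)" by (simp add: power2_eq_square)
    finally show ?thesis by (simp add: \<eta>_def a_def ramp_def)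
  qed
  have hi: "\<eta> k s = 0" if "s \<ge> (R + 1)\<^sup>2" for k s
  proof -
    have "R\<^sup>2 + 1 \<le> s" using that R by (simp add: power2_eq_square algebra_simps)
    then have "real (Suc k) ^ 2 * (R\<^sup>2 - s) \<le> real (Suc k) ^ 2 * (- 1)" by (intro mult_left_mono) auto
    also have "\<dots> \<le> - real (Suc k)"
    proof -
      have "real (Suc k) * 1 \<le> real (Suc k) * real (Suc k)" by (intro mult_left_mono) simp_all
      then show ?thesis unfolding power2_eq_square by (simp only: mult_minus1_right mult_1_right neg_le_iff_le)
    qed
    finally show ?thesis by (simp add: \<eta>_def b_def ramp_def)
  qed
  have zero: "(LINT x|lborel. \<eta> k (x \<bullet> x) * \<Psi> (rproj R x)) = 0" for k
    unfolding \<Psi>_def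
    by (rule weighted_cone_divergence[OF R q qc ed ec, where \<epsilon> = "1 / real (Suc k)" and B = "R + 1"]) (use lo hi R in auto)
  have lin_top: "filterlim (\<lambda>k. real (Suc k)) at_top sequentially"
    by (rule filterlim_compose[OF filterlim_real_sequentially filterlim_Suc])
  have top: "filterlim (\<lambda>k. real (Suc k) ^ 2 * c + d * real (Suc k)) at_top sequentially" if "c > 0" for c d
  proof -
    have "filterlim (\<lambda>t::real. t\<^sup>2 * c + d * t) at_top at_top" using that by real_asymp
    from filterlim_compose[OF this lin_top] show ?thesis .
  qed
  have bot: "filterlim (\<lambda>k. real (Suc k) ^ 2 * c + d * real (Suc k)) at_bot sequentially" if "c < 0" for c d
    using top[of "- c" "- d"] that by (subst filterlim_uminus_at_top[symmetric] filterlim_uminus_at_bot) (simp add: algebra_simps)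
  have ramp0: "(\<lambda>k. ramp (f k)) \<longlonglongrightarrow> 0" if "filterlim f at_bot sequentially" for f
  proof (rule tendsto_eventually)
    have "\<forall>\<^sub>F k in sequentially. f k \<le> 0" using that by (simp add: filterlim_at_bot)
    then show "\<forall>\<^sub>F k in sequentially. ramp (f k) = 0" by eventually_elim (simp add: ramp_def)
  qed
  have lim: "(\<lambda>k. \<eta> k (x \<bullet> x)) \<longlonglongrightarrow> indicator (cball 0 R - {0}) x" for x :: 'a
  proof -
    consider "x = 0" | "x \<noteq> 0" "norm x \<le> R" | "norm x > R" by linarith
    then show ?thesis
    proof cases
      case 1
      then show ?thesis using lo[of 0] by simp
    next
      case 2
      have "(\<lambda>k. ramp (a k (x \<bullet> x))) \<longlonglongrightarrow> 1"
        using filterlim_compose[OF ramp_limit top[of "x \<bullet> x" "-1"]] 2 by (simp add: a_def del: of_nat_Suc)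
      moreover have "(\<lambda>k. ramp (b k (x \<bullet> x))) \<longlonglongrightarrow> 1"
      proof (rule filterlim_compose[OF ramp_limit], rule filterlim_at_top_mono[OF lin_top])
        have "x \<bullet> x \<le> R\<^sup>2" using 2 by (simp add: dot_square_norm power_mono)
        then show "\<forall>\<^sub>F k in sequentially. real (Suc k) \<le> b k (x \<bullet> x)"
          unfolding b_def by (intro always_eventually) simp
      qed
      ultimately have "(\<lambda>k. \<eta> k (x \<bullet> x)) \<longlonglongrightarrow> 1 * 1" unfolding \<eta>_def by (rule tendsto_mult)
      then show ?thesis using 2 by simp
    next
      case 3
      have "R\<^sup>2 < x \<bullet> x" using 3 R by (simp add: dot_square_norm power_strict_mono)
      then have "(\<lambda>k. ramp (b k (x \<bullet> x))) \<longlonglongrightarrow> 0"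
        using ramp0[OF bot[of "R\<^sup>2 - x \<bullet> x" 1]] by (simp add: b_def)
      then have "(\<lambda>k. \<eta> k (x \<bullet> x)) \<longlonglongrightarrow> 0"
        by (rule tendsto_sandwich[OF _ _ tendsto_const, rotated 2])
           (auto simp: \<eta>_def ramp_bounds mult_left_le_one_le intro!: always_eventually mult_nonneg_nonneg)
      then show ?thesis using 3 by simp
    qed
  qed
  define w where "w = (\<lambda>x::'a. M * indicator (cball 0 (R + 1)) x :: real)"
  have "emeasure lborel (cball 0 (R + 1) :: 'a set) < \<infinity>" by (rule emeasure_lborel_cball_finite)
  then have wi: "integrable lborel w"
    unfolding w_def by (intro integrable_mult_right integrable_real_indicator) auto
  have bound: "norm (\<eta> k (x \<bullet> x) * \<Psi> (rproj R x)) \<le> w x" for k x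
  proof (cases "norm x \<le> R + 1")
    case True
    have "\<bar>\<eta> k (x \<bullet> x)\<bar> \<le> 1" unfolding \<eta>_def abs_mult using ramp_bounds by (intro mult_le_one) auto
    then have "\<bar>\<eta> k (x \<bullet> x)\<bar> * \<bar>\<Psi> (rproj R x)\<bar> \<le> 1 * M" using M by (intro mult_mono) auto
    then show ?thesis using True by (simp add: w_def abs_mult)
  next
    case False
    then have "(R + 1)\<^sup>2 \<le> x \<bullet> x" using R by (simp add: dot_square_norm power_mono)
    then show ?thesis using hi False by (simp add: w_def)
  qed
  have em: "\<eta> k \<in> borel_measurable borel" for k
    using ed by (intro borel_measurable_continuous_onI) (meson DERIV_isCont continuous_at_imp_continuous_on)
  have "(\<lambda>k. LINT x|lborel. \<eta> k (x \<bullet> x) * \<Psi> (rproj R x)) \<longlonglongrightarrow>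
     (LINT x|lborel. indicator (cball 0 R - {0}) x * \<Psi> (rproj R x))"
  proof (rule integral_dominated_convergence[where w = w])
    show "AE x in lborel. (\<lambda>k. \<eta> k (x \<bullet> x) * \<Psi> (rproj R x)) \<longlonglongrightarrow> indicator (cball 0 R - {0}) x * \<Psi> (rproj R x)"
      by (intro AE_I2 tendsto_mult lim tendsto_const)
  qed (use wi bound em \<Psi>m rm in \<open>auto intro!: borel_measurable_indicator borel_measurable_times measurable_compose[OF rm \<Psi>m] measurable_compose[OF _ em]\<close>)
  then have "(LINT x|lborel. indicator (cball 0 R - {0}) x * \<Psi> (rproj R x)) = 0"
    unfolding zero by (simp add: LIMSEQ_const_iff)
  moreover have "\<Psi> \<in> borel_measurable (sph_vol R)"
    by (rule continuous_measurable_sph_vol[OF continuous_on_subset[OF \<Psi>c]]) simp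
  ultimately show ?thesis unfolding \<Psi>_def[symmetric] using integral_sph_vol[OF R, of \<Psi>] by simp
qed

text \<open>
  The divergence theorem for the product \<open>q = w h \<phi>\<close>; its derivative along the gradient of the
  height splits by the product rule and \<open>norm (\<nabla>h)\<^sup>2 = (1 - h\<^sup>2) / R\<^sup>2\<close>.
\<close>

lemma sphere_integration_by_parts:
  fixes \<phi> :: "'a::euclidean_space \<Rightarrow> real"
  assumes R: "R > 0" and p: "p \<in> sphere 0 R" and t: "test_fun R \<Omega> \<phi>"
    and w: "\<And>s. (w has_real_derivative w' s) (at s)" and wc: "continuous_on UNIV w'"
  shows "(LINT x|sph_vol R. (w (height R p x) *\<^sub>R height_grad R p x) \<bullet> sph_grad R \<phi> x)
    = (LINT x|sph_vol R. (((real DIM('a) - 1) * height R p x * w (height R p x) - (1 - (height R p x)\<^sup>2) * w' (height R p x)) / R\<^sup>2) * \<phi> x)"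
    (is "?A = ?B")
proof -
  define D where "D = (\<lambda>x. frechet_derivative \<phi> (at x))"
  have T: "(\<phi> has_derivative D x) (at x)" "continuous_on UNIV (\<lambda>x. D x v)" "continuous_on UNIV \<phi>" for x v
    using test_fun_derivative[OF t] by (auto simp: D_def)
  define q where "q = (\<lambda>x. w (height R p x) * \<phi> x)"
  define q' where "q' = (\<lambda>x h. w (height R p x) * D x h + w' (height R p x) * (h \<bullet> p / R\<^sup>2) * \<phi> x)"
  define f where "f = (\<lambda>x. ((real DIM('a) - 1) * height R p x * w (height R p x) - (1 - (height R p x)\<^sup>2) * w' (height R p x)) / R\<^sup>2)"
  have wcont: "continuous_on UNIV w" using w by (meson DERIV_isCont continuous_at_imp_continuous_on)
  have wd: "((\<lambda>x. w (height R p x)) has_derivative (\<lambda>h. w' (height R p x) * (h \<bullet> p / R\<^sup>2))) (at x)" for x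
  proof -
    have "(height R p has_derivative (\<lambda>h. h \<bullet> p / R\<^sup>2)) (at x)"
      unfolding height_def[abs_def] divide_inverse by (auto intro!: derivative_eq_intros)
    from has_derivative_compose[OF this w[unfolded has_field_derivative_def]] show ?thesis .
  qed
  have qd: "(q has_derivative q' x) (at x)" for x
    unfolding q_def q'_def by (rule has_derivative_mult[OF wd T(1)])
  have qc: "continuous_on UNIV (\<lambda>x. q' x b)" for b
    unfolding q'_def using R
    by (intro continuous_intros T continuous_on_compose2[OF wcont] continuous_on_compose2[OF wc]) auto
  have lin: "linear (D x)" for x using T(1) by (rule has_derivative_linear)
  define i1 where "i1 = (\<lambda>x. w (height R p x) * D x (height_grad R p x))"
  define i2 where "i2 = (\<lambda>x. f x * \<phi> x)"
  have eq: "sph_div_integrand R p q q' x = i1 x - i2 x" if "x \<in> sphere 0 R" for x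
    unfolding sph_div_integrand_def q_def q'_def norm_height_grad(1)[OF R p that] i1_def i2_def f_def
    using R by (simp add: field_simps)
  have "D y (height_grad R p y) = (\<Sum>b\<in>Basis. (height_grad R p y \<bullet> b) * D y b)" for y
  proof -
    have "D y (height_grad R p y) = D y (\<Sum>b\<in>Basis. (height_grad R p y \<bullet> b) *\<^sub>R b)" by (simp add: euclidean_representation)
    then show ?thesis by (simp add: linear_sum[OF lin] linear_cmul[OF lin])
  qed
  then have c1: "continuous_on UNIV i1" unfolding i1_def
    by (simp only:) (intro continuous_intros T continuous_on_compose2[OF wcont]; simp)
  have c2: "continuous_on UNIV i2" unfolding i2_def f_def using R
    by (intro continuous_intros T continuous_on_compose2[OF wcont] continuous_on_compose2[OF wc]) auto
  have int: "integrable (sph_vol R) i" if "continuous_on UNIV i" for i :: "'a \<Rightarrow> real"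
    by (rule continuous_integrable_sph_vol[OF R continuous_on_subset[OF that]]) simp
  have "0 = (LINT x|sph_vol R. i1 x - i2 x)"
    using sphere_divergence_theorem[OF R qd qc, of p] eq
    by (metis (no_types, lifting) Bochner_Integration.integral_cong space_sph_vol)
  also have "\<dots> = (LINT x|sph_vol R. i1 x) - (LINT x|sph_vol R. i2 x)"
    using int c1 c2 by (intro Bochner_Integration.integral_diff) auto
  finally have "(LINT x|sph_vol R. i1 x) = ?B" by (simp add: i2_def f_def)
  moreover have "?A = (LINT x|sph_vol R. i1 x)"
    by (rule Bochner_Integration.integral_cong)
       (auto simp: i1_def D_def test_fun_sph_grad_inner[OF R _ t height_grad_tangent[OF R]])
  ultimately show ?thesis by simp
qed


section \<open>Smooth approximation of radial functions\<close>

text \<open>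
  The functions \<open>t\<close> to the power \<open>- m\<close> times \<open>exp (- 1 / t)\<close>, continued by \<open>0\<close>. All of them are flat at
  \<open>0\<close>, and their span is closed under differentiation, which yields smoothness without computing
  higher derivatives.
\<close>

definition flat_exp :: "nat \<Rightarrow> real \<Rightarrow> real" where
  "flat_exp m t = (if t \<le> 0 then 0 else (1 / t) ^ m * exp (- (1 / t)))"

lemma flat_exp_at_0: "(flat_exp m \<longlongrightarrow> 0) (at_right 0)"
proof -
  have "((\<lambda>z::real. z ^ m / exp z) \<longlongrightarrow> 0) at_top" by (rule tendsto_power_div_exp_0)
  then have "((\<lambda>t::real. inverse t ^ m / exp (inverse t)) \<longlongrightarrow> 0) (at_right 0)"
    by (rule filterlim_compose[OF _ filterlim_inverse_at_top_right])
  then show ?thesis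
    by (rule Lim_transform_eventually)
       (auto simp: eventually_at_filter flat_exp_def exp_minus field_simps)
qed

lemma flat_exp_deriv:
  "(flat_exp m has_real_derivative - real m * flat_exp (Suc m) t + flat_exp (m + 2) t) (at t)"
proof (cases t "0::real" rule: linorder_cases)
  case less
  have "(flat_exp m has_real_derivative 0) (at t)"
    by (rule has_field_derivative_transform_within_open[where S = "{..<0}" and f = "\<lambda>_. 0"])
       (use less in \<open>auto simp: flat_exp_def\<close>)
  then show ?thesis using less by (simp add: flat_exp_def)
next
  case greater
  have "((\<lambda>t. (1 / t) ^ m * exp (- (1 / t))) has_real_derivative
      - real m * ((1 / t) ^ (Suc m) * exp (- (1 / t))) + (1 / t) ^ (m + 2) * exp (- (1 / t))) (at t)"
  proof -
    have u: "((\<lambda>t. 1 / t) has_real_derivative - ((1 / t)\<^sup>2)) (at t)"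
      using greater by (auto intro!: derivative_eq_intros simp: power2_eq_square)
    show ?thesis
      by (rule DERIV_cong[OF DERIV_mult[OF DERIV_power[OF u, of m] DERIV_chain2[OF DERIV_exp DERIV_minus[OF u]]]])
        (cases m; simp add: power2_eq_square algebra_simps add_divide_distrib diff_divide_distrib)
  qed
  then have "(flat_exp m has_real_derivative
      - real m * ((1 / t) ^ (Suc m) * exp (- (1 / t))) + (1 / t) ^ (m + 2) * exp (- (1 / t))) (at t)"
    by (rule has_field_derivative_transform_within_open[where S = "{0<..}"])
       (use greater in \<open>auto simp: flat_exp_def\<close>)
  then show ?thesis using greater by (simp add: flat_exp_def)
next
  case equal
  have "((\<lambda>y. (flat_exp m y - flat_exp m 0) / (y - 0)) \<longlongrightarrow> 0) (at 0)"
  proof (rule filterlim_split_at)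
    show "((\<lambda>y. (flat_exp m y - flat_exp m 0) / (y - 0)) \<longlongrightarrow> 0) (at_left 0)"
      by (rule tendsto_eventually) (auto simp: eventually_at_filter flat_exp_def)
    show "((\<lambda>y. (flat_exp m y - flat_exp m 0) / (y - 0)) \<longlongrightarrow> 0) (at_right 0)"
      by (rule Lim_transform_eventually[OF flat_exp_at_0[of "Suc m"]])
         (auto simp: eventually_at_filter flat_exp_def)
  qed
  then show ?thesis using equal by (simp add: has_field_derivative_iff flat_exp_def)
qed

lemma flat_exp_bounds: "0 \<le> flat_exp 0 t" "flat_exp 0 t \<le> 1" "0 \<le> flat_exp 1 t" "flat_exp 0 t + flat_exp 1 t \<le> 1"
proof -
  show "0 \<le> flat_exp 0 t" "flat_exp 0 t \<le> 1" "0 \<le> flat_exp 1 t" by (auto simp: flat_exp_def)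
  show "flat_exp 0 t + flat_exp 1 t \<le> 1"
  proof (cases "t \<le> 0")
    case False
    have "(1 + 1 / t) * exp (- (1 / t)) \<le> exp (1 / t) * exp (- (1 / t))"
      by (intro mult_right_mono exp_ge_add_one_self) auto
    then show ?thesis using False by (simp add: flat_exp_def exp_minus field_simps)
  qed (simp add: flat_exp_def)
qed

lemma flat_exp_limit: "(flat_exp 0 \<longlongrightarrow> 1) at_top" "((\<lambda>t. flat_exp 0 t + flat_exp 1 t) \<longlongrightarrow> 1) at_top"
proof -
  have ev: "\<forall>\<^sub>F t in at_top. (t::real) > 0" by (rule eventually_gt_at_top)
  have "((\<lambda>t::real. exp (- (1 / t))) \<longlongrightarrow> 1) at_top" by real_asymp
  then show "(flat_exp 0 \<longlongrightarrow> 1) at_top"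
    by (rule Lim_transform_eventually) (rule eventually_mono[OF ev], simp add: flat_exp_def)
  have "((\<lambda>t::real. exp (- (1 / t)) + 1 / t * exp (- (1 / t))) \<longlongrightarrow> 1) at_top" by real_asymp
  then show "((\<lambda>t. flat_exp 0 t + flat_exp 1 t) \<longlongrightarrow> 1) at_top"
    by (rule Lim_transform_eventually) (rule eventually_mono[OF ev], simp add: flat_exp_def)
qed

text \<open>
  The module spanned by the flat functions of \<open>P\<close> over the polynomials; closed under differentiation
  when \<open>P\<close> is a polynomial.
\<close>

inductive flat_alg :: "(real \<Rightarrow> real) \<Rightarrow> (real \<Rightarrow> real) \<Rightarrow> bool" for P where
  flat_base: "real_polynomial_function Q \<Longrightarrow> flat_alg P (\<lambda>s. Q s * flat_exp m (P s))"
| flat_add: "flat_alg P f \<Longrightarrow> flat_alg P g \<Longrightarrow> flat_alg P (\<lambda>s. f s + g s)"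

lemma flat_alg_deriv:
  assumes P: "real_polynomial_function P" and g: "flat_alg P g"
  shows "\<exists>g'. flat_alg P g' \<and> (\<forall>s. (g has_real_derivative g' s) (at s))"
  using g
proof induction
  case (flat_base Q m)
  obtain P' where P': "real_polynomial_function P'" "\<And>x. (P has_real_derivative P' x) (at x)"
    using has_real_derivative_polynomial_function[OF P] by blast
  obtain Q' where Q': "real_polynomial_function Q'" "\<And>x. (Q has_real_derivative Q' x) (at x)"
    using has_real_derivative_polynomial_function[OF flat_base] by blast
  let ?g' = "\<lambda>s. Q' s * flat_exp m (P s) + ((- real m * (Q s * P' s)) * flat_exp (Suc m) (P s)
     + (Q s * P' s) * flat_exp (m + 2) (P s))"
  have "flat_alg P ?g'"
    by (intro flat_alg.intros real_polynomial_function.intros Q' P' flat_base)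
  moreover have "((\<lambda>s. Q s * flat_exp m (P s)) has_real_derivative ?g' s) (at s)" for s
    using DERIV_mult[OF Q'(2)[of s] DERIV_chain2[OF flat_exp_deriv P'(2)[of s]]]
    by (simp add: algebra_simps)
  ultimately show ?case by blast
next
  case (flat_add f g)
  then obtain f' g' where "flat_alg P f'" "flat_alg P g'" "\<And>s. (f has_real_derivative f' s) (at s)"
    "\<And>s. (g has_real_derivative g' s) (at s)" by blast
  then show ?case by (intro exI[of _ "\<lambda>s. f' s + g' s"]) (auto intro: flat_alg.intros DERIV_add)
qed

text \<open>
  A directional derivative of \<open>g\<close> composed with the height is a constant times \<open>g'\<close> composed with the
  height, so smoothness follows by induction; the factor \<open>c\<close> absorbs these constants.
\<close>

lemma Ck_profile:
  fixes p :: "'a::euclidean_space"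
  assumes P: "real_polynomial_function P" and g: "flat_alg P g"
  shows "Ck m (\<lambda>x. c * g (height R p x))"
  using g
proof (induction m arbitrary: g c)
  case 0
  obtain g' where "\<And>s. (g has_real_derivative g' s) (at s)" using flat_alg_deriv[OF P 0] by blast
  then have "continuous_on UNIV g" by (meson DERIV_isCont continuous_at_imp_continuous_on)
  then show ?case by (auto intro!: continuous_intros continuous_on_compose2[of UNIV g])
next
  case (Suc m)
  obtain g' where g': "flat_alg P g'" "\<And>s. (g has_real_derivative g' s) (at s)"
    using flat_alg_deriv[OF P Suc.prems] by blast
  have d: "((\<lambda>x. c * g (height R p x)) has_derivative (\<lambda>v. (c * (v \<bullet> p / R\<^sup>2)) * g' (height R p x))) (at x)" for x
  proof -
    have "(height R p has_derivative (\<lambda>h. h \<bullet> p / R\<^sup>2)) (at x)"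
      unfolding height_def[abs_def] divide_inverse by (auto intro!: derivative_eq_intros)
    from has_derivative_compose[OF this g'(2)[unfolded has_field_derivative_def]]
    have "((\<lambda>x. g (height R p x)) has_derivative (\<lambda>h. g' (height R p x) * (h \<bullet> p / R\<^sup>2))) (at x)" .
    from has_derivative_mult_right[OF this, of c] show ?thesis by (simp add: mult_ac)
  qed
  then have fd: "frechet_derivative (\<lambda>x. c * g (height R p x)) (at x) = (\<lambda>v. (c * (v \<bullet> p / R\<^sup>2)) * g' (height R p x))" for x
    by (rule frechet_derivative_at[symmetric])
  have "Ck m (\<lambda>x. frechet_derivative (\<lambda>x. c * g (height R p x)) (at x) v)" for v
    unfolding fd by (rule Suc.IH[OF g'(1)])
  then show ?case using d by (auto simp: differentiable_def)
qed

lemma polynomial_antiderivative: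
  assumes "real_polynomial_function q"
  shows "\<exists>P. real_polynomial_function P \<and> (\<forall>s. (P has_real_derivative q s) (at s)) \<and> P a = 0"
proof -
  obtain c n where q: "q = (\<lambda>x. \<Sum>i\<le>n. c i * x ^ i)"
    using assms real_polynomial_function_iff_sum by blast
  define A where "A = (\<lambda>x. \<Sum>i\<le>n. (c i / real (Suc i)) * x ^ Suc i)"
  have "real_polynomial_function A"
    unfolding A_def by (intro real_polynomial_function_sum real_polynomial_function.intros real_polynomial_function_power) auto
  then have "real_polynomial_function (\<lambda>x. A x + - A a)"
    by (intro real_polynomial_function.intros(2-3))
  moreover have "((\<lambda>x. A x + - A a) has_real_derivative q s) (at s)" for s
  proof -
    have "((\<lambda>x. (c i / real (Suc i)) * x ^ Suc i) has_real_derivative c i * s ^ i) (at s)" for i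
      by (rule DERIV_cong[OF DERIV_cmult[OF DERIV_pow]]) (simp del: of_nat_Suc)
    then have "(A has_real_derivative q s) (at s)" unfolding A_def q by (rule DERIV_sum)
    then show ?thesis by (auto intro!: derivative_eq_intros)
  qed
  ultimately show ?thesis by (intro exI[of _ "\<lambda>x. A x + - A a"]) auto
qed

text \<open>
  Polynomials \<open>P\<^sub>j\<close> are chosen within \<open>\<delta>\<^sub>j\<close> of \<open>F\<close>, with derivatives close to \<open>w\<close>, and composed with
  \<open>\<theta> t = (t - 2 \<delta>) exp (- \<delta>\<^sup>2 / (t - 2 \<delta>))\<close>, continued by \<open>0\<close> for \<open>t \<le> 2 \<delta>\<close>. The result vanishes where
  \<open>F \<le> \<delta>\<close>, and since \<open>0 \<le> \<theta>' \<le> 1\<close> with \<open>\<theta>' \<longlonglongrightarrow> 1\<close> for fixed \<open>t > 0\<close>, functions and derivatives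
  converge boundedly on \<open>F > 0\<close>.
\<close>

lemma truncated_polynomial_approx:
  fixes F w :: "real \<Rightarrow> real"
  assumes F: "\<And>s. s \<in> {-1..1} \<Longrightarrow> (F has_real_derivative w s) (at s)" and wc: "continuous_on {-1..1} w"
    and a: "a \<in> {-1..1}" "F a = 0"
  obtains g g' :: "nat \<Rightarrow> real \<Rightarrow> real" and \<delta> :: "nat \<Rightarrow> real" and M :: real
  where "\<And>j. \<exists>P. real_polynomial_function P \<and> flat_alg P (g j)"
    and "\<And>j s. (g j has_real_derivative g' j s) (at s)"
    and "\<And>j. \<delta> j > 0" and "\<And>j s. s \<in> {-1..1} \<Longrightarrow> F s \<le> \<delta> j \<Longrightarrow> g j s = 0"
    and "\<And>j s. s \<in> {-1..1} \<Longrightarrow> \<bar>g j s\<bar> \<le> M" and "\<And>j s. s \<in> {-1..1} \<Longrightarrow> \<bar>g' j s\<bar> \<le> M"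
    and "\<And>s. s \<in> {-1..1} \<Longrightarrow> F s > 0 \<Longrightarrow> (\<lambda>j. g j s) \<longlonglongrightarrow> F s"
    and "\<And>s. s \<in> {-1..1} \<Longrightarrow> F s > 0 \<Longrightarrow> (\<lambda>j. g' j s) \<longlonglongrightarrow> w s"
proof -
  define \<delta> where "\<delta> = (\<lambda>j::nat. 1 / (2 * real (Suc j)))"
  have d: "\<delta> j > 0" "\<delta> j \<le> 1" for j by (auto simp: \<delta>_def)
  have dlim: "\<delta> \<longlonglongrightarrow> 0" unfolding \<delta>_def by real_asymp
  have "\<exists>q. real_polynomial_function q \<and> (\<forall>s\<in>{-1..1}. \<bar>w s - q s\<bar> < \<delta> j / 2)" for j
  proof -
    have "\<delta> j / 2 > 0" using d(1)[of j] by simp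
    then obtain q where "real_polynomial_function q" "\<And>s. s \<in> {-1..1} \<Longrightarrow> \<bar>w s - q s\<bar> < \<delta> j / 2"
      by (rule Stone_Weierstrass_real_polynomial_function[OF compact_Icc wc]) blast
    then show ?thesis by blast
  qed
  then obtain q where q: "\<And>j. real_polynomial_function (q j)" "\<And>j s. s \<in> {-1..1} \<Longrightarrow> \<bar>w s - q j s\<bar> < \<delta> j / 2"
    by metis
  have "\<exists>P. real_polynomial_function P \<and> (\<forall>s. (P has_real_derivative q j s) (at s)) \<and> P a = 0" for j
    by (rule polynomial_antiderivative[OF q(1)])
  then obtain P where P: "\<And>j. real_polynomial_function (P j)"
    "\<And>j s. (P j has_real_derivative q j s) (at s)" "\<And>j. P j a = 0" by metis
  have PF: "\<bar>F s - P j s\<bar> \<le> \<delta> j" if s: "s \<in> {-1..1}" for j s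
  proof -
    have "norm ((F s - P j s) - (F a - P j a)) \<le> \<delta> j / 2 * norm (s - a)"
    proof (rule field_differentiable_bound[of "{-1..1}"])
      fix z :: real assume z: "z \<in> {-1..1}"
      show "((\<lambda>s. F s - P j s) has_field_derivative (w z - q j z)) (at z within {-1..1})"
        using DERIV_diff[OF F[OF z] P(2)] by (rule has_field_derivative_at_within)
      show "norm (w z - q j z) \<le> \<delta> j / 2" using q(2)[OF z, of j] by simp
    qed (use s a in auto)
    also have "\<dots> \<le> \<delta> j / 2 * 2" using s a d(1)[of j] by (intro mult_left_mono) auto
    finally show ?thesis using a P(3) by simp
  qed
  define X where "X = (\<lambda>j s. (P j s - 2 * \<delta> j) / (\<delta> j)\<^sup>2)"
  define X' where "X' = (\<lambda>j s. q j s / (\<delta> j)\<^sup>2)"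
  have Xd: "(X j has_real_derivative X' j s) (at s)" for j s
    using DERIV_cdivide[OF DERIV_diff[OF P(2) DERIV_const]] by (simp add: X_def X'_def)
  have Xp: "real_polynomial_function (X j)" for j
  proof -
    have "X j = (\<lambda>s. (P j s + - (2 * \<delta> j)) * (1 / (\<delta> j)\<^sup>2))" by (simp add: X_def fun_eq_iff)
    then show ?thesis
      by (simp only:) (intro real_polynomial_function.intros(2-4) P)
  qed
  define g where "g = (\<lambda>j s. ((\<delta> j)\<^sup>2 * X j s) * flat_exp 0 (X j s))"
  define g' where "g' = (\<lambda>j s. q j s * (flat_exp 0 (X j s) + flat_exp 1 (X j s)))"
  have g1: "flat_alg (X j) (g j)" for j
    unfolding g_def by (intro flat_alg.intros real_polynomial_function.intros Xp)
  have g2: "(g j has_real_derivative g' j s) (at s)" for j s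
  proof -
    have t: "t * flat_exp 2 t = flat_exp 1 t" for t by (simp add: flat_exp_def power2_eq_square)
    have "(g j has_real_derivative ((\<delta> j)\<^sup>2 * X' j s) * flat_exp 0 (X j s)
        + (flat_exp 2 (X j s) * X' j s) * ((\<delta> j)\<^sup>2 * X j s)) (at s)"
      unfolding g_def using DERIV_mult[OF DERIV_cmult[OF Xd] DERIV_chain2[OF flat_exp_deriv[of 0] Xd]] by (simp add: numeral_2_eq_2)
    moreover have "((\<delta> j)\<^sup>2 * X' j s) * flat_exp 0 (X j s) + (flat_exp 2 (X j s) * X' j s) * ((\<delta> j)\<^sup>2 * X j s)
       = ((\<delta> j)\<^sup>2 * X' j s) * (flat_exp 0 (X j s) + X j s * flat_exp 2 (X j s))" by (simp add: algebra_simps)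
    moreover have "(\<delta> j)\<^sup>2 * X' j s = q j s" using d(1)[of j] by (simp add: X'_def)
    ultimately show ?thesis unfolding g'_def t by simp
  qed
  have dX: "(\<delta> j)\<^sup>2 * X j s = P j s - 2 * \<delta> j" for j s using d(1)[of j] by (simp add: X_def)
  have g3: "g j s = 0" if "s \<in> {-1..1}" "F s \<le> \<delta> j" for j s
  proof -
    have "P j s - 2 * \<delta> j \<le> 0" using PF[OF that(1), of j] that(2) by linarith
    then have "X j s \<le> 0" by (simp add: X_def divide_nonpos_nonneg)
    then show ?thesis by (simp add: g_def flat_exp_def)
  qed
  have Fc: "continuous_on {-1..1} F" using F by (meson DERIV_isCont continuous_at_imp_continuous_on)
  have "bounded (F ` {-1..1})" "bounded (w ` {-1..1})"
    by (intro compact_imp_bounded compact_continuous_image Fc wc compact_Icc)+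
  then obtain B1 B2 where "\<forall>s\<in>{-1..1}. \<bar>F s\<bar> \<le> B1" "\<forall>s\<in>{-1..1}. \<bar>w s\<bar> \<le> B2"
    unfolding bounded_iff by auto
  then have B: "\<bar>F s\<bar> \<le> B1" "\<bar>w s\<bar> \<le> B2" if "s \<in> {-1..1}" for s using that by auto
  define M where "M = max (B1 + 1) (B2 + 1)"
  have g4: "\<bar>g j s\<bar> \<le> M" "\<bar>g' j s\<bar> \<le> M" if s: "s \<in> {-1..1}" for j s
  proof -
    have Mn: "M \<ge> 0" using B[OF s] by (simp add: M_def)
    show "\<bar>g j s\<bar> \<le> M"
    proof (cases "X j s \<le> 0")
      case True
      then show ?thesis using Mn by (simp add: g_def flat_exp_def)
    next
      case False
      then have "0 \<le> (\<delta> j)\<^sup>2 * X j s" by simp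
      then have "\<bar>(\<delta> j)\<^sup>2 * X j s\<bar> \<le> M" unfolding dX using PF[OF s, of j] B(1)[OF s] d[of j] by (simp add: M_def)
      then have "\<bar>(\<delta> j)\<^sup>2 * X j s\<bar> * \<bar>flat_exp 0 (X j s)\<bar> \<le> M * 1"
        using flat_exp_bounds Mn by (intro mult_mono) auto
      then show ?thesis by (simp add: g_def abs_mult)
    qed
    have "\<bar>q j s\<bar> \<le> B2 + 1" using q(2)[OF s, of j] B(2)[OF s] d[of j] by linarith
    then have "\<bar>q j s\<bar> \<le> M" by (simp add: M_def)
    moreover have "0 \<le> flat_exp 0 (X j s) + flat_exp 1 (X j s)" using flat_exp_bounds by simp
    ultimately have "\<bar>q j s\<bar> * \<bar>flat_exp 0 (X j s) + flat_exp 1 (X j s)\<bar> \<le> M * 1"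
      using flat_exp_bounds(4) Mn by (intro mult_mono) auto
    then show "\<bar>g' j s\<bar> \<le> M" by (simp add: g'_def abs_mult)
  qed
  have g5: "(\<lambda>j. g j s) \<longlonglongrightarrow> F s" "(\<lambda>j. g' j s) \<longlonglongrightarrow> w s" if s: "s \<in> {-1..1}" "F s > 0" for s
  proof -
    have "(\<lambda>j. P j s - F s) \<longlonglongrightarrow> 0"
      by (rule Lim_null_comparison[OF _ dlim]) (use PF[OF s(1)] in \<open>auto intro!: always_eventually simp: abs_minus_commute\<close>)
    then have "(\<lambda>j. (P j s - F s) + F s) \<longlonglongrightarrow> 0 + F s" by (intro tendsto_add tendsto_const)
    then have Pl: "(\<lambda>j. P j s) \<longlonglongrightarrow> F s" by simp
    have "\<bar>q j s - w s\<bar> \<le> \<delta> j" for j using q(2)[OF s(1), of j] d(1)[of j] by linarith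
    then have "(\<lambda>j. q j s - w s) \<longlonglongrightarrow> 0"
      by (intro Lim_null_comparison[OF _ dlim]) (auto intro!: always_eventually)
    then have "(\<lambda>j. (q j s - w s) + w s) \<longlonglongrightarrow> 0 + w s" by (intro tendsto_add tendsto_const)
    then have ql: "(\<lambda>j. q j s) \<longlonglongrightarrow> w s" by simp
    have "(\<lambda>j. P j s - 2 * \<delta> j) \<longlonglongrightarrow> F s - 2 * 0" by (intro tendsto_intros Pl dlim)
    then have Pd: "(\<lambda>j. P j s - 2 * \<delta> j) \<longlonglongrightarrow> F s" by simp
    have "filterlim (\<lambda>j. 1 / (\<delta> j)\<^sup>2) at_top sequentially" unfolding \<delta>_def by real_asymp
    then have "filterlim (\<lambda>j. (P j s - 2 * \<delta> j) * (1 / (\<delta> j)\<^sup>2)) at_top sequentially"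
      by (rule filterlim_tendsto_pos_mult_at_top[OF Pd s(2)])
    then have Xt: "filterlim (\<lambda>j. X j s) at_top sequentially" by (simp add: X_def)
    have "(\<lambda>j. (P j s - 2 * \<delta> j) * flat_exp 0 (X j s)) \<longlonglongrightarrow> F s * 1"
      by (intro tendsto_mult Pd filterlim_compose[OF flat_exp_limit(1) Xt])
    then show "(\<lambda>j. g j s) \<longlonglongrightarrow> F s" by (simp add: g_def dX)
    have "(\<lambda>j. g' j s) \<longlonglongrightarrow> w s * 1" unfolding g'_def
      by (intro tendsto_mult ql filterlim_compose[OF flat_exp_limit(2) Xt])
    then show "(\<lambda>j. g' j s) \<longlonglongrightarrow> w s" by simp
  qed
  show ?thesis
  proof (rule that[of g g' \<delta> M])
    show "\<exists>P. real_polynomial_function P \<and> flat_alg P (g j)" for j using g1 Xp by blast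
  qed (use g2 g3 g4 g5 d in auto)
qed


section \<open>Radial functions as solutions\<close>

text \<open>
  The approximating functions vanish where \<open>F \<le> \<delta>\<close>, hence outside a compact part of the cap, and
  bounded pointwise convergence gives convergence of the integrals.
\<close>

lemma H10_profile:
  fixes p :: "'a::euclidean_space"
  assumes R: "R > 0" and p: "p \<in> sphere 0 R"
    and F: "\<And>s. s \<in> {-1..1} \<Longrightarrow> (F has_real_derivative w s) (at s)" and wc: "continuous_on {-1..1} w"
    and a: "a \<in> {-1..1}" "F a = 0" and Fp: "\<And>s. s \<in> {-1..1} \<Longrightarrow> F s > 0 \<longleftrightarrow> a < s"
  shows "H10_with_grad R {x \<in> sphere 0 R. a < height R p x} (\<lambda>x. F (height R p x)) (\<lambda>x. w (height R p x) *\<^sub>R height_grad R p x)"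
proof -
  define \<Omega> where "\<Omega> = {x \<in> sphere 0 R. a < height R p x}"
  have Fc: "continuous_on {-1..1} F" using F by (meson DERIV_isCont continuous_at_imp_continuous_on)
  have hs: "height R p x \<in> {-1..1}" if "x \<in> sphere 0 R" for x using height_bounds[OF R p that] by simp
  have comp: "continuous_on (sphere 0 R) (\<lambda>x. G (height R p x))" if "continuous_on {-1..1} G" for G :: "real \<Rightarrow> real"
    by (rule continuous_on_compose2[OF that]) (use hs in \<open>auto intro!: continuous_intros\<close>)
  have meas: "(\<lambda>x. G (height R p x)) \<in> borel_measurable (sph_vol R)" if "continuous_on {-1..1} G" for G :: "real \<Rightarrow> real"
    by (rule continuous_measurable_sph_vol[OF comp[OF that]])
  have hgm: "height_grad R p \<in> borel_measurable (sph_vol R)"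
    by (rule continuous_measurable_sph_vol) (rule continuous_intros)
  have \<Omega>s: "\<Omega> \<in> sets (sph_vol R)" unfolding \<Omega>_def by (rule openin_sets_sph_vol[OF open_cap])
  interpret fm: finite_measure "sph_vol R :: 'a measure" by (rule finite_measure_sph_vol[OF R])
  obtain g g' \<delta> M where g: "\<And>j. \<exists>P. real_polynomial_function P \<and> flat_alg P (g j)"
    and gd: "\<And>j s. (g j has_real_derivative g' j s) (at s)" and d: "\<And>j. \<delta> j > (0::real)"
    and gz: "\<And>j s. s \<in> {-1..1} \<Longrightarrow> F s \<le> \<delta> j \<Longrightarrow> g j s = 0"
    and gM: "\<And>j s. s \<in> {-1..1} \<Longrightarrow> \<bar>g j s\<bar> \<le> M" "\<And>j s. s \<in> {-1..1} \<Longrightarrow> \<bar>g' j s\<bar> \<le> M"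
    and gl: "\<And>s. s \<in> {-1..1} \<Longrightarrow> F s > 0 \<Longrightarrow> (\<lambda>j. g j s) \<longlonglongrightarrow> F s" "\<And>s. s \<in> {-1..1} \<Longrightarrow> F s > 0 \<Longrightarrow> (\<lambda>j. g' j s) \<longlonglongrightarrow> w s"
    by (rule truncated_polynomial_approx[of F w a]) (erule F | rule wc a | rule that | assumption)+
  define \<phi> where "\<phi> = (\<lambda>j (x::'a). g j (height R p x))"
  have tf: "test_fun R \<Omega> (\<phi> j)" for j
    unfolding test_fun_def
  proof (intro conjI allI)
    fix m
    obtain P where "real_polynomial_function P" "flat_alg P (g j)" using g by blast
    from Ck_profile[OF this, of m 1 R p] show "Ck m (\<phi> j)" by (simp add: \<phi>_def)
    define K where "K = {x \<in> sphere 0 R. \<delta> j \<le> F (height R p x)}"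
    have "closed (sphere 0 R \<inter> (\<lambda>x. F (height R p x)) -` {\<delta> j..})"
      by (intro continuous_closed_preimage comp Fc) auto
    moreover have "K = sphere 0 R \<inter> (\<lambda>x. F (height R p x)) -` {\<delta> j..}" by (auto simp: K_def)
    moreover have "bounded K" by (rule bounded_subset[OF bounded_sphere[of 0 R]]) (auto simp: K_def)
    ultimately have "compact K" by (simp add: compact_eq_bounded_closed)
    moreover have "K \<subseteq> \<Omega>"
    proof
      fix x assume x: "x \<in> K"
      then have "F (height R p x) > 0" using d[of j] by (simp add: K_def)
      then show "x \<in> \<Omega>" using Fp hs x by (simp add: K_def \<Omega>_def)
    qed
    moreover have "\<forall>x\<in>sphere 0 R - K. \<phi> j x = 0"
    proof
      fix x assume "x \<in> sphere 0 R - K"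
      then have "x \<in> sphere 0 R" "F (height R p x) \<le> \<delta> j" by (auto simp: K_def)
      then show "\<phi> j x = 0" unfolding \<phi>_def using gz hs by blast
    qed
    ultimately show "\<exists>K. compact K \<and> K \<subseteq> \<Omega> \<and> (\<forall>x\<in>sphere 0 R - K. \<phi> j x = 0)" by blast
  qed
  have lim0: "(\<lambda>j. \<integral>\<^sup>+x\<in>\<Omega>. ennreal (H j (height R p x)) \<partial>sph_vol R) \<longlonglongrightarrow> 0"
    if H: "\<And>j. continuous_on {-1..1} (H j)" "\<And>j s. s \<in> {-1..1} \<Longrightarrow> H j s \<le> B"
      "\<And>s. s \<in> {-1..1} \<Longrightarrow> F s > 0 \<Longrightarrow> (\<lambda>j. H j s) \<longlonglongrightarrow> 0" for H :: "nat \<Rightarrow> real \<Rightarrow> real" and B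
  proof -
    have "(\<lambda>j. \<integral>\<^sup>+x. ennreal (H j (height R p x)) * indicator \<Omega> x \<partial>sph_vol R) \<longlonglongrightarrow> (\<integral>\<^sup>+(x::'a). 0 \<partial>sph_vol R)"
    proof (rule nn_integral_dominated_convergence[where w = "\<lambda>_::'a. ennreal B"])
      show "(\<lambda>x. ennreal (H j (height R p x)) * indicator \<Omega> x) \<in> borel_measurable (sph_vol R)" for j
        using meas[OF H(1)] \<Omega>s by measurable
      show "AE x in sph_vol R. ennreal (H j (height R p x)) * indicator \<Omega> x \<le> ennreal B" for j
        using H(2) hs by (intro AE_I2) (auto simp: indicator_def intro: ennreal_leI)
      show "(\<integral>\<^sup>+x. ennreal B \<partial>(sph_vol R :: 'a measure)) < \<infinity>"
        using fm.emeasure_finite[of "space (sph_vol R)"]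
        by (simp add: ennreal_mult_eq_top_iff less_top[symmetric] del: space_sph_vol)
      show "AE x in sph_vol R. (\<lambda>j. ennreal (H j (height R p x)) * indicator \<Omega> x) \<longlonglongrightarrow> 0"
      proof (intro AE_I2)
        fix x :: 'a assume "x \<in> space (sph_vol R)"
        then have x: "x \<in> sphere 0 R" by simp
        show "(\<lambda>j. ennreal (H j (height R p x)) * indicator \<Omega> x) \<longlonglongrightarrow> 0"
        proof (cases "x \<in> \<Omega>")
          case True
          then have "F (height R p x) > 0" using Fp hs by (simp add: \<Omega>_def)
          from tendsto_ennrealI[OF H(3)[OF hs[OF x] this]] True show ?thesis by simp
        qed simp
      qed
    qed auto
    then show ?thesis by simp
  qed
  have gc: "continuous_on S (g j)" for S j
    using gd by (meson DERIV_isCont continuous_at_imp_continuous_on)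
  have g'c: "continuous_on {-1..1} (g' j)" for j
  proof -
    obtain P where P: "real_polynomial_function P" "flat_alg P (g j)" using g by blast
    then obtain h where h: "flat_alg P h" "\<And>s. (g j has_real_derivative h s) (at s)" using flat_alg_deriv by blast
    then have "g' j = h" using gd DERIV_unique by blast
    moreover obtain h' where "\<And>s. (h has_real_derivative h' s) (at s)" using flat_alg_deriv[OF P(1) h(1)] by blast
    ultimately show ?thesis by (metis DERIV_isCont continuous_at_imp_continuous_on)
  qed
  have bd: "\<exists>B. \<forall>s\<in>{-1..1}. \<bar>G s\<bar> \<le> B" if "continuous_on {-1..1} G" for G :: "real \<Rightarrow> real"
  proof -
    have "bounded (G ` {-1..1})" by (intro compact_imp_bounded compact_continuous_image that compact_Icc)
    then show ?thesis unfolding bounded_iff by auto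
  qed
  obtain B1 where B1: "\<And>s. s \<in> {-1..1} \<Longrightarrow> \<bar>F s\<bar> \<le> B1" using bd[OF Fc] by blast
  obtain B2 where B2: "\<And>s. s \<in> {-1..1} \<Longrightarrow> \<bar>w s\<bar> \<le> B2" using bd[OF wc] by blast
  have sq: "(y - z)\<^sup>2 \<le> (M + B)\<^sup>2" if "\<bar>y\<bar> \<le> M" "\<bar>z\<bar> \<le> B" for y z B :: real
  proof -
    have "\<bar>y - z\<bar>\<^sup>2 \<le> (M + B)\<^sup>2" using that by (intro power_mono) auto
    then show ?thesis by simp
  qed
  have L1: "(\<lambda>j. \<integral>\<^sup>+x\<in>\<Omega>. ennreal ((\<phi> j x - F (height R p x))\<^sup>2) \<partial>sph_vol R) \<longlonglongrightarrow> 0"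
    unfolding \<phi>_def
  proof (rule lim0)
    show "continuous_on {-1..1} (\<lambda>s. (g j s - F s)\<^sup>2)" for j by (intro continuous_intros gc Fc)
    show "(g j s - F s)\<^sup>2 \<le> (M + B1)\<^sup>2" if "s \<in> {-1..1}" for j s using sq gM B1 that by blast
    show "(\<lambda>j. (g j s - F s)\<^sup>2) \<longlonglongrightarrow> 0" if "s \<in> {-1..1}" "F s > 0" for s
    proof -
      have "(\<lambda>j. (g j s - F s)\<^sup>2) \<longlonglongrightarrow> (F s - F s)\<^sup>2" by (intro tendsto_intros gl that)
      then show ?thesis by simp
    qed
  qed
  have hn: "(norm (height_grad R p x))\<^sup>2 = (1 - (height R p x)\<^sup>2) / R\<^sup>2" if "x \<in> sphere 0 R" for x
  proof -
    have "(height R p x)\<^sup>2 \<le> 1" using hs[OF that] by (simp add: abs_square_le_1 abs_le_iff)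
    then show ?thesis by (simp add: norm_height_grad(2)[OF R p that] power_divide)
  qed
  have L2: "(\<lambda>j. \<integral>\<^sup>+x\<in>\<Omega>. ennreal ((norm (sph_grad R (\<phi> j) x - w (height R p x) *\<^sub>R height_grad R p x))\<^sup>2) \<partial>sph_vol R) \<longlonglongrightarrow> 0"
  proof -
    have "(norm (sph_grad R (\<phi> j) x - w (height R p x) *\<^sub>R height_grad R p x))\<^sup>2
        = (g' j (height R p x) - w (height R p x))\<^sup>2 * ((1 - (height R p x)\<^sup>2) / R\<^sup>2)" if x: "x \<in> sphere 0 R" for j x
    proof -
      have "sph_grad R (\<phi> j) x = g' j (height R p x) *\<^sub>R height_grad R p x"
        unfolding \<phi>_def by (intro sph_grad_eqI[OF R x] has_sph_grad_height[OF R x] gd)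
      then show ?thesis
        using hn[OF x] by (simp add: scaleR_diff_left[symmetric] power_mult_distrib)
    qed
    then have "(\<integral>\<^sup>+x\<in>\<Omega>. ennreal ((norm (sph_grad R (\<phi> j) x - w (height R p x) *\<^sub>R height_grad R p x))\<^sup>2) \<partial>sph_vol R)
      = (\<integral>\<^sup>+x\<in>\<Omega>. ennreal ((g' j (height R p x) - w (height R p x))\<^sup>2 * ((1 - (height R p x)\<^sup>2) / R\<^sup>2)) \<partial>sph_vol R)" for j
      by (intro nn_integral_cong) simp
    moreover have "(\<lambda>j. \<integral>\<^sup>+x\<in>\<Omega>. ennreal ((g' j (height R p x) - w (height R p x))\<^sup>2 * ((1 - (height R p x)\<^sup>2) / R\<^sup>2)) \<partial>sph_vol R) \<longlonglongrightarrow> 0"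
    proof (rule lim0)
      show "continuous_on {-1..1} (\<lambda>s. (g' j s - w s)\<^sup>2 * ((1 - s\<^sup>2) / R\<^sup>2))" for j
        using R by (intro continuous_intros g'c wc) auto
      show "(g' j s - w s)\<^sup>2 * ((1 - s\<^sup>2) / R\<^sup>2) \<le> (M + B2)\<^sup>2 * (1 / R\<^sup>2)" if "s \<in> {-1..1}" for j s
      proof (intro mult_mono divide_right_mono)
        show "(g' j s - w s)\<^sup>2 \<le> (M + B2)\<^sup>2" using sq gM B2 that by blast
        show "0 \<le> (1 - s\<^sup>2) / R\<^sup>2" using that by (simp add: abs_square_le_1 abs_le_iff)
      qed auto
      show "(\<lambda>j. (g' j s - w s)\<^sup>2 * ((1 - s\<^sup>2) / R\<^sup>2)) \<longlonglongrightarrow> 0" if "s \<in> {-1..1}" "F s > 0" for s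
      proof -
        have "(\<lambda>j. (g' j s - w s)\<^sup>2 * ((1 - s\<^sup>2) / R\<^sup>2)) \<longlonglongrightarrow> (w s - w s)\<^sup>2 * ((1 - s\<^sup>2) / R\<^sup>2)"
          by (intro tendsto_mult tendsto_power tendsto_diff gl that tendsto_const)
        then show ?thesis by simp
      qed
    qed
    ultimately show ?thesis by simp
  qed
  have m1: "set_borel_measurable (sph_vol R) \<Omega> (\<lambda>x. F (height R p x))"
    "set_borel_measurable (sph_vol R) \<Omega> (\<lambda>x. w (height R p x) *\<^sub>R height_grad R p x)"
    unfolding set_borel_measurable_def
    by (intro borel_measurable_scaleR borel_measurable_indicator \<Omega>s meas Fc wc hgm)+
  show ?thesis
    unfolding H10_with_grad_def \<Omega>_def[symmetric] using m1 tf L1 L2 by blast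
qed

text \<open>
  A test function and its gradient vanish off \<open>\<Omega>\<close>, so the equation reduces to integration by parts
  over the whole sphere; this is why \<open>w\<close> is taken differentiable on the whole line.
\<close>

lemma profile_weak_poisson:
  fixes p :: "'a::euclidean_space"
  assumes R: "R > 0" and p: "p \<in> sphere 0 R"
    and w: "\<And>s. (w has_real_derivative w' s) (at s)" and wc: "continuous_on UNIV w'"
    and f: "\<And>x. x \<in> \<Omega> \<Longrightarrow> f x = ((real DIM('a) - 1) * height R p x * w (height R p x) - (1 - (height R p x)\<^sup>2) * w' (height R p x)) / R\<^sup>2"
    and \<Omega>: "\<Omega> \<subseteq> sphere 0 R"
  shows "weak_poisson R \<Omega> (\<lambda>x. w (height R p x) *\<^sub>R height_grad R p x) f"
  unfolding weak_poisson_def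
proof (intro allI impI)
  fix \<phi> :: "'a \<Rightarrow> real"
  assume t: "test_fun R \<Omega> \<phi>"
  then obtain K where K: "compact K" "K \<subseteq> \<Omega>" "\<And>x. x \<in> sphere 0 R - K \<Longrightarrow> \<phi> x = 0"
    unfolding test_fun_def by blast
  have out: "\<phi> x = 0" "sph_grad R \<phi> x = 0" if "x \<in> sphere 0 R" "x \<notin> \<Omega>" for x
    using that K sph_grad_zero_outside[OF R that(1) compact_imp_closed[OF K(1)], of \<phi>] by auto
  have "(LINT x:\<Omega>|sph_vol R. (w (height R p x) *\<^sub>R height_grad R p x) \<bullet> sph_grad R \<phi> x)
      = (LINT x|sph_vol R. (w (height R p x) *\<^sub>R height_grad R p x) \<bullet> sph_grad R \<phi> x)"
    unfolding set_lebesgue_integral_def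
    by (rule Bochner_Integration.integral_cong) (use out in \<open>auto simp: indicator_def\<close>)
  also have "\<dots> = (LINT x|sph_vol R. (((real DIM('a) - 1) * height R p x * w (height R p x) - (1 - (height R p x)\<^sup>2) * w' (height R p x)) / R\<^sup>2) * \<phi> x)"
    by (rule sphere_integration_by_parts[OF R p t w wc])
  also have "\<dots> = (LINT x:\<Omega>|sph_vol R. f x * \<phi> x)"
    unfolding set_lebesgue_integral_def
    by (rule Bochner_Integration.integral_cong) (use out f in \<open>auto simp: indicator_def\<close>)
  finally show "(LINT x:\<Omega>|sph_vol R. (w (height R p x) *\<^sub>R height_grad R p x) \<bullet> sph_grad R \<phi> x) = (LINT x:\<Omega>|sph_vol R. f x * \<phi> x)" .
qed

lemma profile_overdetermined:
  fixes p :: "'a::euclidean_space"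
  assumes R: "R > 0" and p: "p \<in> sphere 0 R"
    and F: "\<And>s. s \<in> {-1..1} \<Longrightarrow> (F has_real_derivative w s) (at s)" and wc: "continuous_on UNIV w"
    and a: "F a = 0" "w a \<ge> 0"
  shows "overdetermined_bc R {x \<in> sphere 0 R. a < height R p x} (\<lambda>x. F (height R p x)) (w a * (sqrt (1 - a\<^sup>2) / R))"
  unfolding overdetermined_bc_def
proof (rule exI[of _ UNIV], rule exI[of _ "\<lambda>x. w (height R p x) *\<^sub>R height_grad R p x"], intro conjI ballI)
  have hs: "height R p x \<in> {-1..1}" if "x \<in> sphere 0 R" for x using height_bounds[OF R p that] by simp
  have Fc: "continuous_on {-1..1} F" using F by (meson DERIV_isCont continuous_at_imp_continuous_on)
  have "closure {x \<in> sphere 0 R. a < height R p x} \<subseteq> sphere 0 R"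
    by (rule closure_minimal) auto
  then show "continuous_on (closure {x \<in> sphere 0 R. a < height R p x} \<inter> UNIV) (\<lambda>x. F (height R p x))"
    by (intro continuous_on_compose2[OF Fc]) (use hs in \<open>auto intro!: continuous_intros\<close>)
  show "continuous_on (closure {x \<in> sphere 0 R. a < height R p x} \<inter> UNIV) (\<lambda>x. w (height R p x) *\<^sub>R height_grad R p x)"
    by (intro continuous_intros continuous_on_compose2[OF wc]) auto
  show "has_sph_grad R (\<lambda>x. F (height R p x)) (w (height R p x) *\<^sub>R height_grad R p x) x"
    if "x \<in> {x \<in> sphere 0 R. a < height R p x} \<inter> UNIV" for x
    using that by (intro has_sph_grad_height[OF R] F hs) auto
  fix x assume "x \<in> sph_top R frontier_of {x \<in> sphere 0 R. a < height R p x}"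
  then have x: "x \<in> sphere 0 R" "height R p x = a" using open_cap_frontier by blast+
  then show "F (height R p x) = 0" using a by simp
  show "norm (w (height R p x) *\<^sub>R height_grad R p x) = w a * (sqrt (1 - a\<^sup>2) / R)"
    using norm_height_grad(2)[OF R p x(1)] x a by simp
qed auto


section \<open>The explicit profile and the counterexample\<close>

text \<open>
  The derivative of a radial harmonic function with respect to the height: its flux through every
  parallel is the same.
\<close>

definition flux_free :: "nat \<Rightarrow> real \<Rightarrow> real" where
  "flux_free n s = (1 - s\<^sup>2) powr (- real n / 2)"

definition flux_free' :: "nat \<Rightarrow> real \<Rightarrow> real" where
  "flux_free' n s = real n * s * (1 - s\<^sup>2) powr (- real n / 2 - 1)"

definition clamp :: "real \<Rightarrow> real \<Rightarrow> real \<Rightarrow> real" where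
  "clamp a c s = max a (min c s)"

text \<open>
  Between \<open>a\<close> and \<open>c\<close> this is \<open>flux_free\<close>, outside it is continued by tangent lines. The continuation
  past \<open>c\<close> produces the source; the one below \<open>a\<close> lies outside the domain and only serves to avoid the
  singularity at \<open>-1\<close>.
\<close>

definition slope :: "nat \<Rightarrow> real \<Rightarrow> real \<Rightarrow> real \<Rightarrow> real" where
  "slope n a c s = flux_free n (clamp a c s) + flux_free' n (clamp a c s) * (s - clamp a c s)"

text \<open>
  The source (times \<open>R\<^sup>2\<close>) produced by the tangent line at \<open>c\<close>, for heights above \<open>c\<close>. Replacing \<open>s\<close> by
  \<open>max c s\<close> continues it by its value at \<open>c\<close>, which is \<open>0\<close> because \<open>flux_free\<close> has matching value and
  slope there.
\<close>

definition source :: "nat \<Rightarrow> real \<Rightarrow> real \<Rightarrow> real" where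
  "source n c s = (let m = max c s in
     real n * m * (flux_free n c + flux_free' n c * (m - c)) - (1 - m\<^sup>2) * flux_free' n c)"

lemma flux_free_deriv:
  assumes "\<bar>s\<bar> < 1"
  shows "(flux_free n has_real_derivative flux_free' n s) (at s)"
proof -
  have "1 - s\<^sup>2 > 0" using assms by (simp add: abs_square_less_1)
  then have "((\<lambda>s. (1 - s\<^sup>2) powr (- real n / 2)) has_real_derivative
      (- real n / 2) * (1 - s\<^sup>2) powr (- real n / 2 - 1) * (- 2 * s)) (at s)"
    by (intro DERIV_chain2[OF has_real_derivative_powr]) (auto intro!: derivative_eq_intros)
  then show ?thesis unfolding flux_free_def[abs_def] flux_free'_def by (simp add: mult_ac)
qed

lemma flux_free_ode:
  assumes "\<bar>s\<bar> < 1"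
  shows "(1 - s\<^sup>2) * flux_free' n s = real n * s * flux_free n s"
proof -
  have p: "1 - s\<^sup>2 > 0" using assms by (simp add: abs_square_less_1)
  have "(1 - s\<^sup>2) * (1 - s\<^sup>2) powr (- real n / 2 - 1) = (1 - s\<^sup>2) powr (1 + (- real n / 2 - 1))"
    using p powr_mult_base[of "1 - s\<^sup>2" "- real n / 2 - 1"] by simp
  then show ?thesis by (simp add: flux_free_def flux_free'_def mult_ac)
qed

lemma flux_free_pos: "\<bar>s\<bar> < 1 \<Longrightarrow> flux_free n s > 0"
  by (simp add: flux_free_def abs_square_less_1 abs_square_eq_1)

lemma flux_free'_continuous: "continuous_on {-1<..<1} (flux_free' n)"
  unfolding flux_free'_def[abs_def]
  by (intro continuous_intros) (auto simp: power2_eq_1_iff)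

lemma slope_deriv:
  assumes ac: "-1 < a" "a < c" "c < 1"
  shows "(slope n a c has_real_derivative flux_free' n (clamp a c s)) (at s)"
proof -
  let ?L = "\<lambda>b s. flux_free n b + flux_free' n b * (s - b)"
  have L: "(?L b has_real_derivative flux_free' n b) (at s)" for b s
    by (auto intro!: derivative_eq_intros)
  have "slope n a c = (\<lambda>s. if s \<le> a then ?L a s else (if s \<le> c then flux_free n s else ?L c s))"
    using ac by (auto simp: slope_def clamp_def fun_eq_iff)
  moreover have "flux_free' n (clamp a c s) = (if s \<le> a then flux_free' n a else (if s \<le> c then flux_free' n s else flux_free' n c))"
    using ac by (auto simp: clamp_def)
  moreover have "((\<lambda>s. if s \<le> a then ?L a s else (if s \<le> c then flux_free n s else ?L c s)) has_real_derivative
    (if s \<le> a then flux_free' n a else (if s \<le> c then flux_free' n s else flux_free' n c))) (at s)"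
  proof (rule DERIV_glue_at[OF L])
    assume "a \<le> s"
    then show "((\<lambda>s. if s \<le> c then flux_free n s else ?L c s) has_real_derivative
        (if s \<le> c then flux_free' n s else flux_free' n c)) (at s)"
      using ac by (intro DERIV_glue_at L flux_free_deriv) auto
  qed (use ac in auto)
  ultimately show ?thesis by simp
qed

lemma slope_deriv_continuous:
  assumes ac: "-1 < a" "a < c" "c < 1"
  shows "continuous_on UNIV (\<lambda>s. flux_free' n (clamp a c s))"
  unfolding clamp_def
  by (rule continuous_on_compose2[OF flux_free'_continuous]) (use ac in \<open>auto intro!: continuous_intros\<close>)

lemma slope_pos:
  assumes ac: "-1 < a" "a \<le> 0" "0 < c" "c < 1"
  shows "slope n a c s > 0"
proof -
  have m: "\<bar>clamp a c s\<bar> < 1" using ac by (auto simp: clamp_def)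
  have "0 \<le> flux_free' n (clamp a c s) * (s - clamp a c s)"
  proof -
    consider "s < a" | "a \<le> s" "s \<le> c" | "c < s" by linarith
    then show ?thesis
    proof cases
      case 1
      then have "clamp a c s = a" using ac by (simp add: clamp_def)
      then show ?thesis using 1 ac by (simp add: flux_free'_def mult_nonneg_nonpos mult_nonpos_nonneg mult_nonpos_nonpos)
    next
      case 2
      then have "clamp a c s = s" by (simp add: clamp_def)
      then show ?thesis by simp
    next
      case 3
      then have "clamp a c s = c" using ac by (simp add: clamp_def)
      then show ?thesis using 3 ac by (simp add: flux_free'_def)
    qed
  qed
  then show ?thesis unfolding slope_def using flux_free_pos[OF m, of n] by linarith
qed

lemma source_slope:
  assumes ac: "-1 < a" "a < s" "a < c" "c < 1" "-1 < s"
  shows "real n * s * slope n a c s - (1 - s\<^sup>2) * flux_free' n (clamp a c s) = source n c s"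
proof -
  have c0: "source n c c = 0"
    using flux_free_ode[of c n] ac by (simp add: source_def)
  show "real n * s * slope n a c s - (1 - s\<^sup>2) * flux_free' n (clamp a c s) = source n c s"
  proof (cases "s \<le> c")
    case True
    then have "clamp a c s = s" "max c s = c" using ac by (auto simp: clamp_def)
    moreover have "source n c s = source n c c" using True by (simp add: source_def max_def)
    ultimately show ?thesis using flux_free_ode[of s n] ac True c0 by (simp add: slope_def)
  next
    case False
    then have "clamp a c s = c" "max c s = s" using ac by (auto simp: clamp_def)
    then show ?thesis by (simp add: slope_def source_def Let_def)
  qed
qed

lemma source_sign:
  assumes c: "0 < c" "c < 1" and n: "n \<ge> 1"
  shows "s \<le> c \<Longrightarrow> source n c s = 0" and "c < s \<Longrightarrow> source n c s > 0"
proof -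
  have z: "real n * c * flux_free n c = (1 - c\<^sup>2) * flux_free' n c" using flux_free_ode[of c n] c by simp
  then show "source n c s = 0" if "s \<le> c" using that by (simp add: source_def max_absorb1)
  have pos: "flux_free n c > 0" "flux_free' n c \<ge> 0" using flux_free_pos[of c n] c by (auto simp: flux_free'_def)
  show "source n c s > 0" if s: "c < s"
  proof -
    have "source n c s = real n * (s - c) * flux_free n c + real n * s * (flux_free' n c * (s - c)) + (s\<^sup>2 - c\<^sup>2) * flux_free' n c"
      using s z by (simp add: source_def max_absorb2 algebra_simps)
    moreover have "real n * (s - c) * flux_free n c > 0" using n s pos by simp
    moreover have "real n * s * (flux_free' n c * (s - c)) \<ge> 0" using s c pos by simp
    moreover have "(s\<^sup>2 - c\<^sup>2) * flux_free' n c \<ge> 0" using s c pos by (simp add: power_mono)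
    ultimately show ?thesis by linarith
  qed
qed

lemma source_continuous: "continuous_on UNIV (source n c)"
  unfolding source_def Let_def by (intro continuous_intros)

text \<open>
  Up to the factor \<open>1 / R\<close> the boundary slope is \<open>\<tau>\<close> to the power \<open>(1 - n) / 2\<close> with \<open>\<tau> = 1 - a\<^sup>2\<close>, which
  for \<open>n \<ge> 2\<close> and \<open>\<tau> < 1\<close> is at least \<open>1 / sqrt \<tau>\<close>.
\<close>

lemma boundary_flux_unbounded:
  assumes n: "n \<ge> 2" and R: "R > 0"
  shows "\<exists>a. -1 < a \<and> a < 0 \<and> L \<le> flux_free n a * (sqrt (1 - a\<^sup>2) / R)"
proof -
  define \<tau> where "\<tau> = min (1 / 2) (1 / ((\<bar>L\<bar> + 1) * R)\<^sup>2)"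
  have \<tau>: "0 < \<tau>" "\<tau> \<le> 1 / 2" "\<tau> \<le> 1 / ((\<bar>L\<bar> + 1) * R)\<^sup>2" using R by (auto simp: \<tau>_def)
  define a where "a = - sqrt (1 - \<tau>)"
  have a2: "1 - a\<^sup>2 = \<tau>" using \<tau> by (simp add: a_def)
  have a: "-1 < a" "a < 0" using \<tau> by (auto simp: a_def)
  have "sqrt \<tau> \<le> 1 / ((\<bar>L\<bar> + 1) * R)"
    using real_sqrt_le_mono[OF \<tau>(3)] R by (simp add: real_sqrt_divide)
  moreover have "(\<bar>L\<bar> + 1) * R > 0" using R by (intro mult_pos_pos) auto
  ultimately have "sqrt \<tau> * ((\<bar>L\<bar> + 1) * R) \<le> 1" by (simp only: pos_le_divide_eq)
  moreover have "sqrt \<tau> * R > 0" using \<tau> R by simp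
  ultimately have "\<bar>L\<bar> + 1 \<le> 1 / (sqrt \<tau> * R)" by (simp only: pos_le_divide_eq mult_ac)
  also have "1 / sqrt \<tau> \<le> \<tau> powr (- real n / 2) * sqrt \<tau>"
  proof -
    have "1 / sqrt \<tau> = \<tau> powr (- 1 / 2)" using \<tau> by (simp add: powr_half_sqrt[symmetric] powr_minus_divide)
    also have "\<dots> \<le> \<tau> powr (- real n / 2 + 1 / 2)"
      using \<tau> n by (intro powr_mono') auto
    also have "\<dots> = \<tau> powr (- real n / 2) * \<tau> powr (1 / 2)" by (rule powr_add)
    also have "\<dots> = \<tau> powr (- real n / 2) * sqrt \<tau>" using \<tau> by (simp add: powr_half_sqrt)
    finally show ?thesis .
  qed
  then have "1 / (sqrt \<tau> * R) \<le> \<tau> powr (- real n / 2) * (sqrt \<tau> / R)"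
    using R divide_right_mono[of _ _ R] by fastforce
  finally have "L \<le> flux_free n a * (sqrt (1 - a\<^sup>2) / R)"
    unfolding flux_free_def a2 by simp
  then show ?thesis using a by blast
qed

lemma cap_perimeter_pos:
  fixes p :: "'a::euclidean_space"
  assumes R: "R > 0" and p: "p \<in> sphere 0 R" and c: "0 < c" "c < 1" and dim: "DIM('a) \<ge> 3"
  shows "perimeter R {x \<in> sphere 0 R. c \<le> height R p x} > 0"
  unfolding perimeter_def cap_frontier[OF R p c]
proof (rule parallel_hausdorff_pos[OF R])
  show "norm (p /\<^sub>R R) = 1" using p R by simp
  show "DIM('a) = DIM('a) - 2 + 2" "DIM('a) - 2 \<ge> 1" using dim by auto
  show "\<bar>c\<bar> < 1" using c by simp
  have "height R p x = c \<longleftrightarrow> x \<bullet> (p /\<^sub>R R) = R * c" for x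
    using R by (simp add: height_def field_simps power2_eq_square)
  then show "{x \<in> sphere 0 R. height R p x = c} = {x \<in> sphere 0 R. x \<bullet> (p /\<^sub>R R) = R * c}" by simp
qed

text \<open>
  Points on the boundary parallel belong to the support because every neighbourhood of them meets the
  open cap in a nonempty open set, which has positive volume.
\<close>

lemma ess_supp_cap:
  fixes p :: "'a::euclidean_space"
  assumes R: "R > 0" and p: "p \<in> sphere 0 R" and c: "0 < c" "c < 1"
    and f: "\<And>x. x \<in> sphere 0 R \<Longrightarrow> f x \<noteq> 0 \<longleftrightarrow> c < height R p x"
  shows "ess_supp R f = {x \<in> sphere 0 R. c \<le> height R p x}"
proof (intro equalityI subsetI)
  fix x assume x: "x \<in> ess_supp R f"
  show "x \<in> {x \<in> sphere 0 R. c \<le> height R p x}"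
  proof (rule ccontr)
    assume "x \<notin> {x \<in> sphere 0 R. c \<le> height R p x}"
    moreover have "openin (sph_top R) (sphere 0 R - {x \<in> sphere 0 R. c \<le> height R p x})"
      using closed_cap[of R c p] by (metis openin_diff openin_topspace topspace_euclidean_subtopology)
    ultimately have pos: "emeasure (sph_vol R) {y \<in> sphere 0 R - {x \<in> sphere 0 R. c \<le> height R p x}. f y \<noteq> 0} > 0"
      using x unfolding ess_supp_def by blast
    have empty: "{y \<in> sphere 0 R - {x \<in> sphere 0 R. c \<le> height R p x}. f y \<noteq> 0} = {}"
      using f by auto
    show False using pos unfolding empty by simp
  qed
next
  fix x assume x: "x \<in> {x \<in> sphere 0 R. c \<le> height R p x}"
  have "emeasure (sph_vol R) {y \<in> U. f y \<noteq> 0} > 0" if U: "openin (sph_top R) U" "x \<in> U" for U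
  proof -
    obtain T where T: "open T" "U = sphere 0 R \<inter> T" using U by (auto simp: openin_open)
    have eq: "{y \<in> U. f y \<noteq> 0} = U \<inter> {x \<in> sphere 0 R. c < height R p x}" using f T by auto
    have "U \<inter> {x \<in> sphere 0 R. c < height R p x} \<noteq> {}"
    proof (cases "height R p x = c")
      case True
      obtain y where "y \<in> T \<inter> sphere 0 R" "c < height R p y"
        using sphere_near_level(1)[OF R p _ True c T(1)] x U T by auto
      then show ?thesis using T by auto
    next
      case False
      then show ?thesis using x U by auto
    qed
    then show ?thesis unfolding eq
      by (intro sph_vol_open_pos[OF R] openin_Int U open_cap)
  qed
  then show "x \<in> ess_supp R f" using x unfolding ess_supp_def by blast
qed

lemma profile_antiderivative:
  assumes "continuous_on UNIV (w :: real \<Rightarrow> real)" "\<And>s. w s > 0" "a \<in> {-1..1}"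
  shows "\<exists>F. (\<forall>s\<in>{-1..1}. (F has_real_derivative w s) (at s)) \<and> F a = 0 \<and> (\<forall>s\<in>{-1..1}. F s > 0 \<longleftrightarrow> a < s)"
proof -
  obtain G where G: "\<And>s. s \<in> {-2..2} \<Longrightarrow> (G has_vector_derivative w s) (at s within {-2..2})"
    using antiderivative_continuous[of "-2" 2 w] continuous_on_subset[OF assms(1)] by blast
  define F where "F = (\<lambda>s. G s - G a)"
  have F: "(F has_real_derivative w s) (at s)" if "s \<in> {-1..1}" for s
  proof -
    have "(G has_vector_derivative w s) (at s within {-2<..<2})"
      using G[of s] that by (auto intro: has_vector_derivative_within_subset)
    moreover have "at s within {-2<..<2} = at s" by (rule at_within_open) (use that in auto)
    ultimately have "(G has_real_derivative w s) (at s)"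
      by (simp only: has_real_derivative_iff_has_vector_derivative)
    then show ?thesis unfolding F_def by (auto intro!: derivative_eq_intros)
  qed
  have mono: "F x < F y" if "x < y" "x \<in> {-1..1}" "y \<in> {-1..1}" for x y
  proof (rule DERIV_pos_imp_increasing[OF that(1)])
    fix z assume "x \<le> z" "z \<le> y"
    then have "z \<in> {-1..1}" using that by auto
    then show "\<exists>d. (F has_real_derivative d) (at z) \<and> 0 < d" using F assms(2) by blast
  qed
  have "F s > 0 \<longleftrightarrow> a < s" if "s \<in> {-1..1}" for s
    using mono[of a s] mono[of s a] that assms(3) by (cases s a rule: linorder_cases) (auto simp: F_def)
  then show ?thesis using F by (intro exI[of _ F]) (auto simp: F_def)
qed

lemma cap_QS_solution:
  fixes p :: "'a::euclidean_space"
  assumes R: "R > 0" and p: "p \<in> sphere 0 R" and dim: "DIM('a) = n + 1" and n: "n \<ge> 1"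
    and ac: "-1 < a" "a < 0" "0 < c" "c < 1"
  shows "QS_solution R (\<lambda>x. source n c (height R p x) / R\<^sup>2) (flux_free n a * (sqrt (1 - a\<^sup>2) / R)) {x \<in> sphere 0 R. a < height R p x}"
proof -
  define w where "w = slope n a c"
  have wd: "(w has_real_derivative flux_free' n (clamp a c s)) (at s)" for s
    unfolding w_def using ac by (intro slope_deriv) auto
  have wc: "continuous_on UNIV w" using wd by (meson DERIV_isCont continuous_at_imp_continuous_on)
  have w'c: "continuous_on UNIV (\<lambda>s. flux_free' n (clamp a c s))"
    using ac by (intro slope_deriv_continuous) auto
  have wp: "w s > 0" for s unfolding w_def using ac by (intro slope_pos) auto
  have aI: "a \<in> {-1..1}" using ac by simp
  obtain F where F: "\<And>s. s \<in> {-1..1} \<Longrightarrow> (F has_real_derivative w s) (at s)" "F a = 0"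
    "\<And>s. s \<in> {-1..1} \<Longrightarrow> F s > 0 \<longleftrightarrow> a < s"
    using profile_antiderivative[OF wc wp aI] by blast
  have wa: "w a = flux_free n a" using ac by (simp add: w_def slope_def clamp_def)
  define \<Omega> where "\<Omega> = {x \<in> sphere 0 R. a < height R p x}"
  have pp: "p \<bullet> p = R\<^sup>2" using p by (simp add: power2_norm_eq_inner[symmetric])
  have "H10_with_grad R \<Omega> (\<lambda>x. F (height R p x)) (\<lambda>x. w (height R p x) *\<^sub>R height_grad R p x)"
    unfolding \<Omega>_def by (rule H10_profile[OF R p F(1) continuous_on_subset[OF wc] aI F(2,3)]) auto
  moreover have "weak_poisson R \<Omega> (\<lambda>x. w (height R p x) *\<^sub>R height_grad R p x) (\<lambda>x. source n c (height R p x) / R\<^sup>2)"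
  proof (rule profile_weak_poisson[OF R p wd w'c])
    show "source n c (height R p x) / R\<^sup>2 = ((real DIM('a) - 1) * height R p x * w (height R p x)
        - (1 - (height R p x)\<^sup>2) * flux_free' n (clamp a c (height R p x))) / R\<^sup>2" if "x \<in> \<Omega>" for x
      using source_slope[of a "height R p x" c n] ac that by (simp add: dim w_def \<Omega>_def)
  qed (auto simp: \<Omega>_def)
  moreover have "overdetermined_bc R \<Omega> (\<lambda>x. F (height R p x)) (flux_free n a * (sqrt (1 - a\<^sup>2) / R))"
    unfolding \<Omega>_def wa[symmetric] by (rule profile_overdetermined[OF R p F(1) wc F(2)]) (use wp[of a] in auto)
  moreover have "ess_supp R (\<lambda>x. source n c (height R p x) / R\<^sup>2) \<subseteq> \<Omega>"
  proof -
    have "ess_supp R (\<lambda>x. source n c (height R p x) / R\<^sup>2) = {x \<in> sphere 0 R. c \<le> height R p x}"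
    proof (rule ess_supp_cap[OF R p ac(3,4)])
      show "source n c (height R p x) / R\<^sup>2 \<noteq> 0 \<longleftrightarrow> c < height R p x" for x
        using source_sign[OF ac(3,4) n, of "height R p x"] R by (cases "c < height R p x") auto
    qed
    then show ?thesis using ac by (auto simp: \<Omega>_def)
  qed
  moreover have "openin (sph_top R) \<Omega>" unfolding \<Omega>_def by (rule open_cap)
  moreover have "connected \<Omega>" unfolding \<Omega>_def using ac by (intro open_cap_connected[OF R p]) auto
  moreover have "p \<in> \<Omega>" using p ac R by (simp add: \<Omega>_def height_def pp)
  ultimately show ?thesis unfolding QS_solution_def \<Omega>_def[symmetric] by blast
qed

theorem mainTheorem2:
  fixes p :: "'a::euclidean_space" and n :: nat and R :: real
  assumes "DIM('a) = n + 1" and "n \<ge> 2" and "R > 0" and "p \<in> sphere 0 R"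
  shows "\<exists>(r0::real) (f :: 'a \<Rightarrow> real) (k::real).
    let C = geodesic_cball R p r0 in
      0 < r0 \<and> r0 < pi * R / 2 \<and>
      L2_sphere R f \<and>
      (\<forall>x\<in>sphere 0 R. f x \<ge> 0) \<and>
      (\<forall>x\<in>sphere 0 R. \<forall>y\<in>sphere 0 R. sph_dist R p x = sph_dist R p y \<longrightarrow> f x = f y) \<and>
      ess_supp R f \<subseteq> C \<and>
      (\<forall>x\<in>sph_top R interior_of C. f x > 0) \<and>
      tconv R (ess_supp R f) = C \<and>
      k > 0 \<and>
      (\<exists>\<Omega>. QS_solution R f k \<Omega> \<and> C \<subset> \<Omega>) \<and>
      ennreal (LINT x:C|sph_vol R. f x) < ennreal k * perimeter R C"
proof -
  note dim = assms(1) and n = assms(2) and R = assms(3) and p = assms(4)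
  have dim2: "DIM('a) \<ge> 2" "DIM('a) \<ge> 3" and n1: "n \<ge> 1" using dim n by auto
  define c :: real where "c = 1 / 2"
  have c: "0 < c" "c < 1" "\<bar>c\<bar> \<le> 1" by (auto simp: c_def)
  define r0 where "r0 = R * arccos c"
  define f where "f = (\<lambda>x::'a. source n c (height R p x) / R\<^sup>2)"
  define C where "C = geodesic_cball R p r0"
  have Ceq: "C = {x \<in> sphere 0 R. c \<le> height R p x}"
    unfolding C_def r0_def by (rule geodesic_cball_eq[OF R p dim2(1) c(3)])
  have fs: "f x = 0 \<longleftrightarrow> \<not> c < height R p x" "f x > 0 \<longleftrightarrow> c < height R p x" for x
    using source_sign[OF c(1,2) n1, of "height R p x"] R unfolding f_def by (cases "c < height R p x"; force)+
  have supp: "ess_supp R f = C"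
    unfolding Ceq by (rule ess_supp_cap[OF R p c(1,2)]) (simp add: fs)
  have "arccos c < arccos 0" using c by (intro arccos_less_arccos) auto
  then have r0: "0 < r0" "r0 < pi * R / 2"
    using R arccos_lt_bounded[of c] c by (auto simp: r0_def)
  have fc: "continuous_on UNIV f"
    unfolding f_def using R by (intro continuous_intros continuous_on_compose2[OF source_continuous]) auto
  have L2: "L2_sphere R f"
    unfolding L2_sphere_def
    by (intro conjI continuous_measurable_sph_vol continuous_integrable_sph_vol[OF R] continuous_intros continuous_on_subset[OF fc]) auto
  have radial: "f x = f y" if xy: "x \<in> sphere 0 R" "y \<in> sphere 0 R" and eq: "sph_dist R p x = sph_dist R p y" for x y
  proof -
    have "arccos (p \<bullet> x / R\<^sup>2) = arccos (p \<bullet> y / R\<^sup>2)"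
      using eq R unfolding sph_dist_eq[OF R p xy(1) dim2(1)] sph_dist_eq[OF R p xy(2) dim2(1)] by simp
    then have "p \<bullet> x / R\<^sup>2 = p \<bullet> y / R\<^sup>2"
      using arccos_eq_iff sph_inner_bound[OF R p xy(1)] sph_inner_bound[OF R p xy(2)] by blast
    then show ?thesis unfolding f_def height_def by (simp only: inner_commute[of _ p])
  qed
  have interior: "f x > 0" if "x \<in> sph_top R interior_of C" for x
    using cap_interior[OF R p c(1,2)] that unfolding Ceq fs by blast
  have tc: "tconv R (ess_supp R f) = C"
    unfolding supp Ceq by (rule tconv_cap[OF R p dim2(1) c(1)])
  define I where "I = (LINT x:C|sph_vol R. f x)"
  have P: "perimeter R C > 0" unfolding Ceq by (rule cap_perimeter_pos[OF R p c(1,2) dim2(2)])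
  \<comment> \<open>The perimeter might be infinite; a finite positive lower bound is all that is used.\<close>
  obtain q where q: "0 < q" "ennreal q \<le> perimeter R C"
  proof (cases "perimeter R C = \<infinity>")
    case True
    then show ?thesis using that[of 1] by simp
  next
    case False
    then show ?thesis using P that[of "enn2real (perimeter R C)"]
      by (simp add: enn2real_positive_iff less_top)
  qed
  obtain a where a: "-1 < a" "a < 0" and aL: "(\<bar>I\<bar> + 1) / q \<le> flux_free n a * (sqrt (1 - a\<^sup>2) / R)"
    using boundary_flux_unbounded[OF n R] by blast
  define k where "k = flux_free n a * (sqrt (1 - a\<^sup>2) / R)"
  have k: "(\<bar>I\<bar> + 1) / q \<le> k" using aL by (simp add: k_def)
  have "0 < (\<bar>I\<bar> + 1) / q" using q by (intro divide_pos_pos) auto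
  then have kpos: "k > 0" using k by linarith
  have "\<bar>I\<bar> + 1 \<le> k * q" using k q by (simp add: pos_divide_le_eq)
  then have "ennreal I < ennreal (k * q)" using kpos q by (intro ennreal_lessI) auto
  also have "ennreal (k * q) = ennreal k * ennreal q" using kpos q by (intro ennreal_mult) auto
  also have "\<dots> \<le> ennreal k * perimeter R C" using q by (intro mult_left_mono) auto
  finally have final: "ennreal I < ennreal k * perimeter R C" .
  define \<Omega> where "\<Omega> = {x \<in> sphere 0 R. a < height R p x}"
  have QS: "QS_solution R f k \<Omega>"
    unfolding f_def k_def \<Omega>_def by (rule cap_QS_solution[OF R p dim n1 a c(1,2)])
  obtain z0 where z0: "z0 \<noteq> 0" "orthogonal p z0"
    using orthogonal_to_vector_exists[OF dim2(1)] by blast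
  have "height R p (rproj R z0) = 0" using z0 by (simp add: height_def rproj_def orthogonal_def inner_commute)
  then have "rproj R z0 \<in> \<Omega> - C" using rproj_sphere[OF R z0(1)] a c by (simp add: \<Omega>_def Ceq)
  moreover have "C \<subseteq> \<Omega>" using a c by (auto simp: \<Omega>_def Ceq)
  ultimately have sub: "C \<subset> \<Omega>" by blast
  have nonneg: "f x \<ge> 0" for x using fs[of x] by (cases "c < height R p x") auto
  show ?thesis
    unfolding Let_def
  proof (rule exI[of _ r0], rule exI[of _ f], rule exI[of _ k], fold C_def, fold I_def, intro conjI ballI impI)
    show "ess_supp R f \<subseteq> C" using supp by simp
    show "\<exists>\<Omega>. QS_solution R f k \<Omega> \<and> C \<subset> \<Omega>" using QS sub by blast
  qed (rule r0 L2 nonneg tc kpos final | erule interior | erule (2) radial)+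
qed

end
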